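(* Let $K$ be a commutative ring with unit that is both a $\mathbb{Q}$-ring (contains $\mathbb{Q}$ as a subring) and an integral domain, let $\chi=(\chi_d\colon W_d\to U(K))_{d\ge1}$ be an $\omega$-invariant sequence of characters, and let $E$ be a $K$-module with finite basis. The addition and the external composition law $(a,a^* )\mapsto a\rfloor a^*$ ($a\in[\chi](E)$, $a^*\in[\chi](E^* )$) on $[\chi](E^* )$ define on this set a structure of left unital $[\chi](E)$-module.
   Context: $S_\infty$ is the group of permutations of the positive integers fixing all but finitely many elements, $S_d\le S_\infty$ the subgroup fixing all $t>d$, and $\omega\colon S_\infty\to S_\infty$ the injective endomorphism $(\omega(\sigma))(1)=1$, $(\omega(\sigma))(t)=\sigma(t-1)+1$ for $t\ge2$. A sequence of group homomorphisms $\chi=(\chi_d\colon W_d\to U(K))_{d\ge1}$ ($U(K)$ the group of units of $K$) is $\omega$-invariant if $W_d\le S_d$, $W_d\le W_{d+1}$, $\omega(W_d)\le W_{d+1}$, and $\chi_{d+1}|_{W_d}=\chi_d=\chi_{d+1}\circ\omega|_{W_d}$ for all $d\ge1$. We write $\chi(\sigma)=\chi_d(\sigma)$ for $\sigma\in W_d$. It is known that then $\chi_d=\chi_d^{-1}$ for all $d$. $S_d$ acts on $T^d(E)$ by $\sigma(x_1\otimes\cdots\otimes x_d)=x_{\sigma^{-1}(1)}\otimes\cdots\otimes x_{\sigma^{-1}(d)}$. $[\chi]^d(E)$ is the quotient of $T^d(E)$ by the submodule generated by all $\chi_d(\sigma)^{-1}z-\sigma z$, $\sigma\in W_d$, $z\in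 T^d(E)$; $[\chi]^0(E)=K$; the image of $x_1\otimes\cdots\otimes x_d$ is $x_1\chi\ldots\chi x_d$. $[\chi](E)=\coprod_{d\ge0}[\chi]^d(E)$ is an associative graded $K$-algebra with unit, with product (also denoted by $\chi$) $(x_1\chi\ldots\chi x_d)\chi(y_1\chi\ldots\chi y_e)=x_1\chi\ldots\chi x_d\chi y_1\chi\ldots\chi y_e$. $\langle\ ,\ \rangle\colon[\chi](E)\times[\chi](E^* )\to K$ is the bilinear form for which components of different degrees are orthogonal, $\langle x_1\chi\ldots\chi x_d,x_1^*\chi\ldots\chi x_d^*\rangle=\sum_{\sigma\in W_d}\chi(\sigma)\prod_{t=1}^d x_t^*(x_{\sigma^{-1}(t)})$ for $d\ge1$, and $\langle k,k^*\rangle=kk^*$ in degree $0$; it induces isomorphisms $[\chi]^d(E^* )\cong([\chi]^d(E))^*$, hence identifies $[\chi](E^* )$ with the graded dual of $[\chi](E)$. Left inner product: for $a\in[\chi](E)$ and $a^*\in[\chi](E^* )$, $a\rfloor a^*\in[\chi](E^* )$ is the image of $a^*$ under the transpose of the right multiplication $x\mapsto x\chi a$ of $[\chi](E)$; i.e. it is the unique element with $\langle x\chi a,a^*\rangle=\langle x,a\rfloor a^*\rangle$ for all $x\in[\chi](E)$. *)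

theory Defs
  imports Complex_Main "HOL-Algebra.Sym_Groups" "HOL-Algebra.AbelCoset" "HOL-Algebra.Module"
begin

definition rat_ring :: "rat ring" where
  "rat_ring = \<lparr>carrier = UNIV, monoid.mult = (*), one = 1, zero = 0, add = (+)\<rparr>"

definition contains_rat :: "('k, 'm) ring_scheme \<Rightarrow> bool" where
  "contains_rat K \<longleftrightarrow> (\<exists>h \<in> ring_hom rat_ring K. inj_on h UNIV)"

text \<open>Permutations of the positive integers are functions on \<^typ>\<open>nat\<close> fixing 0; the subgroup
  of those fixing all \<open>t > d\<close> is \<^term>\<open>sym_group d\<close>.\<close>

definition omega :: "(nat \<Rightarrow> nat) \<Rightarrow> nat \<Rightarrow> nat" where
  "omega \<sigma> t = (if t \<le> 1 then t else \<sigma> (t - 1) + 1)"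

definition omega_invariant ::
    "('k, 'm) ring_scheme \<Rightarrow> (nat \<Rightarrow> (nat \<Rightarrow> nat) set) \<Rightarrow> (nat \<Rightarrow> (nat \<Rightarrow> nat) \<Rightarrow> 'k) \<Rightarrow> bool" where
  "omega_invariant K W \<chi> \<longleftrightarrow>
    (\<forall>d\<ge>1. subgroup (W d) (sym_group d) \<and>
           \<chi> d \<in> hom (sym_group d\<lparr>carrier := W d\<rparr>) (units_of K) \<and>
           W d \<subseteq> W (d + 1) \<and> omega ` W d \<subseteq> W (d + 1) \<and>
           (\<forall>\<sigma>\<in>W d. \<chi> (d + 1) \<sigma> = \<chi> d \<sigma> \<and> \<chi> (d + 1) (omega \<sigma>) = \<chi> d \<sigma>))"

definition module_basis :: "('k, 'm) ring_scheme \<Rightarrow> ('k, 'e, 'n) module_scheme \<Rightarrow> 'e set \<Rightarrow> bool" where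
  "module_basis K E B \<longleftrightarrow> B \<subseteq> carrier E \<and>
    (\<forall>x\<in>carrier E. \<exists>S c. finite S \<and> S \<subseteq> B \<and> c \<in> S \<rightarrow> carrier K \<and>
       x = (\<Oplus>\<^bsub>E\<^esub>b\<in>S. c b \<odot>\<^bsub>E\<^esub> b)) \<and>
    (\<forall>S c. finite S \<and> S \<subseteq> B \<and> c \<in> S \<rightarrow> carrier K \<and>
       (\<Oplus>\<^bsub>E\<^esub>b\<in>S. c b \<odot>\<^bsub>E\<^esub> b) = \<zero>\<^bsub>E\<^esub> \<longrightarrow> (\<forall>b\<in>S. c b = \<zero>\<^bsub>K\<^esub>))"

text \<open>The fields \<^const>\<open>monoid.mult\<close> and \<^const>\<open>one\<close> of a record that is only used as a module
  are left unspecified.\<close>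

definition dual_module :: "('k, 'm) ring_scheme \<Rightarrow> ('k, 'e, 'n) module_scheme \<Rightarrow> ('k, 'e \<Rightarrow> 'k) module" where
  "dual_module K E =
    \<lparr>carrier = {f \<in> carrier E \<rightarrow>\<^sub>E carrier K.
       (\<forall>x\<in>carrier E. \<forall>y\<in>carrier E. f (x \<oplus>\<^bsub>E\<^esub> y) = f x \<oplus>\<^bsub>K\<^esub> f y) \<and>
       (\<forall>k\<in>carrier K. \<forall>x\<in>carrier E. f (k \<odot>\<^bsub>E\<^esub> x) = k \<otimes>\<^bsub>K\<^esub> f x)},
     monoid.mult = undefined, one = undefined,
     zero = (\<lambda>x\<in>carrier E. \<zero>\<^bsub>K\<^esub>),
     add = (\<lambda>f g. \<lambda>x\<in>carrier E. f x \<oplus>\<^bsub>K\<^esub> g x),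
     smult = (\<lambda>k f. \<lambda>x\<in>carrier E. k \<otimes>\<^bsub>K\<^esub> f x)\<rparr>"

definition generated_submodule ::
    "('k, 'm) ring_scheme \<Rightarrow> ('k, 'a, 'n) module_scheme \<Rightarrow> 'a set \<Rightarrow> 'a set" where
  "generated_submodule K M S = \<Inter>{N. submodule N K M \<and> S \<subseteq> N}"

definition quot_module :: "('k, 'a, 'n) module_scheme \<Rightarrow> 'a set \<Rightarrow> ('k, 'a set) module" where
  "quot_module M N =
    \<lparr>carrier = a_rcosets\<^bsub>M\<^esub> N, monoid.mult = undefined, one = undefined,
     zero = N, add = set_add M,
     smult = (\<lambda>k A. \<Union>a\<in>A. N +>\<^bsub>M\<^esub> (k \<odot>\<^bsub>M\<^esub> a))\<rparr>"

definition free_module :: "('k, 'm) ring_scheme \<Rightarrow> 'x set \<Rightarrow> ('k, 'x \<Rightarrow> 'k) module" where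
  "free_module K X =
    \<lparr>carrier = {u. (\<forall>x. u x \<in> carrier K) \<and> (\<forall>x. x \<notin> X \<longrightarrow> u x = \<zero>\<^bsub>K\<^esub>) \<and>
                   finite {x. u x \<noteq> \<zero>\<^bsub>K\<^esub>}},
     monoid.mult = undefined, one = undefined,
     zero = (\<lambda>_. \<zero>\<^bsub>K\<^esub>),
     add = (\<lambda>u v x. u x \<oplus>\<^bsub>K\<^esub> v x),
     smult = (\<lambda>k u x. k \<otimes>\<^bsub>K\<^esub> u x)\<rparr>"

definition gen :: "('k, 'm) ring_scheme \<Rightarrow> 'x \<Rightarrow> 'x \<Rightarrow> 'k" where
  "gen K x = (\<lambda>y. if y = x then \<one>\<^bsub>K\<^esub> else \<zero>\<^bsub>K\<^esub>)"

text \<open>The linear extension of a map from the basis \<^term>\<open>X\<close> of \<^term>\<open>free_module K X\<close> to \<^term>\<open>M\<close>.\<close>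

definition lin_ext ::
    "('k, 'm) ring_scheme \<Rightarrow> ('k, 'a, 'n) module_scheme \<Rightarrow> ('x \<Rightarrow> 'a) \<Rightarrow> ('x \<Rightarrow> 'k) \<Rightarrow> 'a" where
  "lin_ext K M f u = (\<Oplus>\<^bsub>M\<^esub>x\<in>{x. u x \<noteq> \<zero>\<^bsub>K\<^esub>}. u x \<odot>\<^bsub>M\<^esub> f x)"

text \<open>The tensor power \<open>T\<^sup>d(E)\<close>, the quotient of the free module on the \<open>d\<close>-tuples of elements
  of \<open>E\<close> by the multilinearity relations.\<close>

definition tuples :: "('k, 'e, 'n) module_scheme \<Rightarrow> nat \<Rightarrow> 'e list set" where
  "tuples E d = {w. length w = d \<and> set w \<subseteq> carrier E}"

abbreviation free_tensors ::
    "('k, 'm) ring_scheme \<Rightarrow> ('k, 'e, 'n) module_scheme \<Rightarrow> nat \<Rightarrow> ('k, 'e list \<Rightarrow> 'k) module" where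
  "free_tensors K E d \<equiv> free_module K (tuples E d)"

definition multilinear_rels ::
    "('k, 'm) ring_scheme \<Rightarrow> ('k, 'e, 'n) module_scheme \<Rightarrow> nat \<Rightarrow> ('e list \<Rightarrow> 'k) set" where
  "multilinear_rels K E d =
    generated_submodule K (free_tensors K E d)
     ({gen K (w[i := x \<oplus>\<^bsub>E\<^esub> y])
         \<ominus>\<^bsub>free_tensors K E d\<^esub> (gen K (w[i := x]) \<oplus>\<^bsub>free_tensors K E d\<^esub> gen K (w[i := y]))
       | w i x y. w \<in> tuples E d \<and> i < d \<and> x \<in> carrier E \<and> y \<in> carrier E} \<union>
      {gen K (w[i := k \<odot>\<^bsub>E\<^esub> x])
         \<ominus>\<^bsub>free_tensors K E d\<^esub> (k \<odot>\<^bsub>free_tensors K E d\<^esub> gen K (w[i := x]))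
       | w i k x. w \<in> tuples E d \<and> i < d \<and> k \<in> carrier K \<and> x \<in> carrier E})"

definition tensor_power ::
    "('k, 'm) ring_scheme \<Rightarrow> ('k, 'e, 'n) module_scheme \<Rightarrow> nat \<Rightarrow> ('k, ('e list \<Rightarrow> 'k) set) module" where
  "tensor_power K E d = quot_module (free_tensors K E d) (multilinear_rels K E d)"

text \<open>Tuples are indexed from 1 in the mathematics but from 0 as lists: \<open>x\<^sub>t\<close> is \<open>w ! (t - 1)\<close>.\<close>

definition perm_tuple :: "(nat \<Rightarrow> nat) \<Rightarrow> 'e list \<Rightarrow> 'e list" where
  "perm_tuple \<sigma> w = map (\<lambda>t. w ! (inv' \<sigma> t - 1)) [1..<length w + 1]"

definition tensor_act ::
    "('k, 'm) ring_scheme \<Rightarrow> ('k, 'e, 'n) module_scheme \<Rightarrow> nat \<Rightarrow> (nat \<Rightarrow> nat)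
      \<Rightarrow> ('e list \<Rightarrow> 'k) set \<Rightarrow> ('e list \<Rightarrow> 'k) set" where
  "tensor_act K E d \<sigma> z =
    (\<Union>u\<in>z. multilinear_rels K E d +>\<^bsub>free_tensors K E d\<^esub>
              lin_ext K (free_tensors K E d) (\<lambda>w. gen K (perm_tuple \<sigma> w)) u)"

text \<open>The product \<open>T\<^sup>d(E) \<times> T\<^sup>e(E) \<rightarrow> T\<^sup>d\<^sup>+\<^sup>e(E)\<close> induced by concatenation of tuples.\<close>

definition tensor_mult ::
    "('k, 'm) ring_scheme \<Rightarrow> ('k, 'e, 'n) module_scheme \<Rightarrow> nat \<Rightarrow> nat
      \<Rightarrow> ('e list \<Rightarrow> 'k) set \<Rightarrow> ('e list \<Rightarrow> 'k) set \<Rightarrow> ('e list \<Rightarrow> 'k) set" where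
  "tensor_mult K E d e y z =
    (\<Union>u\<in>y. \<Union>v\<in>z. multilinear_rels K E (d + e) +>\<^bsub>free_tensors K E (d + e)\<^esub>
       lin_ext K (free_tensors K E (d + e))
         (\<lambda>w. lin_ext K (free_tensors K E (d + e)) (\<lambda>w'. gen K (w @ w')) v) u)"

text \<open>In degree 0 there are no relations, so that \<open>[\<chi>]\<^sup>0(E) = T\<^sup>0(E)\<close> is the free module on the
  empty tuple, with \<open>k \<in> K\<close> corresponding to the class of \<open>k\<close> times the empty tuple. The values
  of \<open>W\<close> and \<open>\<chi>\<close> at 0 are never used.\<close>

definition chi_rels ::
    "('k, 'm) ring_scheme \<Rightarrow> (nat \<Rightarrow> (nat \<Rightarrow> nat) set) \<Rightarrow> (nat \<Rightarrow> (nat \<Rightarrow> nat) \<Rightarrow> 'k)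
      \<Rightarrow> ('k, 'e, 'n) module_scheme \<Rightarrow> nat \<Rightarrow> ('e list \<Rightarrow> 'k) set set" where
  "chi_rels K W \<chi> E d =
    generated_submodule K (tensor_power K E d)
      {((inv\<^bsub>K\<^esub> (\<chi> d \<sigma>)) \<odot>\<^bsub>tensor_power K E d\<^esub> z) \<ominus>\<^bsub>tensor_power K E d\<^esub> tensor_act K E d \<sigma> z
       | \<sigma> z. d \<ge> 1 \<and> \<sigma> \<in> W d \<and> z \<in> carrier (tensor_power K E d)}"

definition chi_power ::
    "('k, 'm) ring_scheme \<Rightarrow> (nat \<Rightarrow> (nat \<Rightarrow> nat) set) \<Rightarrow> (nat \<Rightarrow> (nat \<Rightarrow> nat) \<Rightarrow> 'k)
      \<Rightarrow> ('k, 'e, 'n) module_scheme \<Rightarrow> nat \<Rightarrow> ('k, ('e list \<Rightarrow> 'k) set set) module" where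
  "chi_power K W \<chi> E d = quot_module (tensor_power K E d) (chi_rels K W \<chi> E d)"

definition chi_mult ::
    "('k, 'm) ring_scheme \<Rightarrow> (nat \<Rightarrow> (nat \<Rightarrow> nat) set) \<Rightarrow> (nat \<Rightarrow> (nat \<Rightarrow> nat) \<Rightarrow> 'k)
      \<Rightarrow> ('k, 'e, 'n) module_scheme \<Rightarrow> nat \<Rightarrow> nat
      \<Rightarrow> ('e list \<Rightarrow> 'k) set set \<Rightarrow> ('e list \<Rightarrow> 'k) set set \<Rightarrow> ('e list \<Rightarrow> 'k) set set" where
  "chi_mult K W \<chi> E d e A B =
    (\<Union>y\<in>A. \<Union>z\<in>B. chi_rels K W \<chi> E (d + e) +>\<^bsub>tensor_power K E (d + e)\<^esub> tensor_mult K E d e y z)"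

definition chi_one ::
    "('k, 'm) ring_scheme \<Rightarrow> (nat \<Rightarrow> (nat \<Rightarrow> nat) set) \<Rightarrow> (nat \<Rightarrow> (nat \<Rightarrow> nat) \<Rightarrow> 'k)
      \<Rightarrow> ('k, 'e, 'n) module_scheme \<Rightarrow> ('e list \<Rightarrow> 'k) set set" where
  "chi_one K W \<chi> E =
    chi_rels K W \<chi> E 0 +>\<^bsub>tensor_power K E 0\<^esub> (multilinear_rels K E 0 +>\<^bsub>free_tensors K E 0\<^esub> gen K [])"

text \<open>The graded algebra \<open>[\<chi>](E)\<close>; an element is the family of its homogeneous components.\<close>

definition chi_algebra ::
    "('k, 'm) ring_scheme \<Rightarrow> (nat \<Rightarrow> (nat \<Rightarrow> nat) set) \<Rightarrow> (nat \<Rightarrow> (nat \<Rightarrow> nat) \<Rightarrow> 'k)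
      \<Rightarrow> ('k, 'e, 'n) module_scheme \<Rightarrow> ('k, nat \<Rightarrow> ('e list \<Rightarrow> 'k) set set) module" where
  "chi_algebra K W \<chi> E =
    \<lparr>carrier = {a. (\<forall>d. a d \<in> carrier (chi_power K W \<chi> E d)) \<and>
                   finite {d. a d \<noteq> \<zero>\<^bsub>chi_power K W \<chi> E d\<^esub>}},
     monoid.mult = (\<lambda>a b n. \<Oplus>\<^bsub>chi_power K W \<chi> E n\<^esub>d\<in>{..n}. chi_mult K W \<chi> E d (n - d) (a d) (b (n - d))),
     one = (\<lambda>d. if d = 0 then chi_one K W \<chi> E else \<zero>\<^bsub>chi_power K W \<chi> E d\<^esub>),
     zero = (\<lambda>d. \<zero>\<^bsub>chi_power K W \<chi> E d\<^esub>),
     add = (\<lambda>a b d. a d \<oplus>\<^bsub>chi_power K W \<chi> E d\<^esub> b d),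
     smult = (\<lambda>k a d. k \<odot>\<^bsub>chi_power K W \<chi> E d\<^esub> a d)\<rparr>"

text \<open>The bilinear form: \<open>tuple_form\<close> is its value on \<open>x\<^sub>1\<chi>\<dots>\<chi>x\<^sub>d\<close> and \<open>x\<^sub>1\<^sup>*\<chi>\<dots>\<chi>x\<^sub>d\<^sup>*\<close>, extended
  bilinearly by \<open>free_form\<close>. An element \<open>A\<close> of \<open>[\<chi>]\<^sup>d(E)\<close> is a class of classes, and \<open>\<Union>A\<close> is the
  set of its representatives in the free module on the \<open>d\<close>-tuples.\<close>

definition tuple_form ::
    "('k, 'm) ring_scheme \<Rightarrow> (nat \<Rightarrow> (nat \<Rightarrow> nat) set) \<Rightarrow> (nat \<Rightarrow> (nat \<Rightarrow> nat) \<Rightarrow> 'k)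
      \<Rightarrow> nat \<Rightarrow> 'e list \<Rightarrow> ('e \<Rightarrow> 'k) list \<Rightarrow> 'k" where
  "tuple_form K W \<chi> d w w' =
    (if d = 0 then \<one>\<^bsub>K\<^esub>
     else \<Oplus>\<^bsub>K\<^esub>\<sigma>\<in>W d. \<chi> d \<sigma> \<otimes>\<^bsub>K\<^esub> (\<Otimes>\<^bsub>K\<^esub>t\<in>{1..d}. (w' ! (t - 1)) (w ! (inv' \<sigma> t - 1))))"

definition free_form ::
    "('k, 'm) ring_scheme \<Rightarrow> (nat \<Rightarrow> (nat \<Rightarrow> nat) set) \<Rightarrow> (nat \<Rightarrow> (nat \<Rightarrow> nat) \<Rightarrow> 'k)
      \<Rightarrow> nat \<Rightarrow> ('e list \<Rightarrow> 'k) \<Rightarrow> (('e \<Rightarrow> 'k) list \<Rightarrow> 'k) \<Rightarrow> 'k" where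
  "free_form K W \<chi> d u v =
    (\<Oplus>\<^bsub>K\<^esub>w\<in>{w. u w \<noteq> \<zero>\<^bsub>K\<^esub>}. \<Oplus>\<^bsub>K\<^esub>w'\<in>{w'. v w' \<noteq> \<zero>\<^bsub>K\<^esub>}.
       u w \<otimes>\<^bsub>K\<^esub> v w' \<otimes>\<^bsub>K\<^esub> tuple_form K W \<chi> d w w')"

definition chi_power_form ::
    "('k, 'm) ring_scheme \<Rightarrow> (nat \<Rightarrow> (nat \<Rightarrow> nat) set) \<Rightarrow> (nat \<Rightarrow> (nat \<Rightarrow> nat) \<Rightarrow> 'k)
      \<Rightarrow> nat \<Rightarrow> ('e list \<Rightarrow> 'k) set set \<Rightarrow> (('e \<Rightarrow> 'k) list \<Rightarrow> 'k) set set \<Rightarrow> 'k" where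
  "chi_power_form K W \<chi> d A B = (THE k. \<forall>u\<in>\<Union>A. \<forall>v\<in>\<Union>B. k = free_form K W \<chi> d u v)"

definition chi_form ::
    "('k, 'm) ring_scheme \<Rightarrow> (nat \<Rightarrow> (nat \<Rightarrow> nat) set) \<Rightarrow> (nat \<Rightarrow> (nat \<Rightarrow> nat) \<Rightarrow> 'k)
      \<Rightarrow> ('k, 'e, 'n) module_scheme
      \<Rightarrow> (nat \<Rightarrow> ('e list \<Rightarrow> 'k) set set) \<Rightarrow> (nat \<Rightarrow> (('e \<Rightarrow> 'k) list \<Rightarrow> 'k) set set) \<Rightarrow> 'k" where
  "chi_form K W \<chi> E a b =
    (\<Oplus>\<^bsub>K\<^esub>d\<in>{d. a d \<noteq> \<zero>\<^bsub>chi_power K W \<chi> E d\<^esub> \<and> b d \<noteq> \<zero>\<^bsub>chi_power K W \<chi> (dual_module K E) d\<^esub>}.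
       chi_power_form K W \<chi> d (a d) (b d))"

definition left_inner ::
    "('k, 'm) ring_scheme \<Rightarrow> (nat \<Rightarrow> (nat \<Rightarrow> nat) set) \<Rightarrow> (nat \<Rightarrow> (nat \<Rightarrow> nat) \<Rightarrow> 'k)
      \<Rightarrow> ('k, 'e, 'n) module_scheme
      \<Rightarrow> (nat \<Rightarrow> ('e list \<Rightarrow> 'k) set set) \<Rightarrow> (nat \<Rightarrow> (('e \<Rightarrow> 'k) list \<Rightarrow> 'k) set set)
      \<Rightarrow> nat \<Rightarrow> (('e \<Rightarrow> 'k) list \<Rightarrow> 'k) set set" where
  "left_inner K W \<chi> E a b =
    (THE c. c \<in> carrier (chi_algebra K W \<chi> (dual_module K E)) \<and>
       (\<forall>x\<in>carrier (chi_algebra K W \<chi> E).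
          chi_form K W \<chi> E (x \<otimes>\<^bsub>chi_algebra K W \<chi> E\<^esub> a) b = chi_form K W \<chi> E x c))"

text \<open>\<^locale>\<open>module\<close> requires a commutative ring of scalars, which \<open>[\<chi>](E)\<close> need not be.\<close>

locale left_unital_module = R?: ring R + M?: abelian_group M
  for R (structure) and M (structure) +
  fixes act
  assumes act_closed: "\<lbrakk>a \<in> carrier R; m \<in> carrier M\<rbrakk> \<Longrightarrow> act a m \<in> carrier M"
    and act_l_distr: "\<lbrakk>a \<in> carrier R; b \<in> carrier R; m \<in> carrier M\<rbrakk> \<Longrightarrow>
      act (a \<oplus>\<^bsub>R\<^esub> b) m = act a m \<oplus>\<^bsub>M\<^esub> act b m"
    and act_r_distr: "\<lbrakk>a \<in> carrier R; m \<in> carrier M; n \<in> carrier M\<rbrakk> \<Longrightarrow>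
      act a (m \<oplus>\<^bsub>M\<^esub> n) = act a m \<oplus>\<^bsub>M\<^esub> act a n"
    and act_assoc: "\<lbrakk>a \<in> carrier R; b \<in> carrier R; m \<in> carrier M\<rbrakk> \<Longrightarrow>
      act (a \<otimes>\<^bsub>R\<^esub> b) m = act a (act b m)"
    and act_one: "m \<in> carrier M \<Longrightarrow> act \<one>\<^bsub>R\<^esub> m = m"

end

theory Submission
  imports Defs
begin

text \<open>
  The form pairs \<open>[\<chi>](E)\<close> with \<open>[\<chi>](E\<^sup>*)\<close>, and \<open>a \<rfloor> _\<close> is the adjoint of right multiplication by
  \<open>a\<close>; once adjoints exist and are unique, the module laws are the transposes of the ring laws of
  \<open>[\<chi>](E)\<close>. So the point is that the form induces an isomorphism from \<open>[\<chi>]\<^sup>d(E\<^sup>*)\<close> onto the dual of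
  \<open>[\<chi>]\<^sup>d(E)\<close>. With dual bases and \<open>1/|W\<^sub>d|\<close> available, both directions are explicit: a functional
  \<open>\<phi>\<close> is represented by \<open>1/|W\<^sub>d|\<close> times the sum over basis words \<open>w\<close> of \<open>\<phi>(w) w\<^sup>*\<close>, and \<open>v\<close> equals
  \<open>1/|W\<^sub>d|\<close> times the sum of \<open>\<langle>w, v\<rangle> w\<^sup>*\<close>.

  The form is compatible with the relations in its second argument only because \<open>\<chi>\<^sub>d = \<chi>\<^sub>d\<^sup>-\<^sup>1\<close>. To see
  this, let \<open>G\<close> be the union of the \<open>W\<^sub>d\<close>. The commutator of \<open>g \<in> G\<close> with the shift of \<open>g\<close> whose support
  meets that of \<open>g\<close> in exactly one point is a 3-cycle. Shift invariance and finiteness of supports then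
  put the 3-cycle \<open>(x, g x, g (g x))\<close> into \<open>G\<close> for every \<open>x\<close> at which these three points are distinct.
  The character is trivial on 3-cycles, so they can be split off until \<open>g\<close> is an involution.
\<close>

section \<open>Linear maps, quotients and free modules\<close>

text \<open>Averaging over \<open>W d\<close> stands in for a basis of the powers of the dual. The
  classes of basis words generate them, but words of one orbit have proportional classes, and a word
  fixed by some \<open>\<sigma>\<close> with \<open>\<chi> d \<sigma> \<noteq> 1\<close> has a class
  annihilated by \<open>1 - \<chi> d \<sigma>\<close>. Choosing orbit representatives would mean
  tracking stabilizers. In a sum over all words, the words of one orbit are met through the elements
  of the group, each contributing the same term with the square of the character as weight, so that
  the factor is the order of the group whatever the stabilizers are. The other obstacle is the
  encoding: the powers are quotients of quotients, and their operations are unions over all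
  representatives. Everything is therefore pulled back to the free modules on tuples. A map given
  there on generators descends as soon as it is multilinear and transforms correctly under
  \<open>W d\<close>, and identities between linear maps are checked on generators only.\<close>

definition lin_map ::
    "('k, 'm) ring_scheme \<Rightarrow> ('k, 'a, 'p) module_scheme \<Rightarrow> ('k, 'b, 'q) module_scheme \<Rightarrow> ('a \<Rightarrow> 'b) \<Rightarrow> bool" where
  "lin_map K M N f \<longleftrightarrow> f \<in> carrier M \<rightarrow> carrier N \<and>
    (\<forall>x\<in>carrier M. \<forall>y\<in>carrier M. f (x \<oplus>\<^bsub>M\<^esub> y) = f x \<oplus>\<^bsub>N\<^esub> f y) \<and>
    (\<forall>k\<in>carrier K. \<forall>x\<in>carrier M. f (k \<odot>\<^bsub>M\<^esub> x) = k \<odot>\<^bsub>N\<^esub> f x)"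

lemma lin_mapI:
  assumes "\<And>x. x \<in> carrier M \<Longrightarrow> f x \<in> carrier N"
    and "\<And>x y. x \<in> carrier M \<Longrightarrow> y \<in> carrier M \<Longrightarrow> f (x \<oplus>\<^bsub>M\<^esub> y) = f x \<oplus>\<^bsub>N\<^esub> f y"
    and "\<And>k x. k \<in> carrier K \<Longrightarrow> x \<in> carrier M \<Longrightarrow> f (k \<odot>\<^bsub>M\<^esub> x) = k \<odot>\<^bsub>N\<^esub> f x"
  shows "lin_map K M N f"
  using assms by (auto simp: lin_map_def)

lemma lin_map_closed: "lin_map K M N f \<Longrightarrow> x \<in> carrier M \<Longrightarrow> f x \<in> carrier N"
  and lin_map_add: "lin_map K M N f \<Longrightarrow> x \<in> carrier M \<Longrightarrow> y \<in> carrier M \<Longrightarrow> f (x \<oplus>\<^bsub>M\<^esub> y) = f x \<oplus>\<^bsub>N\<^esub> f y"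
  and lin_map_smult: "lin_map K M N f \<Longrightarrow> k \<in> carrier K \<Longrightarrow> x \<in> carrier M \<Longrightarrow> f (k \<odot>\<^bsub>M\<^esub> x) = k \<odot>\<^bsub>N\<^esub> f x"
  by (auto simp: lin_map_def)

lemma lin_map_zero:
  assumes "module K M" "module K N" "lin_map K M N f"
  shows "f \<zero>\<^bsub>M\<^esub> = \<zero>\<^bsub>N\<^esub>"
proof -
  interpret M: module K M by fact
  interpret N: module K N by fact
  have "f (\<zero>\<^bsub>K\<^esub> \<odot>\<^bsub>M\<^esub> \<zero>\<^bsub>M\<^esub>) = \<zero>\<^bsub>K\<^esub> \<odot>\<^bsub>N\<^esub> f \<zero>\<^bsub>M\<^esub>"
    by (rule lin_map_smult[OF assms(3)]) auto
  then show ?thesis using lin_map_closed[OF assms(3)] by simp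
qed

lemma lin_map_minus:
  assumes "module K M" "module K N" "lin_map K M N f" "x \<in> carrier M"
  shows "f (\<ominus>\<^bsub>M\<^esub> x) = \<ominus>\<^bsub>N\<^esub> f x"
proof -
  interpret M: module K M by fact
  interpret N: module K N by fact
  have c: "f x \<in> carrier N" "f (\<ominus>\<^bsub>M\<^esub> x) \<in> carrier N" using lin_map_closed[OF assms(3)] assms(4) by auto
  have "f (\<ominus>\<^bsub>M\<^esub> x) \<oplus>\<^bsub>N\<^esub> f x = \<zero>\<^bsub>N\<^esub>"
    using lin_map_add[OF assms(3), of "\<ominus>\<^bsub>M\<^esub> x" x] lin_map_zero[OF assms(1-3)] assms(4)
    by (simp add: M.M.l_neg)
  then show ?thesis using c by (metis N.M.minus_equality)
qed

lemma lin_map_diff: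
  assumes "module K M" "module K N" "lin_map K M N f" "x \<in> carrier M" "y \<in> carrier M"
  shows "f (x \<ominus>\<^bsub>M\<^esub> y) = f x \<ominus>\<^bsub>N\<^esub> f y"
proof -
  interpret M: module K M by fact
  show ?thesis using assms by (simp add: a_minus_def lin_map_add lin_map_minus)
qed

lemma lin_map_finsum:
  assumes "module K M" "module K N" "lin_map K M N f" "finite A" "g \<in> A \<rightarrow> carrier M"
  shows "f (\<Oplus>\<^bsub>M\<^esub>a\<in>A. g a) = (\<Oplus>\<^bsub>N\<^esub>a\<in>A. f (g a))"
proof -
  interpret M: module K M by fact
  interpret N: module K N by fact
  have fc: "\<And>x. x \<in> carrier M \<Longrightarrow> f x \<in> carrier N" by (rule lin_map_closed[OF assms(3)])
  from assms(4,5) show ?thesis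
  proof induction
    case empty
    then show ?case using lin_map_zero[OF assms(1-3)] by simp
  next
    case (insert a A)
    then have "(\<lambda>a. f (g a)) \<in> A \<rightarrow> carrier N" "g \<in> A \<rightarrow> carrier M" "f (g a) \<in> carrier N" "g a \<in> carrier M"
      using fc by auto
    then show ?case using insert
      by (simp add: lin_map_add[OF assms(3)])
  qed
qed

lemma lin_map_comp: "lin_map K M N f \<Longrightarrow> lin_map K N L g \<Longrightarrow> lin_map K M L (\<lambda>x. g (f x))"
  by (simp add: lin_map_def Pi_iff)

lemma submodule_vimage:
  assumes "module K M" "module K N" "lin_map K M N f" "submodule H K N"
  shows "submodule {x \<in> carrier M. f x \<in> H} K M"
proof -
  interpret M: module K M by fact
  interpret N: module K N by fact
  note h = N.submoduleE[OF assms(4)]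
  have "\<zero>\<^bsub>N\<^esub> \<in> H"
    using subgroup.one_closed[OF submodule.axioms(1)[OF assms(4)]] by simp
  then show ?thesis using h
    by (intro M.submoduleI)
      (auto simp: lin_map_zero[OF assms(1-3)] lin_map_minus[OF assms(1-3)]
        lin_map_add[OF assms(3)] lin_map_smult[OF assms(3)])
qed

lemma submodule_zero:
  assumes "module K M" shows "submodule {\<zero>\<^bsub>M\<^esub>} K M"
proof -
  interpret M: module K M by fact
  show ?thesis by (rule M.submoduleI) auto
qed

lemma submodule_ker:
  assumes "module K M" "module K N" "lin_map K M N f"
  shows "submodule {x \<in> carrier M. f x = \<zero>\<^bsub>N\<^esub>} K M"
  using submodule_vimage[OF assms submodule_zero[OF assms(2)]] by simp

lemma submodule_equalizer:
  assumes "module K M" "module K N" "lin_map K M N f" "lin_map K M N g"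
  shows "submodule {x \<in> carrier M. f x = g x} K M"
proof -
  interpret M: module K M by fact
  interpret N: module K N by fact
  show ?thesis
    by (rule M.submoduleI)
      (simp_all add: lin_map_zero[OF assms(1-3)] lin_map_zero[OF assms(1,2,4)]
        lin_map_minus[OF assms(1-3)] lin_map_minus[OF assms(1,2,4)] subset_eq
        lin_map_add[OF assms(3)] lin_map_smult[OF assms(3)] lin_map_add[OF assms(4)] lin_map_smult[OF assms(4)])
qed

lemma submodule_subset: "submodule H K M \<Longrightarrow> H \<subseteq> carrier M"
  using subgroup.subset[OF submodule.axioms(1)] by fastforce

lemma generated_submodule_submodule:
  assumes "module K M" "S \<subseteq> carrier M"
  shows "submodule (generated_submodule K M S) K M"
proof -
  interpret M: module K M by fact
  have 1: "\<And>N. submodule N K M \<Longrightarrow> \<zero>\<^bsub>M\<^esub> \<in> N"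
    using subgroup.one_closed[OF submodule.axioms(1)] by fastforce
  have 2: "generated_submodule K M S \<subseteq> carrier M"
    unfolding generated_submodule_def using M.carrier_is_submodule assms(2) by blast
  show ?thesis
    using 1 2 M.submoduleE(3-5)
    by (intro M.submoduleI) (simp_all add: generated_submodule_def)
qed

lemma generated_submodule_incl: "S \<subseteq> generated_submodule K M S"
  unfolding generated_submodule_def by blast

lemma generated_submodule_minimal:
  "submodule N K M \<Longrightarrow> S \<subseteq> N \<Longrightarrow> generated_submodule K M S \<subseteq> N"
  unfolding generated_submodule_def by blast

text \<open>All axioms transfer along a surjection that respects the operations; \<open>Q\<close>
  need not be known to be a group beforehand. This is how the quotients get their module
  structure.\<close>

lemma module_image:
  assumes "module K M" "carrier Q = p ` carrier M"
    and "\<And>a b. a \<in> carrier M \<Longrightarrow> b \<in> carrier M \<Longrightarrow> p a \<oplus>\<^bsub>Q\<^esub> p b = p (a \<oplus>\<^bsub>M\<^esub> b)"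
    and "\<zero>\<^bsub>Q\<^esub> = p \<zero>\<^bsub>M\<^esub>"
    and "\<And>k a. k \<in> carrier K \<Longrightarrow> a \<in> carrier M \<Longrightarrow> k \<odot>\<^bsub>Q\<^esub> p a = p (k \<odot>\<^bsub>M\<^esub> a)"
  shows "module K Q"
proof -
  interpret M: module K M by fact
  have "\<exists>y\<in>carrier Q. y \<oplus>\<^bsub>Q\<^esub> x = \<zero>\<^bsub>Q\<^esub>" if x: "x \<in> carrier Q" for x
  proof -
    obtain a where a: "a \<in> carrier M" "x = p a" using x unfolding assms(2) by blast
    then have "p (\<ominus>\<^bsub>M\<^esub> a) \<oplus>\<^bsub>Q\<^esub> x = \<zero>\<^bsub>Q\<^esub>" using assms(3,4) M.M.l_neg by simp
    then show ?thesis using a assms(2) by blast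
  qed
  then have "abelian_group Q"
    by (intro abelian_groupI) (auto simp: assms M.M.a_ac)
  then show ?thesis
    by (intro moduleI M.is_cring) (auto simp: assms M.smult_l_distr M.smult_r_distr M.smult_assoc1)
qed

section \<open>Cosets and quotient modules\<close>

context
  fixes K :: "('k, 'm) ring_scheme" and M :: "('k, 'a, 'n) module_scheme" and N
  assumes M: "module K M" and N: "submodule N K M"
begin

interpretation M: module K M by (rule M)

lemma submodule_abelian_subgroup: "abelian_subgroup N M"
  by (intro abelian_subgroupI3 additive_subgroupI submodule.axioms(1)[OF N]) (rule M.abelian_group_axioms)

interpretation N: abelian_subgroup N M by (rule submodule_abelian_subgroup)

lemma coset_eq_iff:
  assumes "a \<in> carrier M" "b \<in> carrier M"
  shows "N +>\<^bsub>M\<^esub> a = N +>\<^bsub>M\<^esub> b \<longleftrightarrow> a \<ominus>\<^bsub>M\<^esub> b \<in> N"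
proof
  assume "N +>\<^bsub>M\<^esub> a = N +>\<^bsub>M\<^esub> b"
  then have "N +>\<^bsub>M\<^esub> (a \<oplus>\<^bsub>M\<^esub> \<ominus>\<^bsub>M\<^esub> b) = N"
    using assms N.a_subset by (intro M.a_coset_add_inv2) auto
  then show "a \<ominus>\<^bsub>M\<^esub> b \<in> N"
    using M.a_coset_join1[OF _ _ N.a_subgroup, of "a \<ominus>\<^bsub>M\<^esub> b"] assms by (simp add: a_minus_def)
next
  assume "a \<ominus>\<^bsub>M\<^esub> b \<in> N"
  then have "N +>\<^bsub>M\<^esub> (a \<oplus>\<^bsub>M\<^esub> \<ominus>\<^bsub>M\<^esub> b) = N"
    using M.a_coset_join2[OF _ N.a_subgroup] assms by (simp add: a_minus_def)
  then show "N +>\<^bsub>M\<^esub> a = N +>\<^bsub>M\<^esub> b"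
    using assms N.a_subset by (intro M.a_coset_add_inv1) auto
qed

lemma coset_memD:
  assumes "a \<in> carrier M" "b \<in> N +>\<^bsub>M\<^esub> a"
  shows "b \<in> carrier M" "N +>\<^bsub>M\<^esub> b = N +>\<^bsub>M\<^esub> a"
  using assms M.a_r_coset_subset_G[OF N.a_subset] M.a_repr_independence[OF _ _ N.a_subgroup] by auto

lemma coset_eq_iff_mem:
  assumes "a \<in> carrier M" "b \<in> carrier M"
  shows "N +>\<^bsub>M\<^esub> b = N +>\<^bsub>M\<^esub> a \<longleftrightarrow> b \<in> N +>\<^bsub>M\<^esub> a"
  using assms coset_memD N.a_rcos_self by metis

text \<open>The operations on quotients are defined as unions over all representatives. A union of
  equal sets over a nonempty coset is that set, so evaluating such an operation amounts to proving
  independence of the representative.\<close>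

lemma UN_coset_const:
  assumes "a \<in> carrier M" "\<And>b. b \<in> carrier M \<Longrightarrow> N +>\<^bsub>M\<^esub> b = N +>\<^bsub>M\<^esub> a \<Longrightarrow> g b = c"
  shows "(\<Union>b\<in>N +>\<^bsub>M\<^esub> a. g b) = c"
proof -
  have "\<And>b. b \<in> N +>\<^bsub>M\<^esub> a \<Longrightarrow> g b = c" using assms coset_memD by blast
  moreover have "a \<in> N +>\<^bsub>M\<^esub> a" using assms(1) by (rule N.a_rcos_self)
  ultimately show ?thesis by blast
qed

lemma quot_smult:
  assumes "k \<in> carrier K" "a \<in> carrier M"
  shows "k \<odot>\<^bsub>quot_module M N\<^esub> (N +>\<^bsub>M\<^esub> a) = N +>\<^bsub>M\<^esub> (k \<odot>\<^bsub>M\<^esub> a)"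
proof -
  have "N +>\<^bsub>M\<^esub> (k \<odot>\<^bsub>M\<^esub> b) = N +>\<^bsub>M\<^esub> (k \<odot>\<^bsub>M\<^esub> a)"
    if b: "b \<in> carrier M" "N +>\<^bsub>M\<^esub> b = N +>\<^bsub>M\<^esub> a" for b
  proof -
    have "b \<ominus>\<^bsub>M\<^esub> a \<in> N" using b assms coset_eq_iff by simp
    then have "k \<odot>\<^bsub>M\<^esub> (b \<ominus>\<^bsub>M\<^esub> a) \<in> N" using assms(1) submodule.smult_closed[OF N] by simp
    then show ?thesis using assms b coset_eq_iff
      by (simp add: a_minus_def M.smult_r_distr M.smult_r_minus)
  qed
  then show ?thesis
    unfolding quot_module_def module.simps by (intro UN_coset_const[OF assms(2)]) auto
qed

lemma quot_carrier: "carrier (quot_module M N) = (\<lambda>a. N +>\<^bsub>M\<^esub> a) ` carrier M"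
  by (auto simp: quot_module_def A_RCOSETS_def')

lemma quot_zero: "\<zero>\<^bsub>quot_module M N\<^esub> = N +>\<^bsub>M\<^esub> \<zero>\<^bsub>M\<^esub>"
  using M.a_coset_add_zero[OF N.a_subset] by (simp add: quot_module_def)

lemma quot_module_module: "module K (quot_module M N)"
  by (rule module_image[OF M quot_carrier])
    (use quot_zero quot_smult N.a_rcos_sum in \<open>auto simp: quot_module_def\<close>)

lemma quot_lin_map: "lin_map K M (quot_module M N) (\<lambda>a. N +>\<^bsub>M\<^esub> a)"
  by (rule lin_mapI) (use quot_carrier quot_smult N.a_rcos_sum in \<open>auto simp: quot_module_def\<close>)

lemma quot_eq_zero_iff: "a \<in> carrier M \<Longrightarrow> N +>\<^bsub>M\<^esub> a = \<zero>\<^bsub>quot_module M N\<^esub> \<longleftrightarrow> a \<in> N"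
  using coset_eq_iff[of a "\<zero>\<^bsub>M\<^esub>"] quot_zero M.M.minus_equality[of "\<zero>\<^bsub>M\<^esub>" "\<zero>\<^bsub>M\<^esub>"]
  by (simp add: a_minus_def)

end

lemma finsum_mono_neutral:
  assumes "abelian_monoid G" "finite T" "S \<subseteq> T" "\<And>x. x \<in> T - S \<Longrightarrow> f x = \<zero>\<^bsub>G\<^esub>" "f \<in> S \<rightarrow> carrier G"
  shows "finsum G f S = finsum G f T"
proof -
  interpret abelian_monoid G by fact
  show ?thesis
    by (rule add.finprod_mono_neutral_cong_left) (use assms in auto)
qed

section \<open>Free modules and linear extension\<close>

context
  fixes K :: "('k, 'm) ring_scheme" and X :: "'x set"
  assumes K: "cring K"
begin

interpretation K: cring K by (rule K)

lemma free_module_module: "module K (free_module K X)"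
proof -
  have *: "finite {x. u x \<oplus>\<^bsub>K\<^esub> v x \<noteq> \<zero>\<^bsub>K\<^esub>}"
    if "finite {x. u x \<noteq> \<zero>\<^bsub>K\<^esub>}" "finite {x. v x \<noteq> \<zero>\<^bsub>K\<^esub>}" for u v :: "'x \<Rightarrow> 'k"
    by (rule finite_subset[OF _ finite_UnI[OF that]]) auto
  have **: "finite {x. k \<otimes>\<^bsub>K\<^esub> u x \<noteq> \<zero>\<^bsub>K\<^esub>}" if "finite {x. u x \<noteq> \<zero>\<^bsub>K\<^esub>}" "k \<in> carrier K"
    for k and u :: "'x \<Rightarrow> 'k"
    by (rule finite_subset[OF _ that(1)]) (use that in auto)
  have m: "\<exists>y\<in>carrier (free_module K X). y \<oplus>\<^bsub>free_module K X\<^esub> u = \<zero>\<^bsub>free_module K X\<^esub>"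
    if u: "u \<in> carrier (free_module K X)" for u
  proof (rule bexI[of _ "\<lambda>x. \<ominus>\<^bsub>K\<^esub> u x"])
    show "(\<lambda>x. \<ominus>\<^bsub>K\<^esub> u x) \<in> carrier (free_module K X)"
    proof -
      have "finite {x. \<ominus>\<^bsub>K\<^esub> u x \<noteq> \<zero>\<^bsub>K\<^esub>}"
        by (rule finite_subset[of _ "{x. u x \<noteq> \<zero>\<^bsub>K\<^esub>}"]) (use u in \<open>auto simp: free_module_def\<close>)
      then show ?thesis using u by (simp add: free_module_def)
    qed
  qed (use u in \<open>auto simp: free_module_def K.l_neg\<close>)
  have "abelian_group (free_module K X)"
    by (rule abelian_groupI) (use m in \<open>auto simp: free_module_def K.a_ac *\<close>)
  then show ?thesis
    by (intro moduleI K)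
      (auto simp: free_module_def ** K.l_distr K.r_distr K.m_assoc)
qed

interpretation F: module K "free_module K X" by (rule free_module_module)

lemma free_add: "(u \<oplus>\<^bsub>free_module K X\<^esub> v) x = u x \<oplus>\<^bsub>K\<^esub> v x"
  and free_smult: "(k \<odot>\<^bsub>free_module K X\<^esub> u) x = k \<otimes>\<^bsub>K\<^esub> u x"
  and free_zero: "\<zero>\<^bsub>free_module K X\<^esub> x = \<zero>\<^bsub>K\<^esub>"
  by (simp_all add: free_module_def)

lemma free_carrierD:
  assumes "u \<in> carrier (free_module K X)"
  shows "u x \<in> carrier K" "x \<notin> X \<Longrightarrow> u x = \<zero>\<^bsub>K\<^esub>" "finite {x. u x \<noteq> \<zero>\<^bsub>K\<^esub>}" "{x. u x \<noteq> \<zero>\<^bsub>K\<^esub>} \<subseteq> X"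
  using assms by (auto simp: free_module_def)

lemma free_carrierI:
  assumes "\<And>x. u x \<in> carrier K" "finite S" "S \<subseteq> X" "\<And>x. x \<notin> S \<Longrightarrow> u x = \<zero>\<^bsub>K\<^esub>"
  shows "u \<in> carrier (free_module K X)"
  using assms finite_subset[of "{x. u x \<noteq> \<zero>\<^bsub>K\<^esub>}" S] by (auto simp: free_module_def)

lemma gen_closed: "x \<in> X \<Longrightarrow> gen K x \<in> carrier (free_module K X)"
  by (rule free_carrierI[of _ "{x}"]) (auto simp: gen_def)

text \<open>Induction on a finite set containing the support, splitting off one generator at a time.
  Applied to kernels and equalizers, it reduces linear identities to generators.\<close>

lemma free_module_induct:
  assumes "submodule N K (free_module K X)" "\<And>x. x \<in> X \<Longrightarrow> gen K x \<in> N"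
  shows "carrier (free_module K X) \<subseteq> N"
proof
  note n = F.submoduleE[OF assms(1)]
  have z: "\<zero>\<^bsub>free_module K X\<^esub> \<in> N"
    using subgroup.one_closed[OF submodule.axioms(1)[OF assms(1)]] by simp
  have *: "u \<in> N" if "finite S" "S \<subseteq> X" "\<And>x. u x \<in> carrier K" "\<And>x. x \<notin> S \<Longrightarrow> u x = \<zero>\<^bsub>K\<^esub>" for u S
    using that
  proof (induction S arbitrary: u)
    case empty
    then have "u = \<zero>\<^bsub>free_module K X\<^esub>" by (auto simp: free_module_def)
    then show ?case using z by simp
  next
    case (insert s S)
    let ?v = "u(s := \<zero>\<^bsub>K\<^esub>)"
    have "?v \<in> N" using insert.prems by (intro insert.IH) auto
    moreover have "u s \<odot>\<^bsub>free_module K X\<^esub> gen K s \<in> N"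
      using n(4)[OF insert.prems(2) assms(2)] insert.prems(1) by blast
    moreover have "u = ?v \<oplus>\<^bsub>free_module K X\<^esub> (u s \<odot>\<^bsub>free_module K X\<^esub> gen K s)"
      using insert.prems(2) by (auto simp: free_module_def gen_def)
    ultimately show ?case using n(5) by metis
  qed
  fix u assume "u \<in> carrier (free_module K X)"
  then show "u \<in> N" by (intro *[of "{x. u x \<noteq> \<zero>\<^bsub>K\<^esub>}" u]) (use free_carrierD[of u] in blast)+
qed

lemma free_lin_map_eq:
  assumes "module K M" "lin_map K (free_module K X) M f" "lin_map K (free_module K X) M g"
    "\<And>x. x \<in> X \<Longrightarrow> f (gen K x) = g (gen K x)" "u \<in> carrier (free_module K X)"
  shows "f u = g u"
  using free_module_induct[OF submodule_equalizer[OF free_module_module assms(1-3)]] assms(4,5) gen_closed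
  by blast

context
  fixes M :: "('k, 'a, 'n) module_scheme" and f :: "'x \<Rightarrow> 'a"
  assumes M: "module K M" and f: "f \<in> X \<rightarrow> carrier M"
begin

interpretation M: module K M by (rule M)

text \<open>The support over which \<open>lin_ext\<close> sums changes under addition and scaling; a
  fixed finite superset makes the sums comparable term by term.\<close>

lemma lin_ext_superset:
  assumes "finite S" "S \<subseteq> X" "u \<in> carrier (free_module K X)" "\<And>x. x \<notin> S \<Longrightarrow> u x = \<zero>\<^bsub>K\<^esub>"
  shows "lin_ext K M f u = (\<Oplus>\<^bsub>M\<^esub>x\<in>S. u x \<odot>\<^bsub>M\<^esub> f x)"
  unfolding lin_ext_def
  by (rule finsum_mono_neutral)
    (use assms f free_carrierD[OF assms(3)] M.abelian_monoid_axioms in \<open>auto simp: Pi_iff intro!: M.smult_l_null\<close>)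

lemma lin_ext_lin_map: "lin_map K (free_module K X) M (lin_ext K M f)"
proof (rule lin_mapI)
  fix u assume u: "u \<in> carrier (free_module K X)"
  show "lin_ext K M f u \<in> carrier M"
    unfolding lin_ext_def using f free_carrierD[OF u] by (intro M.finsum_closed) auto
  { fix k assume k: "k \<in> carrier K"
    let ?S = "{x. u x \<noteq> \<zero>\<^bsub>K\<^esub>}"
    have "lin_ext K M f (k \<odot>\<^bsub>free_module K X\<^esub> u) = (\<Oplus>\<^bsub>M\<^esub>x\<in>?S. (k \<odot>\<^bsub>free_module K X\<^esub> u) x \<odot>\<^bsub>M\<^esub> f x)"
      by (rule lin_ext_superset) (use u k free_carrierD[OF u] in \<open>auto simp: free_smult\<close>)
    also have "\<dots> = (\<Oplus>\<^bsub>M\<^esub>x\<in>?S. k \<odot>\<^bsub>M\<^esub> (u x \<odot>\<^bsub>M\<^esub> f x))"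
      by (rule M.M.finsum_cong') (use u k f free_carrierD[OF u] in \<open>auto simp: free_smult M.smult_assoc1 Pi_iff subset_eq\<close>)
    also have "\<dots> = k \<odot>\<^bsub>M\<^esub> lin_ext K M f u"
      unfolding lin_ext_def
      by (rule M.finsum_smult_ldistr[symmetric]) (use u k f free_carrierD[OF u] in \<open>auto simp: Pi_iff subset_eq\<close>)
    finally show "lin_ext K M f (k \<odot>\<^bsub>free_module K X\<^esub> u) = k \<odot>\<^bsub>M\<^esub> lin_ext K M f u" . }
  { fix v assume v: "v \<in> carrier (free_module K X)"
    let ?S = "{x. u x \<noteq> \<zero>\<^bsub>K\<^esub>} \<union> {x. v x \<noteq> \<zero>\<^bsub>K\<^esub>}"
    have S: "finite ?S" "?S \<subseteq> X" using u v free_carrierD by auto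
    have "lin_ext K M f (u \<oplus>\<^bsub>free_module K X\<^esub> v) = (\<Oplus>\<^bsub>M\<^esub>x\<in>?S. (u \<oplus>\<^bsub>free_module K X\<^esub> v) x \<odot>\<^bsub>M\<^esub> f x)"
      by (rule lin_ext_superset) (use S u v in \<open>auto simp: free_add\<close>)
    also have "\<dots> = (\<Oplus>\<^bsub>M\<^esub>x\<in>?S. u x \<odot>\<^bsub>M\<^esub> f x \<oplus>\<^bsub>M\<^esub> v x \<odot>\<^bsub>M\<^esub> f x)"
      by (rule M.M.finsum_cong')
        (use S u v f free_carrierD(1)[OF u] free_carrierD(1)[OF v] in \<open>auto simp: free_add M.smult_l_distr Pi_iff subset_eq\<close>)
    also have "\<dots> = (\<Oplus>\<^bsub>M\<^esub>x\<in>?S. u x \<odot>\<^bsub>M\<^esub> f x) \<oplus>\<^bsub>M\<^esub> (\<Oplus>\<^bsub>M\<^esub>x\<in>?S. v x \<odot>\<^bsub>M\<^esub> f x)"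
      by (rule M.M.finsum_addf)
        (use S f free_carrierD(1)[OF u] free_carrierD(1)[OF v] in \<open>auto simp: Pi_iff subset_eq\<close>)
    also have "\<dots> = lin_ext K M f u \<oplus>\<^bsub>M\<^esub> lin_ext K M f v"
      using lin_ext_superset[OF S u] lin_ext_superset[OF S v] by simp
    finally show "lin_ext K M f (u \<oplus>\<^bsub>free_module K X\<^esub> v) = lin_ext K M f u \<oplus>\<^bsub>M\<^esub> lin_ext K M f v" . }
qed

lemma lin_ext_gen: "x \<in> X \<Longrightarrow> lin_ext K M f (gen K x) = f x"
  using lin_ext_superset[of "{x}" "gen K x"] gen_closed[of x] f
  by (auto simp: gen_def Pi_iff M.finsum_singleton)

end

end

text \<open>The ring as a module over itself, so that linear forms are instances of \<^const>\<open>lin_map\<close>.\<close>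

definition self_module :: "('k, 'm) ring_scheme \<Rightarrow> ('k, 'k) module" where
  "self_module K = \<lparr>carrier = carrier K, monoid.mult = monoid.mult K, one = one K, zero = zero K,
     add = add K, smult = monoid.mult K\<rparr>"

lemma self_module_simps [simp]:
  "carrier (self_module K) = carrier K" "\<zero>\<^bsub>self_module K\<^esub> = \<zero>\<^bsub>K\<^esub>"
  "add (self_module K) = add K" "smult (self_module K) = monoid.mult K"
  "finsum (self_module K) = finsum K"
  by (auto simp: self_module_def finsum_def finprod_def fun_eq_iff)

lemma self_module_module: "cring K \<Longrightarrow> module K (self_module K)"
proof -
  assume "cring K"
  then interpret K: cring K .
  have "\<exists>y\<in>carrier K. y \<oplus>\<^bsub>K\<^esub> x = \<zero>\<^bsub>K\<^esub>" if "x \<in> carrier K" for x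
    using K.l_neg[OF that] that by blast
  then have "abelian_group (self_module K)"
    by (intro abelian_groupI) (auto simp: K.a_ac)
  then show ?thesis
    by (intro moduleI) (auto simp: K.is_cring K.l_distr K.r_distr K.m_assoc)
qed

section \<open>Characters invariant under the shift are quadratic\<close>

definition cyc3 :: "'a \<Rightarrow> 'a \<Rightarrow> 'a \<Rightarrow> 'a \<Rightarrow> 'a" where
  "cyc3 x y z t = (if t = x then y else if t = y then z else if t = z then x else t)"

text \<open>The commutator of \<open>g\<close> and \<open>h\<close> is the cycle \<open>b\<close>,
  \<open>g b\<close>, \<open>h b\<close>, written here without inverses. By injectivity
  \<open>g\<close> moves \<open>g b\<close>, and \<open>g b\<close> is not the common point
  \<open>b\<close>, so \<open>h\<close> fixes it; in the same way \<open>g\<close> fixes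
  \<open>h b\<close>. Elsewhere at most one of the two maps moves a given point, and the case
  distinction follows which one.\<close>

lemma commutator_cyc3:
  assumes inj: "inj g" "inj h" and b: "{x. g x \<noteq> x \<and> h x \<noteq> x} = {b}"
  shows "g (h t) = cyc3 b (g b) (h b) (h (g t))" "distinct [b, g b, h b]"
proof -
  have gh: "g x \<noteq> x \<Longrightarrow> x \<noteq> b \<Longrightarrow> h x = x" "h x \<noteq> x \<Longrightarrow> x \<noteq> b \<Longrightarrow> g x = x" "g b \<noteq> b" "h b \<noteq> b" for x
    using b by auto
  have inj_iff [simp]: "g x = g y \<longleftrightarrow> x = y" "h x = h y \<longleftrightarrow> x = y" for x y
    using inj by (auto dest: injD)
  have hgb: "h (g b) = g b" by (rule gh(1)) (use gh(3) in simp_all)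
  have ghb: "g (h b) = h b" by (rule gh(2)) (use gh(4) in simp_all)
  have "g b \<noteq> h b" using hgb gh(4) by (metis inj_iff(2))
  then have ne: "g b \<noteq> h b" "h b \<noteq> g b" "g b \<noteq> b" "b \<noteq> g b" "h b \<noteq> b" "b \<noteq> h b"
    using gh(3,4) by auto
  then show "distinct [b, g b, h b]" by simp
  consider "t = b" | "t \<noteq> b" "g t \<noteq> t" | "t \<noteq> b" "h t \<noteq> t" | "g t = t" "h t = t" by blast
  then show "g (h t) = cyc3 b (g b) (h b) (h (g t))"
  proof cases
    case 1
    then show ?thesis using hgb ghb ne by (simp add: cyc3_def)
  next
    case 2
    then have ht: "h t = t" using gh by blast
    show ?thesis
    proof (cases "g t = b")
      case True
      then show ?thesis using ht ne by (simp add: cyc3_def)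
    next
      case False
      have "h (g t) = g t" by (rule gh(1)) (use 2 False in simp_all)
      moreover have "g t \<noteq> g b" "g t \<noteq> h b" using 2 ghb inj_iff(1) by metis+
      ultimately show ?thesis using ht False by (simp add: cyc3_def)
    qed
  next
    case 3
    then have gt: "g t = t" using gh by blast
    show ?thesis
    proof (cases "h t = b")
      case True
      then show ?thesis using gt ne by (simp add: cyc3_def)
    next
      case False
      have "g (h t) = h t" by (rule gh(2)) (use 3 False in simp_all)
      moreover have "h t \<noteq> h b" "h t \<noteq> g b" using 3 hgb inj_iff(2) by metis+
      ultimately show ?thesis using gt False by (simp add: cyc3_def)
    qed
  next
    case 4
    then have "t \<noteq> b" "t \<noteq> g b" "t \<noteq> h b" using gh(3,4) by auto
    then show ?thesis using 4 by (simp add: cyc3_def)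
  qed
qed

text \<open>The assumption covers \<open>k = 0\<close>, where the first branch still applies to
  \<open>t = 0\<close>.\<close>

lemma omega_funpow: "(omega ^^ k) g t = (if t \<le> k then t else g (t - k) + k)" if "g 0 = 0"
proof (induction k arbitrary: t)
  case 0
  then show ?case using that by simp
next
  case (Suc k)
  show ?case using Suc[of "t - 1"] by (auto simp: omega_def)
qed

text \<open>The indexing by degree is forgotten because the argument conjugates by and composes with
  arbitrarily far shifts, which leave any single \<open>W d\<close> but not the union.\<close>

locale shift_closed_group =
  fixes G :: "(nat \<Rightarrow> nat) set"
  assumes permutes: "g \<in> G \<Longrightarrow> \<exists>d. g permutes {1..d}"
    and comp: "g \<in> G \<Longrightarrow> h \<in> G \<Longrightarrow> g \<circ> h \<in> G"
    and inverse: "g \<in> G \<Longrightarrow> inv' g \<in> G"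
    and omega: "g \<in> G \<Longrightarrow> omega g \<in> G"
begin

lemma bij: "g \<in> G \<Longrightarrow> bij g"
  using permutes permutes_bij by blast

lemma inv_apply: "g \<in> G \<Longrightarrow> g (inv' g x) = x" "g \<in> G \<Longrightarrow> inv' g (g x) = x"
  using bij by (simp_all add: bij_is_surj surj_f_inv_f bij_is_inj inv_f_f)

lemma fix0: "g \<in> G \<Longrightarrow> g 0 = 0"
  using permutes permutes_not_in by fastforce

lemma omega_pow: "g \<in> G \<Longrightarrow> (omega ^^ k) g \<in> G"
  by (induction k) (auto simp: omega)

lemma omega_pow_apply: "g \<in> G \<Longrightarrow> (omega ^^ k) g t = (if t \<le> k then t else g (t - k) + k)"
  by (rule omega_funpow) (rule fix0)

definition T :: "nat \<Rightarrow> nat \<Rightarrow> nat \<Rightarrow> bool" where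
  "T x y z \<longleftrightarrow> distinct [x, y, z] \<and> cyc3 x y z \<in> G"

text \<open>This is an equivalence relation, and by \<open>R_T\<close> any three distinct points of
  one class carry a 3-cycle of \<open>G\<close> in either orientation: 3-cycles that overlap
  generate all the others on their joint support.\<close>

definition R :: "nat \<Rightarrow> nat \<Rightarrow> bool" where
  "R x y \<longleftrightarrow> x = y \<or> (\<exists>z. T x y z)"

lemma T_distinct: "T x y z \<Longrightarrow> x \<noteq> y \<and> y \<noteq> z \<and> x \<noteq> z"
  by (simp add: T_def)

lemma T_rot: "T x y z \<Longrightarrow> T y z x"
proof -
  assume t: "T x y z"
  then have "cyc3 y z x = cyc3 x y z" by (auto simp: T_def cyc3_def fun_eq_iff)
  then show ?thesis using t by (auto simp: T_def)
qed

lemma T_conj: 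
  assumes "g \<in> G" "T x y z"
  shows "T (g x) (g y) (g z)"
proof -
  have "cyc3 (g x) (g y) (g z) = g \<circ> cyc3 x y z \<circ> inv' g"
  proof
    fix t
    have "t = g (inv' g t)" by (simp only: inv_apply(1)[OF assms(1)])
    then obtain s where "t = g s" ..
    then show "cyc3 (g x) (g y) (g z) t = (g \<circ> cyc3 x y z \<circ> inv' g) t"
      using bij[OF assms(1)] by (auto simp: cyc3_def inv_apply[OF assms(1)] bij_is_inj inj_eq)
  qed
  then show ?thesis
    using assms bij[OF assms(1)] by (auto simp: T_def comp inverse bij_is_inj inj_eq)
qed

lemma T_inv: "T x y z \<Longrightarrow> T x z y"
proof -
  assume t: "T x y z"
  have "cyc3 x z y = inv' (cyc3 x y z)"
  proof (rule inv_unique_comp[symmetric])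
    show "cyc3 x y z \<circ> cyc3 x z y = id" "cyc3 x z y \<circ> cyc3 x y z = id"
      using t by (auto simp: T_def cyc3_def fun_eq_iff)
  qed
  then show ?thesis using t inverse by (auto simp: T_def)
qed

lemma T_omega:
  assumes "T x y z" shows "T (x + k) (y + k) (z + k)"
proof -
  have G: "cyc3 x y z \<in> G" "cyc3 y z x \<in> G" "cyc3 z x y \<in> G"
    using assms T_rot unfolding T_def by blast+
  \<comment> \<open>Elements of \<open>G\<close> fix 0, so the three points are positive; only then
    does the shift move exactly their translates.\<close>
  have "x \<noteq> 0" "y \<noteq> 0" "z \<noteq> 0"
    using assms fix0[OF G(1)] fix0[OF G(2)] fix0[OF G(3)] by (auto simp: cyc3_def T_def split: if_splits)
  then have "cyc3 (x + k) (y + k) (z + k) = (omega ^^ k) (cyc3 x y z)"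
    using omega_pow_apply[OF G(1), of k] by (auto simp: fun_eq_iff cyc3_def)
  then show ?thesis using omega_pow[OF G(1), of k] assms by (simp add: T_def)
qed

text \<open>Conjugating \<open>cyc3 a b p\<close> by \<open>cyc3 a q b\<close>, the inverse of
  \<open>cyc3 a b q\<close>, gives \<open>cyc3 q a p\<close>, which is a rotation of the cycle
  wanted.\<close>

lemma T_share2:
  assumes "T a b p" "T a b q" "p \<noteq> q" shows "T a p q"
proof -
  have "T (cyc3 a q b a) (cyc3 a q b b) (cyc3 a q b p)"
    using T_conj T_inv[OF assms(2)] assms(1) unfolding T_def by blast
  then have "T q a p"
    using assms T_distinct[OF assms(1)] T_distinct[OF assms(2)] by (simp add: cyc3_def)
  then show ?thesis by (rule T_rot)
qed

text \<open>If the two cycles have a further common point, they share a pair, or one is a rotation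
  of the other kind wanted. Otherwise \<open>cyc3 y w u\<close> fixes \<open>x\<close> and
  \<open>z\<close>, so conjugating by it turns \<open>cyc3 x y z\<close> into
  \<open>cyc3 x w z\<close>, and \<open>T_share2\<close> applies to the common pair
  \<open>x\<close>, \<open>z\<close>.\<close>

lemma T_trans:
  assumes "T x y z" "T y w u" "x \<noteq> w" shows "T x y w"
proof -
  note d = T_distinct[OF assms(1)] T_distinct[OF assms(2)]
  consider "z = w" | "u = x" | "z \<noteq> w" "u \<noteq> x" "u = z" | "z \<noteq> w" "u \<noteq> x" "u \<noteq> z" by blast
  then show ?thesis
  proof cases
    case 1 then show ?thesis using assms by simp
  next
    case 2 then show ?thesis using assms T_rot by blast
  next
    case 3
    then have "T y x w" using T_share2[of y z x w] T_rot T_inv assms by blast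
    then show ?thesis using T_rot T_inv by blast
  next
    case 4
    have "T (cyc3 y w u x) (cyc3 y w u y) (cyc3 y w u z)"
      using T_conj assms unfolding T_def by blast
    then have "T x w z" using d assms(3) 4 by (simp add: cyc3_def split: if_splits)
    then show ?thesis using T_share2[of x z y w] T_inv assms d by blast
  qed
qed

lemma R_sym: "R x y \<Longrightarrow> R y x"
  unfolding R_def using T_rot T_inv by blast

lemma R_T: "R x y \<Longrightarrow> R y w \<Longrightarrow> distinct [x, y, w] \<Longrightarrow> T x y w"
  using T_trans unfolding R_def distinct_length_2_or_more by blast

lemma R_trans: "R x y \<Longrightarrow> R y w \<Longrightarrow> R x w"
proof (cases "distinct [x, y, w]")
  case True
  then show "R x y \<Longrightarrow> R y w \<Longrightarrow> R x w" using R_T T_inv unfolding R_def by blast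
qed (auto simp: R_def)

text \<open>The points lying on some 3-cycle of \<open>G\<close>; \<open>support_moved\<close> shows
  that these are all the points that \<open>G\<close> moves.\<close>

definition moved :: "nat set" where "moved = {x. \<exists>y z. T x y z}"

text \<open>Shifting a 3-cycle through \<open>a < b\<close> by the multiples of \<open>b - a\<close>
  gives cycles of which consecutive ones share a point. They chain \<open>a\<close>,
  \<open>b\<close>, \<open>b + (b - a)\<close>, ... into one class of \<open>R\<close>.\<close>

lemma R_unbounded:
  assumes "x \<in> moved" obtains u where "u > N" "R x u"
proof -
  obtain y z where t: "T x y z" using assms by (auto simp: moved_def)
  have *: "R a (a + j * (b - a))" if "T a b c" "a < b" for a b c j
  proof (induction j)
    case 0 then show ?case by (simp add: R_def)
  next
    case (Suc j)
    have "T (a + j * (b - a)) (b + j * (b - a)) (c + j * (b - a))" using T_omega that by blast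
    moreover have "b + j * (b - a) = a + Suc j * (b - a)" using that by simp
    ultimately have "R (a + j * (b - a)) (a + Suc j * (b - a))" unfolding R_def by metis
    with Suc show ?case by (rule R_trans)
  qed
  obtain a b c where abc: "T a b c" "a < b" "R x a"
  proof (cases "x < y")
    case True
    show ?thesis by (rule that[OF t True]) (simp add: R_def)
  next
    case False
    then have "y < x" using T_distinct[OF t] by simp
    moreover have "T y x z" using T_rot[OF T_rot[OF T_inv[OF t]]] .
    moreover have "R x y" using t unfolding R_def by blast
    ultimately show ?thesis by (intro that)
  qed
  have "Suc N * 1 \<le> Suc N * (b - a)" using abc(2) by (intro mult_le_mono2) simp
  then have "N < a + Suc N * (b - a)" by (simp only: mult_1_right Suc_le_eq trans_less_add2)
  then show ?thesis by (rule that) (rule R_trans[OF abc(3) *[OF abc(1,2)]])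
qed

text \<open>Take \<open>u\<close> and \<open>v\<close> in the class of \<open>x\<close> beyond the
  support of \<open>g\<close>. Conjugating the cycle through \<open>x\<close>, \<open>u\<close>,
  \<open>v\<close> by \<open>g\<close> changes only \<open>x\<close>, so \<open>g x\<close> lies in
  the class of \<open>u\<close>, which is that of \<open>x\<close>.\<close>

lemma R_apply:
  assumes "g \<in> G" "x \<in> moved" shows "R x (g x)"
proof (cases "g x = x")
  case True then show ?thesis by (simp add: R_def)
next
  case False
  obtain d where d: "g permutes {1..d}" using permutes assms(1) by blast
  obtain u where u: "u > d + x" "R x u" using R_unbounded[OF assms(2)] by blast
  obtain v where v: "v > u" "R x v" using R_unbounded[OF assms(2)] by blast
  have "R u v" using u v R_sym R_trans by blast
  then have t: "T x u v" using R_T[OF u(2)] u v by auto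
  then have "T (g x) (g u) (g v)" using T_conj assms(1) by blast
  moreover have "g u = u" "g v = v" using u v permutes_not_in[OF d] by auto
  ultimately have "R (g x) u" by (auto simp: R_def)
  then show ?thesis using u R_sym R_trans by blast
qed

lemma moved_apply:
  assumes "g \<in> G" shows "x \<in> moved \<longleftrightarrow> g x \<in> moved"
proof -
  have *: "h y \<in> moved" if "h \<in> G" "y \<in> moved" for h y
    using that T_conj[OF that(1)] unfolding moved_def by blast
  show ?thesis using *[OF assms] *[OF inverse[OF assms], of "g x"] inv_apply(2)[OF assms] by auto
qed

lemma moved_up:
  assumes "x \<in> moved" "x \<le> y" shows "y \<in> moved"
proof -
  obtain a b where "T x a b" using assms(1) by (auto simp: moved_def)
  from T_omega[OF this, of "y - x"] show ?thesis using assms(2) unfolding moved_def by auto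
qed

lemma moved_nonempty:
  assumes "g \<in> G" "g p \<noteq> p" shows "\<exists>m. m \<in> moved"
proof -
  obtain d where d: "g permutes {1..d}" using permutes assms(1) by blast
  define S where "S = {x. g x \<noteq> x}"
  have S: "S \<subseteq> {1..d}" "p \<in> S" using permutes_not_in[OF d] assms(2) unfolding S_def by blast+
  then have fin: "finite S" using finite_subset by blast
  define a where "a = Min S"
  define b where "b = Max S"
  have ab: "a \<in> S" "b \<in> S" "\<And>x. x \<in> S \<Longrightarrow> a \<le> x \<and> x \<le> b"
    unfolding a_def b_def using S(2) Min_in[OF fin] Max_in[OF fin] Min_le[OF fin] Max_ge[OF fin] by blast+
  then have a1: "a \<ge> 1" using S(1) by auto
  \<comment> \<open>This shift carries the least moved point of \<open>g\<close> onto the greatest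
    one, so that the supports of \<open>g\<close> and \<open>h\<close> can meet only in
    \<open>b\<close>.\<close>
  define h where "h = (omega ^^ (b - a)) g"
  have h: "h \<in> G" unfolding h_def by (rule omega_pow[OF assms(1)])
  have ht: "h t = (if t \<le> b - a then t else g (t - (b - a)) + (b - a))" for t
    unfolding h_def by (rule omega_pow_apply[OF assms(1)])
  have "x = b" if x: "g x \<noteq> x" "h x \<noteq> x" for x
  proof -
    have "x > b - a" using x(2) ht[of x] by (simp split: if_splits)
    then have "x - (b - a) \<in> S" "x \<in> S" using x ht[of x] by (auto simp: S_def)
    then show "x = b" using ab(3)[of x] ab(3)[of "x - (b - a)"] \<open>x > b - a\<close> by linarith
  qed
  moreover have "g b \<noteq> b" using ab(2) by (simp add: S_def)
  moreover have "h b \<noteq> b"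
  proof -
    have "h b = g a + (b - a)" using ht[of b] ab(3)[OF ab(2)] a1 by auto
    moreover have "g a \<noteq> a" using ab(1) by (simp add: S_def)
    ultimately show ?thesis using ab(3)[OF ab(2)] by linarith
  qed
  ultimately have "{x. g x \<noteq> x \<and> h x \<noteq> x} = {b}" by blast
  note c = commutator_cyc3[OF bij_is_inj[OF bij[OF assms(1)]] bij_is_inj[OF bij[OF h]] this]
  have "cyc3 b (g b) (h b) s = (g \<circ> h \<circ> inv' g \<circ> inv' h) s" for s
    using c(1)[of "inv' g (inv' h s)"] by (simp add: inv_apply(1)[OF h] inv_apply(1)[OF assms(1)])
  then have "cyc3 b (g b) (h b) = g \<circ> h \<circ> inv' g \<circ> inv' h" by (rule ext)
  then have "T b (g b) (h b)" unfolding T_def using c(2) h assms(1) comp inverse by simp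
  then show ?thesis by (auto simp: moved_def)
qed

text \<open>If \<open>g\<close> moves points outside \<^const>\<open>moved\<close>, let \<open>q\<close> be the largest of them. The shift of
  \<open>g\<close> that carries \<open>q\<close> to the least element of \<^const>\<open>moved\<close> maps that element outside
  \<^const>\<open>moved\<close>, a set that is invariant under the group.\<close>

lemma support_moved:
  assumes "g \<in> G" "g p \<noteq> p" shows "p \<in> moved"
proof (rule ccontr)
  assume p: "p \<notin> moved"
  obtain m where m: "m \<in> moved" using moved_nonempty assms by blast
  have fin: "finite (- moved)"
    by (rule finite_subset[of _ "{..<m}"]) (use m moved_up in \<open>auto simp: not_le[symmetric]\<close>)
  define q where "q = Max {x. g x \<noteq> x \<and> x \<notin> moved}"
  have fin': "finite {x. g x \<noteq> x \<and> x \<notin> moved}" by (rule finite_subset[OF _ fin]) auto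
  have q: "g q \<noteq> q" "q \<notin> moved" using Max_in[OF fin'] p assms(2) unfolding q_def by auto
  have qmax: "x \<le> q" if "g x \<noteq> x" "x \<notin> moved" for x
    unfolding q_def using that fin' by (intro Max_ge) auto
  define M where "M = Max (- moved)"
  have M: "M \<notin> moved" using Max_in[OF fin] p unfolding M_def by auto
  have Mmax: "x \<le> M" if "x \<notin> moved" for x
    unfolding M_def using that fin by (intro Max_ge) auto
  have qM: "q \<le> M" using Mmax q by blast
  have "q \<noteq> 0" using fix0[OF assms(1)] q by (metis (full_types))
  \<comment> \<open>The point \<open>g q\<close> is again moved by \<open>g\<close> and outside
    \<open>moved\<close>, so the maximality of \<open>q\<close> puts it below \<open>q\<close>. The
    shift taking \<open>q\<close> to \<open>M + 1\<close> therefore sends \<open>M + 1\<close> to a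
    point at most \<open>M\<close>.\<close>
  have "g q \<notin> moved" using moved_apply[OF assms(1)] q by blast
  moreover have "g (g q) \<noteq> g q" using q bij[OF assms(1)] by (metis bij_is_inj injD)
  ultimately have lt: "g q < q" using qmax[of "g q"] q by auto
  let ?h = "(omega ^^ (M + 1 - q)) g"
  have "?h (M + 1) = g q + (M + 1 - q)"
    using omega_pow_apply[OF assms(1), of "M + 1 - q" "M + 1"] qM \<open>q \<noteq> 0\<close> by auto
  then have "?h (M + 1) \<le> M" using lt qM by linarith
  then have "?h (M + 1) \<notin> moved" using M moved_up by blast
  then have "M + 1 \<notin> moved" using moved_apply[OF omega_pow[OF assms(1)]] by blast
  then show False using Mmax by fastforce
qed

end

section \<open>Values of a character on 3-cycles and on arbitrary elements\<close>

locale shift_invariant_character = shift_closed_group + H: comm_group H for H (structure) +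
  fixes v
  assumes v_closed: "g \<in> G \<Longrightarrow> v g \<in> carrier H"
    and v_comp: "g \<in> G \<Longrightarrow> h \<in> G \<Longrightarrow> v (g \<circ> h) = v g \<otimes> v h"
begin

text \<open>As far as the locale knows, \<open>G\<close> may be empty; hence the premise, which
  \<open>id_mem\<close> provides from any element at hand.\<close>

lemma v_id: "id \<in> G \<Longrightarrow> v id = \<one>"
  using v_comp[of id id] v_closed[of id] by simp

lemma id_mem: "g \<in> G \<Longrightarrow> id \<in> G"
  using comp[OF _ inverse, of g] inv_apply[of g] by (metis comp_apply eq_id_iff)

lemma v_conj:
  assumes "g \<in> G" "h \<in> G" shows "v (g \<circ> h \<circ> inv' g) = v h"
proof -
  have "g \<circ> inv' g = id" using inv_apply assms(1) by (simp add: fun_eq_iff)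
  then have "v g \<otimes> v (inv' g) = \<one>" using v_comp[OF assms(1) inverse[OF assms(1)]] v_id[OF id_mem[OF assms(1)]] by simp
  moreover have "v (g \<circ> h \<circ> inv' g) = v g \<otimes> v h \<otimes> v (inv' g)"
    using assms by (simp add: v_comp comp inverse)
  moreover have "\<dots> = v h \<otimes> (v g \<otimes> v (inv' g))"
    using assms v_closed inverse H.m_ac by simp
  ultimately show ?thesis using assms v_closed by simp
qed

text \<open>Two 3-cycles sharing an ordered pair of points are conjugate and their product is an involution.\<close>

lemma v_cyc3:
  assumes "T x y z" shows "v (cyc3 x y z) = \<one>"
proof -
  have m: "x \<in> moved" and Rxy: "R x y" "R x z" using assms T_inv by (auto simp: moved_def R_def)
  obtain u where u: "u > x + y + z" "R x u" using R_unbounded[OF m] by blast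
  obtain w where w: "w > u" "R x w" using R_unbounded[OF m] by blast
  have R: "R y x" "R z u" "R u w" using u w Rxy R_sym R_trans by blast+
  have d: "distinct [x, y, z, u, w]" using u w T_distinct[OF assms] by auto
  have t: "T y x u" "T z u w" using R_T R u(2) d by auto
  then have t1: "T x y u" using T_rot T_inv by blast
  have G: "cyc3 x y z \<in> G" "cyc3 x y u \<in> G" "cyc3 z u w \<in> G" using assms t1 t by (auto simp: T_def)
  \<comment> \<open>The conjugating cycle fixes \<open>x\<close> and \<open>y\<close> and takes
    \<open>z\<close> to \<open>u\<close>.\<close>
  have "cyc3 x y u = cyc3 z u w \<circ> cyc3 x y z \<circ> inv' (cyc3 z u w)"
  proof
    fix s
    have "s = cyc3 z u w (inv' (cyc3 z u w) s)" by (simp only: inv_apply(1)[OF G(3)])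
    then obtain r where r: "s = cyc3 z u w r" ..
    show "cyc3 x y u s = (cyc3 z u w \<circ> cyc3 x y z \<circ> inv' (cyc3 z u w)) s"
      unfolding r comp_apply inv_apply(2)[OF G(3)] using d by (auto simp: cyc3_def)
  qed
  then have eq: "v (cyc3 x y u) = v (cyc3 x y z)" using v_conj[OF G(3,1)] by simp
  let ?k = "v (cyc3 x y z)"
  have k: "?k \<in> carrier H" using v_closed G by blast
  let ?s = "cyc3 x y z \<circ> cyc3 x y u"
  have "?s \<circ> ?s = id" using d by (auto simp: fun_eq_iff cyc3_def)
  then have "v ?s \<otimes> v ?s = \<one>" using v_comp[of ?s ?s] v_id[OF id_mem] comp G by simp
  \<comment> \<open>Both factors of the involution have the value \<open>?k\<close>, so its fourth
    power is trivial; the cube is trivial because the element is a 3-cycle, and 3 and 4 are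
    coprime.\<close>
  then have 4: "?k \<otimes> ?k \<otimes> (?k \<otimes> ?k) = \<one>" using v_comp[OF G(1,2)] eq by simp
  have "cyc3 x y z \<circ> cyc3 x y z \<circ> cyc3 x y z = id" using d by (auto simp: fun_eq_iff cyc3_def)
  then have 3: "?k \<otimes> ?k \<otimes> ?k = \<one>" using v_comp[OF comp[OF G(1) G(1)] G(1)] v_comp[OF G(1) G(1)] v_id[OF id_mem[OF G(1)]] by simp
  have "?k = ?k \<otimes> ?k \<otimes> ?k \<otimes> ?k" using 3 k by simp
  then show ?thesis using 4 k by (simp add: H.m_assoc)
qed

text \<open>Induction on the size of the support. If \<open>g\<close> is not an involution, pick
  \<open>x\<close> with \<open>g (g x) \<noteq> x\<close> and compose with the cycle through
  \<open>g x\<close>, \<open>x\<close>, \<open>g (g x)\<close> in this order. It has value 1, it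
  takes \<open>g x\<close> back to \<open>x\<close> so that the composite fixes \<open>x\<close>,
  and it only touches points that \<open>g\<close> moves anyway.\<close>

lemma v_square: "g \<in> G \<Longrightarrow> v g \<otimes> v g = \<one>"
proof (induction "card {x. g x \<noteq> x}" arbitrary: g rule: less_induct)
  case less
  show ?case
  proof (cases "g \<circ> g = id")
    case True
    then show ?thesis using v_comp[of g g] v_id id_mem less.prems by metis
  next
    case False
    then obtain x where x: "g (g x) \<noteq> x" by (auto simp: fun_eq_iff)
    let ?y = "g x" and ?w = "g (g x)"
    have d: "distinct [x, ?y, ?w]" using x bij[OF less.prems] by (auto simp: bij_is_inj inj_eq)
    have m: "x \<in> moved" using support_moved[OF less.prems, of x] d by auto
    have t: "T x ?y ?w"
      using R_apply[OF less.prems m] R_apply[OF less.prems, of ?y] moved_apply[OF less.prems] m R_T d by blast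
    then have t': "T ?y x ?w" using T_rot T_inv by blast
    let ?c = "cyc3 ?y x ?w"
    have c: "?c \<in> G" "v ?c = \<one>" using t' v_cyc3 by (auto simp: T_def)
    let ?h = "?c \<circ> g"
    obtain e where "g permutes {1..e}" using permutes less.prems by blast
    then have fin: "finite {t. g t \<noteq> t}"
      using permutes_not_in by (metis (mono_tags, lifting) finite_atLeastAtMost finite_subset mem_Collect_eq subsetI)
    have "{t. ?h t \<noteq> t} \<subset> {t. g t \<noteq> t}"
    proof
      show "{t. ?h t \<noteq> t} \<subseteq> {t. g t \<noteq> t}"
      proof clarify
        fix t assume *: "?h t \<noteq> t" "g t = t"
        have "t \<noteq> x" "t \<noteq> ?y" "t \<noteq> ?w"
          using *(2) d bij[OF less.prems] by (auto simp: bij_is_inj inj_eq)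
        then show False using * by (simp add: cyc3_def)
      qed
      show "{t. ?h t \<noteq> t} \<noteq> {t. g t \<noteq> t}"
      proof -
        have "x \<notin> {t. ?h t \<noteq> t}" "x \<in> {t. g t \<noteq> t}" using d by (auto simp: cyc3_def)
        then show ?thesis by blast
      qed
    qed
    then have "v ?h \<otimes> v ?h = \<one>"
      using less.hyps[of ?h] comp[OF c(1) less.prems] psubset_card_mono[OF fin] by blast
    then show ?thesis using v_comp[OF c(1) less.prems] c(2) v_closed[OF less.prems] by simp
  qed
qed

end

section \<open>Tensor powers and their quotients\<close>

lemma lin_map_plus:
  assumes "module K M" "module K N" "lin_map K M N f" "lin_map K M N g"
  shows "lin_map K M N (\<lambda>x. f x \<oplus>\<^bsub>N\<^esub> g x)"
proof -
  interpret N: module K N by fact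
  show ?thesis
    by (rule lin_mapI)
      (simp_all add: lin_map_closed[OF assms(3)] lin_map_closed[OF assms(4)] lin_map_add[OF assms(3)]
        lin_map_add[OF assms(4)] lin_map_smult[OF assms(3)] lin_map_smult[OF assms(4)] N.smult_r_distr N.M.a_ac)
qed

lemma lin_map_scale:
  assumes "module K N" "lin_map K M N f" "k \<in> carrier K"
  shows "lin_map K M N (\<lambda>x. k \<odot>\<^bsub>N\<^esub> f x)"
proof -
  interpret N: module K N by fact
  have "k \<odot>\<^bsub>N\<^esub> (l \<odot>\<^bsub>N\<^esub> y) = l \<odot>\<^bsub>N\<^esub> (k \<odot>\<^bsub>N\<^esub> y)" if "l \<in> carrier K" "y \<in> carrier N" for l y
    using that assms(3) by (simp add: N.smult_assoc1[symmetric] N.m_comm)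
  then show ?thesis
    by (intro lin_mapI)
      (simp_all add: assms(3) lin_map_closed[OF assms(2)] lin_map_add[OF assms(2)] lin_map_smult[OF assms(2)]
        N.smult_r_distr)
qed

lemma (in abelian_group) diff_eq_zero_iff:
  assumes "a \<in> carrier G" "b \<in> carrier G"
  shows "a \<ominus> b = \<zero> \<longleftrightarrow> a = b"
proof
  assume "a \<ominus> b = \<zero>"
  then have "\<ominus> (\<ominus> b) = a" using assms by (intro minus_equality) (auto simp: a_minus_def)
  then show "a = b" using assms by (simp add: minus_minus)
next
  assume "a = b"
  then show "a \<ominus> b = \<zero>" using assms by (simp add: a_minus_def r_neg)
qed

lemma lin_map_kernel_eq:
  assumes "module K M" "module K N" "lin_map K M N f" "x \<in> carrier M" "y \<in> carrier M"
  shows "f (x \<ominus>\<^bsub>M\<^esub> y) = \<zero>\<^bsub>N\<^esub> \<longleftrightarrow> f x = f y"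
proof -
  interpret N: module K N by fact
  show ?thesis
    using lin_map_closed[OF assms(3)] assms(4,5) by (simp add: lin_map_diff[OF assms(1-3)] N.M.diff_eq_zero_iff)
qed

definition bilin :: "('k, 'm) ring_scheme \<Rightarrow> ('k, 'a, 'p) module_scheme \<Rightarrow> ('k, 'b, 'q) module_scheme
    \<Rightarrow> ('k, 'c, 'r) module_scheme \<Rightarrow> ('a \<Rightarrow> 'b \<Rightarrow> 'c) \<Rightarrow> bool" where
  "bilin K M N L b \<longleftrightarrow> (\<forall>v\<in>carrier N. lin_map K M L (\<lambda>u. b u v)) \<and> (\<forall>u\<in>carrier M. lin_map K N L (b u))"

lemma bilinD:
  assumes "bilin K M N L b"
  shows "v \<in> carrier N \<Longrightarrow> lin_map K M L (\<lambda>u. b u v)" "u \<in> carrier M \<Longrightarrow> lin_map K N L (b u)"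
  using assms by (auto simp: bilin_def)

lemma bilin_flip: "bilin K M N L b \<Longrightarrow> bilin K N M L (\<lambda>v u. b u v)"
  by (auto simp: bilin_def)

lemma bilin_comp: "bilin K M N L b \<Longrightarrow> lin_map K L L' f \<Longrightarrow> bilin K M N L' (\<lambda>u v. f (b u v))"
  by (auto simp: bilin_def intro!: lin_map_comp[where g = f and N = L])

lemma bilin_closed: "bilin K M N L b \<Longrightarrow> u \<in> carrier M \<Longrightarrow> v \<in> carrier N \<Longrightarrow> b u v \<in> carrier L"
  using bilinD(2) lin_map_closed by fast

text \<open>The representatives are exchanged one argument at a time; each difference lies in the
  kernel of \<open>p\<close> or of \<open>q\<close>. This yields the well-definedness of products
  and of the form.\<close>

lemma bilin_factor_eq:
  assumes mods: "module K M" "module K N" "module K L" "module K M'" "module K N'"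
    and b: "bilin K M N L b" and pq: "lin_map K M M' p" "lin_map K N N' q"
    and ker: "\<And>u v. u \<in> carrier M \<Longrightarrow> v \<in> carrier N \<Longrightarrow> p u = \<zero>\<^bsub>M'\<^esub> \<Longrightarrow> b u v = \<zero>\<^bsub>L\<^esub>"
      "\<And>u v. u \<in> carrier M \<Longrightarrow> v \<in> carrier N \<Longrightarrow> q v = \<zero>\<^bsub>N'\<^esub> \<Longrightarrow> b u v = \<zero>\<^bsub>L\<^esub>"
    and u: "u \<in> carrier M" "u' \<in> carrier M" "p u' = p u"
    and v: "v \<in> carrier N" "v' \<in> carrier N" "q v' = q v"
  shows "b u' v' = b u v"
proof -
  interpret M: module K M by fact
  interpret N: module K N by fact
  have "p (u' \<ominus>\<^bsub>M\<^esub> u) = \<zero>\<^bsub>M'\<^esub>" "q (v' \<ominus>\<^bsub>N\<^esub> v) = \<zero>\<^bsub>N'\<^esub>"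
    using lin_map_kernel_eq[OF mods(1,4) pq(1) u(2,1)] lin_map_kernel_eq[OF mods(2,5) pq(2) v(2,1)] u(3) v(3)
    by simp_all
  then have "b (u' \<ominus>\<^bsub>M\<^esub> u) v = \<zero>\<^bsub>L\<^esub>" "b u' (v' \<ominus>\<^bsub>N\<^esub> v) = \<zero>\<^bsub>L\<^esub>"
    using ker u v by auto
  then show ?thesis
    using lin_map_kernel_eq[OF mods(1,3) bilinD(1)[OF b v(1)] u(2,1)]
      lin_map_kernel_eq[OF mods(2,3) bilinD(2)[OF b u(2)] v(2,1)] by simp
qed

text \<open>The nesting of the two extensions is that of \<open>tensor_mult\<close>, so that
  unfolding identifies the two.\<close>

definition bil_ext :: "('k, 'm) ring_scheme \<Rightarrow> ('k, 'a, 'n) module_scheme \<Rightarrow> ('x \<Rightarrow> 'y \<Rightarrow> 'a)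
    \<Rightarrow> ('x \<Rightarrow> 'k) \<Rightarrow> ('y \<Rightarrow> 'k) \<Rightarrow> 'a" where
  "bil_ext K M f u v = lin_ext K M (\<lambda>x. lin_ext K M (f x) v) u"

text \<open>Linearity in the outer argument is that of \<open>lin_ext\<close>. For the inner
  argument, both sides of each law are linear in \<open>u\<close>, and on a generator
  \<open>gen K x\<close> they reduce to the linearity of the inner extension.\<close>

lemma bil_ext_bilin:
  assumes K: "cring K" and M: "module K M"
    and f: "\<And>x y. x \<in> X \<Longrightarrow> y \<in> Y \<Longrightarrow> f x y \<in> carrier M"
  shows "bilin K (free_module K X) (free_module K Y) M (bil_ext K M f)"
    and "x \<in> X \<Longrightarrow> y \<in> Y \<Longrightarrow> bil_ext K M f (gen K x) (gen K y) = f x y"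
proof -
  note FX = free_module_module[OF K, of X] and FY = free_module_module[OF K, of Y]
  interpret FY: module K "free_module K Y" by (rule FY)
  have inner: "lin_map K (free_module K Y) M (\<lambda>v. lin_ext K M (f x) v)" if "x \<in> X" for x
    by (rule lin_ext_lin_map[OF K M]) (use f that in blast)
  have g: "(\<lambda>x. lin_ext K M (f x) v) \<in> X \<rightarrow> carrier M" if "v \<in> carrier (free_module K Y)" for v
    by (intro Pi_I lin_map_closed[OF inner that])
  have left: "lin_map K (free_module K X) M (\<lambda>u. bil_ext K M f u v)" if "v \<in> carrier (free_module K Y)" for v
    unfolding bil_ext_def using lin_ext_lin_map[OF K M g[OF that]] .
  have at_gen: "bil_ext K M f (gen K x) v = lin_ext K M (f x) v" if "x \<in> X" "v \<in> carrier (free_module K Y)" for x v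
    unfolding bil_ext_def using lin_ext_gen[OF K M g[OF that(2)] that(1)] .
  show "bil_ext K M f (gen K x) (gen K y) = f x y" if "x \<in> X" "y \<in> Y"
    unfolding at_gen[OF that(1) gen_closed[OF K that(2)]]
    by (rule lin_ext_gen[OF K M _ that(2)]) (use f that(1) in blast)
  have right: "lin_map K (free_module K Y) M (bil_ext K M f u)" if u: "u \<in> carrier (free_module K X)" for u
  proof (rule lin_mapI)
    fix v assume v: "v \<in> carrier (free_module K Y)"
    show "bil_ext K M f u v \<in> carrier M" using lin_map_closed[OF left[OF v] u] .
    { fix v' assume v': "v' \<in> carrier (free_module K Y)"
      show "bil_ext K M f u (v \<oplus>\<^bsub>free_module K Y\<^esub> v') = bil_ext K M f u v \<oplus>\<^bsub>M\<^esub> bil_ext K M f u v'"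
        by (rule free_lin_map_eq[OF K M left lin_map_plus[OF FX M left[OF v] left[OF v']] _ u])
          (use v v' in \<open>auto simp: at_gen lin_map_add[OF inner]\<close>) }
    { fix k assume k: "k \<in> carrier K"
      show "bil_ext K M f u (k \<odot>\<^bsub>free_module K Y\<^esub> v) = k \<odot>\<^bsub>M\<^esub> bil_ext K M f u v"
        by (rule free_lin_map_eq[OF K M left lin_map_scale[OF M left[OF v] k] _ u])
          (use v k in \<open>auto simp: at_gen lin_map_smult[OF inner]\<close>) }
  qed
  show "bilin K (free_module K X) (free_module K Y) M (bil_ext K M f)"
    unfolding bilin_def using left right by blast
qed

section \<open>Multilinear maps and permutations of tuples\<close>

lemma tuples_update: "w \<in> tuples E d \<Longrightarrow> x \<in> carrier E \<Longrightarrow> w[i := x] \<in> tuples E d"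
  unfolding tuples_def using set_update_subset_insert by fastforce

lemma tuples_append: "w \<in> tuples E d \<Longrightarrow> w' \<in> tuples E e \<Longrightarrow> w @ w' \<in> tuples E (d + e)"
  by (auto simp: tuples_def)

lemma tuples_length: "w \<in> tuples E d \<Longrightarrow> length w = d"
  by (simp add: tuples_def)

lemma tuples_nth: "w \<in> tuples E d \<Longrightarrow> i < d \<Longrightarrow> w ! i \<in> carrier E"
  by (auto simp: tuples_def)

text \<open>List updates are used as in the generators of \<open>multilinear_rels\<close>, so that
  each condition says that one kind of generator is sent to zero.\<close>

definition multilin :: "('k, 'm) ring_scheme \<Rightarrow> ('k, 'e, 'n) module_scheme \<Rightarrow> nat
    \<Rightarrow> ('k, 'a, 'p) module_scheme \<Rightarrow> ('e list \<Rightarrow> 'a) \<Rightarrow> bool" where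
  "multilin K E d M g \<longleftrightarrow> g \<in> tuples E d \<rightarrow> carrier M \<and>
    (\<forall>w\<in>tuples E d. \<forall>i<d. \<forall>x\<in>carrier E. \<forall>y\<in>carrier E.
      g (w[i := x \<oplus>\<^bsub>E\<^esub> y]) = g (w[i := x]) \<oplus>\<^bsub>M\<^esub> g (w[i := y])) \<and>
    (\<forall>w\<in>tuples E d. \<forall>i<d. \<forall>k\<in>carrier K. \<forall>x\<in>carrier E. g (w[i := k \<odot>\<^bsub>E\<^esub> x]) = k \<odot>\<^bsub>M\<^esub> g (w[i := x]))"

lemma multilinI:
  assumes "\<And>w. w \<in> tuples E d \<Longrightarrow> g w \<in> carrier M"
    and "\<And>w i x y. w \<in> tuples E d \<Longrightarrow> i < d \<Longrightarrow> x \<in> carrier E \<Longrightarrow> y \<in> carrier E \<Longrightarrow>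
      g (w[i := x \<oplus>\<^bsub>E\<^esub> y]) = g (w[i := x]) \<oplus>\<^bsub>M\<^esub> g (w[i := y])"
    and "\<And>w i k x. w \<in> tuples E d \<Longrightarrow> i < d \<Longrightarrow> k \<in> carrier K \<Longrightarrow> x \<in> carrier E \<Longrightarrow>
      g (w[i := k \<odot>\<^bsub>E\<^esub> x]) = k \<odot>\<^bsub>M\<^esub> g (w[i := x])"
  shows "multilin K E d M g"
  using assms by (auto simp: multilin_def)

lemma multilinD:
  assumes "multilin K E d M g" "w \<in> tuples E d" "i < d" "x \<in> carrier E"
  shows "y \<in> carrier E \<Longrightarrow> g (w[i := x \<oplus>\<^bsub>E\<^esub> y]) = g (w[i := x]) \<oplus>\<^bsub>M\<^esub> g (w[i := y])"
    "k \<in> carrier K \<Longrightarrow> g (w[i := k \<odot>\<^bsub>E\<^esub> x]) = k \<odot>\<^bsub>M\<^esub> g (w[i := x])"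
  using assms by (auto simp: multilin_def)

lemma multilin_closed: "multilin K E d M g \<Longrightarrow> w \<in> tuples E d \<Longrightarrow> g w \<in> carrier M"
  by (auto simp: multilin_def)

lemma multilin_lin_map: 
  assumes "multilin K E d M g" "lin_map K M N f"
  shows "multilin K E d N (\<lambda>w. f (g w))"
  by (rule multilinI)
    (use assms in \<open>auto simp: multilin_closed multilinD lin_map_add lin_map_smult tuples_update intro: lin_map_closed\<close>)

lemma multilin_append:
  assumes "multilin K E (d + e) M g" 
  shows "w' \<in> tuples E e \<Longrightarrow> multilin K E d M (\<lambda>w. g (w @ w'))"
    and "w' \<in> tuples E d \<Longrightarrow> multilin K E e M (\<lambda>w. g (w' @ w))"
proof -
  assume w': "w' \<in> tuples E e"
  have *: "w[i := x] @ w' = (w @ w')[i := x]" if "w \<in> tuples E d" "i < d" for w i x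
    using that by (simp add: list_update_append1 tuples_length)
  show "multilin K E d M (\<lambda>w. g (w @ w'))"
    by (rule multilinI) (use w' in \<open>auto simp: * multilin_closed[OF assms] multilinD[OF assms] tuples_append\<close>)
next
  assume w': "w' \<in> tuples E d"
  have *: "w' @ w[i := x] = (w' @ w)[d + i := x]" for w i x
    using w' by (simp add: list_update_append tuples_length)
  show "multilin K E e M (\<lambda>w. g (w' @ w))"
    by (rule multilinI) (use w' in \<open>auto simp: * multilin_closed[OF assms] multilinD[OF assms] tuples_append\<close>)
qed

text \<open>Permutations act on positions counted from 1, lists count from 0: the entry at
  \<open>s\<close> is the one with index \<open>Suc s\<close>.\<close>

lemma perm_tuple_nth: "s < length w \<Longrightarrow> perm_tuple \<sigma> w ! s = w ! (inv' \<sigma> (Suc s) - 1)"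
  by (simp add: perm_tuple_def del: upt_Suc)

lemma length_perm_tuple [simp]: "length (perm_tuple \<sigma> w) = length w"
  by (simp add: perm_tuple_def del: upt_Suc)

lemma permutes_inv_range: "\<sigma> permutes {1..d} \<Longrightarrow> s < d \<Longrightarrow> 1 \<le> inv' \<sigma> (Suc s) \<and> inv' \<sigma> (Suc s) \<le> d \<and> inv' \<sigma> (Suc s) - 1 < d"
  using permutes_in_image[OF permutes_inv, of \<sigma> "{1..d}" "Suc s"] by auto

lemma permutes_range: "\<sigma> permutes {1..d} \<Longrightarrow> i < d \<Longrightarrow> 1 \<le> \<sigma> (Suc i) \<and> \<sigma> (Suc i) \<le> d \<and> \<sigma> (Suc i) - 1 < d"
  using permutes_in_image[of \<sigma> "{1..d}" "Suc i"] by auto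

lemma perm_tuple_tuples: "\<sigma> permutes {1..d} \<Longrightarrow> w \<in> tuples E d \<Longrightarrow> perm_tuple \<sigma> w \<in> tuples E d"
proof -
  assume a: "\<sigma> permutes {1..d}" "w \<in> tuples E d"
  have "perm_tuple \<sigma> w ! s \<in> carrier E" if "s < d" for s
    using permutes_inv_range[OF a(1) that] tuples_nth[OF a(2), of "inv' \<sigma> (Suc s) - 1"] that
    by (simp add: perm_tuple_nth tuples_length[OF a(2)])
  then show ?thesis using a(2) by (auto simp: tuples_def in_set_conv_nth)
qed

text \<open>The entry with index \<open>Suc i\<close> of \<open>w\<close> ends up at index
  \<open>\<sigma> (Suc i)\<close>, so an update of \<open>w\<close> becomes an update of the
  permuted tuple. This is why permuting preserves multilinearity.\<close>

lemma perm_tuple_update: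
  assumes "\<sigma> permutes {1..d}" "length w = d" "i < d"
  shows "perm_tuple \<sigma> (w[i := x]) = (perm_tuple \<sigma> w)[\<sigma> (Suc i) - 1 := x]"
proof -
  have si: "1 \<le> \<sigma> (Suc i)"
    using permutes_range[OF assms(1,3)] by simp
  show "perm_tuple \<sigma> (w[i := x]) = (perm_tuple \<sigma> w)[\<sigma> (Suc i) - 1 := x]"
  proof (rule nth_equalityI)
    fix s assume "s < length (perm_tuple \<sigma> (w[i := x]))"
    then have s: "s < d" using assms by simp
    note r = permutes_inv_range[OF assms(1) s]
    have "i = inv' \<sigma> (Suc s) - 1 \<longleftrightarrow> inv' \<sigma> (Suc s) = Suc i" using r by auto
    also have "\<dots> \<longleftrightarrow> \<sigma> (Suc i) = Suc s" using permutes_inv_eq[OF assms(1)] by metis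
    also have "\<dots> \<longleftrightarrow> \<sigma> (Suc i) - 1 = s" using si by auto
    finally show "perm_tuple \<sigma> (w[i := x]) ! s = (perm_tuple \<sigma> w)[\<sigma> (Suc i) - 1 := x] ! s"
      using s r assms by (auto simp: perm_tuple_nth nth_list_update)
  qed simp
qed

text \<open>All indices above \<open>d\<close> are fixed, so acting on the first factors of a
  product is acting by the same permutation on the whole. This is where the inclusion of
  \<open>W d\<close> in the later groups will be used.\<close>

lemma perm_tuple_append:
  assumes "\<sigma> permutes {1..d}" "length w = d"
  shows "perm_tuple \<sigma> w @ w' = perm_tuple \<sigma> (w @ w')"
proof (rule nth_equalityI)
  fix s assume "s < length (perm_tuple \<sigma> w @ w')"
  then have s: "s < d + length w'" using assms by simp
  show "(perm_tuple \<sigma> w @ w') ! s = perm_tuple \<sigma> (w @ w') ! s"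
  proof (cases "s < d")
    case True
    then show ?thesis using s assms permutes_inv_range[OF assms(1) True]
      by (auto simp: perm_tuple_nth nth_append)
  next
    case False
    then have "inv' \<sigma> (Suc s) = Suc s" using permutes_not_in[OF permutes_inv[OF assms(1)]] by simp
    then show ?thesis using s False assms by (simp add: perm_tuple_nth nth_append)
  qed
qed simp

lemma inv_omega_funpow:
  assumes "\<sigma> permutes {1..d}"
  shows "inv' ((omega ^^ k) \<sigma>) = (omega ^^ k) (inv' \<sigma>)"
proof -
  note p = assms permutes_inv[OF assms]
  have z: "\<sigma> 0 = 0" "inv' \<sigma> 0 = 0" using permutes_not_in[OF p(1), of 0] permutes_not_in[OF p(2), of 0] by auto
  \<comment> \<open>Positive points stay positive, so a point above \<open>k\<close> is sent above
    \<open>k\<close> by the shifted map and the second branch of \<open>omega_funpow\<close> applies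
    again.\<close>
  have nz: "\<sigma> t \<noteq> 0" "inv' \<sigma> t \<noteq> 0" if "t \<noteq> 0" for t
    using permutes_inj[OF p(1)] permutes_inj[OF p(2)] z that by (metis injD)+
  note o = omega_funpow[of \<sigma>, OF z(1)] omega_funpow[of "inv' \<sigma>", OF z(2)]
  show ?thesis
    by (rule inv_unique_comp) (auto simp: fun_eq_iff o nz permutes_inverses[OF assms])
qed

text \<open>Counterpart of \<open>perm_tuple_append\<close>: acting on the last factors of a product
  is acting by a shifted permutation on the whole. This is what makes closure under
  \<open>omega\<close> the right condition for a product.\<close>

lemma perm_tuple_omega:
  assumes "\<sigma> permutes {1..d}" "length w = d" "length w' = k"
  shows "w' @ perm_tuple \<sigma> w = perm_tuple ((omega ^^ k) \<sigma>) (w' @ w)"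
proof (rule nth_equalityI)
  have z: "inv' \<sigma> 0 = 0" using permutes_not_in[OF permutes_inv[OF assms(1)], of 0] by auto
  fix s assume "s < length (w' @ perm_tuple \<sigma> w)"
  then have s: "s < k + d" using assms by simp
  show "(w' @ perm_tuple \<sigma> w) ! s = perm_tuple ((omega ^^ k) \<sigma>) (w' @ w) ! s"
  proof (cases "s < k")
    case True
    then show ?thesis using s assms 
      by (simp add: perm_tuple_nth nth_append inv_omega_funpow[OF assms(1)] omega_funpow[of "inv' \<sigma>", OF z])
  next
    case False
    then have "s - k < d" using s by linarith
    then obtain j where "inv' \<sigma> (Suc (s - k)) = Suc j"
      using permutes_inv_range[OF assms(1)] by (metis One_nat_def Suc_le_D)
    then show ?thesis using s False assms
      by (simp add: perm_tuple_nth nth_append inv_omega_funpow[OF assms(1)] omega_funpow[of "inv' \<sigma>", OF z] Suc_diff_le)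
  qed
qed simp

lemma multilin_perm:
  assumes "multilin K E d M g" "\<sigma> permutes {1..d}"
  shows "multilin K E d M (\<lambda>w. g (perm_tuple \<sigma> w))"
  by (rule multilinI)
    (simp_all del: One_nat_def add: multilin_closed[OF assms(1)] perm_tuple_tuples[OF assms(2)]
      perm_tuple_update[OF assms(2)] permutes_range[OF assms(2)] tuples_length multilinD[OF assms(1)])

section \<open>The groups, the character and its square\<close>

locale omega_character = K: cring K for K :: "('k, 'm) ring_scheme" +
  fixes W :: "nat \<Rightarrow> (nat \<Rightarrow> nat) set" and \<chi> :: "nat \<Rightarrow> (nat \<Rightarrow> nat) \<Rightarrow> 'k"
  assumes omega_invariant: "omega_invariant K W \<chi>"
begin

lemma
  assumes "d \<ge> 1"
  shows W_permutes: "\<sigma> \<in> W d \<Longrightarrow> \<sigma> permutes {1..d}"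
    and W_id: "id \<in> W d"
    and W_comp: "\<sigma> \<in> W d \<Longrightarrow> \<tau> \<in> W d \<Longrightarrow> \<sigma> \<circ> \<tau> \<in> W d"
    and W_inv: "\<sigma> \<in> W d \<Longrightarrow> inv' \<sigma> \<in> W d"
    and chi_Units: "\<sigma> \<in> W d \<Longrightarrow> \<chi> d \<sigma> \<in> Units K"
    and chi_comp: "\<sigma> \<in> W d \<Longrightarrow> \<tau> \<in> W d \<Longrightarrow> \<chi> d (\<sigma> \<circ> \<tau>) = \<chi> d \<sigma> \<otimes>\<^bsub>K\<^esub> \<chi> d \<tau>"
proof -
  have s: "subgroup (W d) (sym_group d)" and h: "\<chi> d \<in> hom (sym_group d\<lparr>carrier := W d\<rparr>) (units_of K)"
    using omega_invariant assms by (auto simp: omega_invariant_def)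
  show p: "\<sigma> \<in> W d \<Longrightarrow> \<sigma> permutes {1..d}" for \<sigma>
    using subgroup.subset[OF s] sym_group_carrier by blast
  show "id \<in> W d" using subgroup.one_closed[OF s] by (simp add: sym_group_one)
  show "\<sigma> \<in> W d \<Longrightarrow> \<tau> \<in> W d \<Longrightarrow> \<sigma> \<circ> \<tau> \<in> W d"
    using subgroup.m_closed[OF s] by (simp add: sym_group_mult)
  show "\<sigma> \<in> W d \<Longrightarrow> inv' \<sigma> \<in> W d"
    using subgroup.m_inv_closed[OF s] p by (metis sym_group_carrier sym_group_inv_equality)
  show "\<sigma> \<in> W d \<Longrightarrow> \<chi> d \<sigma> \<in> Units K"
    using h by (auto simp: hom_def units_of_carrier)
  show "\<sigma> \<in> W d \<Longrightarrow> \<tau> \<in> W d \<Longrightarrow> \<chi> d (\<sigma> \<circ> \<tau>) = \<chi> d \<sigma> \<otimes>\<^bsub>K\<^esub> \<chi> d \<tau>"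
    using h by (auto simp: hom_def units_of_mult sym_group_mult)
qed

lemma chi_closed: "d \<ge> 1 \<Longrightarrow> \<sigma> \<in> W d \<Longrightarrow> \<chi> d \<sigma> \<in> carrier K"
  using chi_Units by blast

lemma chi_inv_closed: "d \<ge> 1 \<Longrightarrow> \<sigma> \<in> W d \<Longrightarrow> inv\<^bsub>K\<^esub> (\<chi> d \<sigma>) \<in> carrier K"
  using chi_Units by simp

lemma W_add:
  assumes "d \<ge> 1" "\<sigma> \<in> W d"
  shows "\<sigma> \<in> W (d + e) \<and> \<chi> (d + e) \<sigma> = \<chi> d \<sigma>"
proof (induction e)
  case (Suc e)
  have "\<forall>d\<ge>1. W d \<subseteq> W (d + 1) \<and> (\<forall>\<sigma>\<in>W d. \<chi> (d + 1) \<sigma> = \<chi> d \<sigma>)"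
    using omega_invariant by (auto simp: omega_invariant_def)
  from this[rule_format, of "d + e"] show ?case using Suc assms by auto
qed (use assms in auto)

lemma W_omega_add:
  assumes "d \<ge> 1" "\<sigma> \<in> W d"
  shows "(omega ^^ e) \<sigma> \<in> W (d + e) \<and> \<chi> (d + e) ((omega ^^ e) \<sigma>) = \<chi> d \<sigma>"
proof (induction e)
  case (Suc e)
  have "\<forall>d\<ge>1. omega ` W d \<subseteq> W (d + 1) \<and> (\<forall>\<sigma>\<in>W d. \<chi> (d + 1) (omega \<sigma>) = \<chi> d \<sigma>)"
    using omega_invariant by (auto simp: omega_invariant_def)
  from this[rule_format, of "d + e"] show ?case using Suc assms by auto
qed (use assms in auto)

lemma W_le:
  assumes "1 \<le> d" "d \<le> d'" "\<sigma> \<in> W d"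
  shows "\<sigma> \<in> W d'" "\<chi> d' \<sigma> = \<chi> d \<sigma>"
  using W_add[of d \<sigma> "d' - d"] assms by auto

lemma finite_W: "d \<ge> 1 \<Longrightarrow> finite (W d)"
  by (rule finite_subset[of _ "{\<sigma>. \<sigma> permutes {1..d}}"]) (use W_permutes in \<open>blast intro: finite_permutations\<close>)+

lemma chi_square:
  assumes "d \<ge> 1" "\<sigma> \<in> W d"
  shows "\<chi> d \<sigma> \<otimes>\<^bsub>K\<^esub> \<chi> d \<sigma> = \<one>\<^bsub>K\<^esub>"
proof -
  define G where "G = (\<Union>d\<in>{1..}. W d)"
  \<comment> \<open>The chosen degree does not matter: any two degrees in which \<open>g\<close>
    occurs are compared in the larger of them, where the values agree.\<close>
  define v where "v g = \<chi> (SOME d. d \<ge> 1 \<and> g \<in> W d) g" for g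
  have v: "v g = \<chi> d g" if "d \<ge> 1" "g \<in> W d" for g d
  proof -
    define e where "e = (SOME d. d \<ge> 1 \<and> g \<in> W d)"
    have e: "e \<ge> 1 \<and> g \<in> W e" unfolding e_def by (rule someI[of _ d]) (use that in simp)
    have "\<chi> e g = \<chi> (max d e) g" "\<chi> d g = \<chi> (max d e) g"
      using W_le(2)[of e "max d e" g] W_le(2)[of d "max d e" g] e that by auto
    then show ?thesis by (simp add: v_def e_def)
  qed
  have common: "\<exists>d\<ge>1. g \<in> W d \<and> h \<in> W d" if gh: "g \<in> G" "h \<in> G" for g h
  proof -
    obtain a b where "a \<ge> 1" "b \<ge> 1" "g \<in> W a" "h \<in> W b" using gh by (auto simp: G_def)
    then show ?thesis using W_le(1)[of a "max a b" g] W_le(1)[of b "max a b" h]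
      by (intro exI[of _ "max a b"]) auto
  qed
  have mem: "g \<in> G" if "d \<ge> 1" "g \<in> W d" for g d using that by (auto simp: G_def)
  interpret shift_invariant_character G "units_of K" v
  proof (intro shift_invariant_character.intro shift_closed_group.intro shift_invariant_character_axioms.intro
      K.units_comm_group)
    fix g assume "g \<in> G"
    then obtain a where a: "a \<ge> 1" "g \<in> W a" by (auto simp: G_def)
    show "\<exists>d. g permutes {1..d}" using W_permutes a by blast
    show "inv' g \<in> G" using W_inv mem a by blast
    show "omega g \<in> G" using W_omega_add[OF a, of 1] mem[of "a + 1"] by simp
    show "v g \<in> carrier (units_of K)" using v[OF a] chi_Units[OF a] by (simp add: units_of_carrier)
  next
    fix g h assume "g \<in> G" "h \<in> G"
    then obtain a where a: "a \<ge> 1" "g \<in> W a" "h \<in> W a" using common by blast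
    then show "g \<circ> h \<in> G" using W_comp mem by blast
    show "v (g \<circ> h) = v g \<otimes>\<^bsub>units_of K\<^esub> v h"
      using v[OF a(1)] a W_comp chi_comp by (simp add: units_of_mult)
  qed
  show ?thesis using v_square[OF mem[OF assms]] v[OF assms] by (simp add: units_of_mult units_of_one)
qed

lemma chi_inv_eq:
  assumes "d \<ge> 1" "\<sigma> \<in> W d" shows "inv\<^bsub>K\<^esub> (\<chi> d \<sigma>) = \<chi> d \<sigma>"
  using chi_square[OF assms] chi_closed[OF assms] K.comm_inv_char by simp

lemma chi_id: "d \<ge> 1 \<Longrightarrow> \<chi> d id = \<one>\<^bsub>K\<^esub>"
  using chi_comp[of d id id] W_id[of d] chi_square[of d id] by simp

end

lemma multilin_cong:
  assumes "module K E" "multilin K E d M h" "\<And>w. w \<in> tuples E d \<Longrightarrow> g w = h w"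
  shows "multilin K E d M g"
proof -
  interpret E: module K E by fact
  show ?thesis
    by (rule multilinI)
      (simp_all add: assms(3) tuples_update multilin_closed[OF assms(2)] multilinD[OF assms(2)])
qed

section \<open>Tensor powers as quotients of free modules\<close>

definition tensor_class :: "('k, 'm) ring_scheme \<Rightarrow> ('k, 'e, 'n) module_scheme \<Rightarrow> nat
    \<Rightarrow> ('e list \<Rightarrow> 'k) \<Rightarrow> ('e list \<Rightarrow> 'k) set" where
  "tensor_class K E d u = multilinear_rels K E d +>\<^bsub>free_tensors K E d\<^esub> u"

text \<open>The composite of both quotient maps. Every element of a power is written as such a class
  of an element of the free module, so that the intermediate tensor power seldom appears
  later.\<close>

definition chi_class :: "('k, 'm) ring_scheme \<Rightarrow> (nat \<Rightarrow> (nat \<Rightarrow> nat) set) \<Rightarrow> (nat \<Rightarrow> (nat \<Rightarrow> nat) \<Rightarrow> 'k)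
    \<Rightarrow> ('k, 'e, 'n) module_scheme \<Rightarrow> nat \<Rightarrow> ('e list \<Rightarrow> 'k) \<Rightarrow> ('e list \<Rightarrow> 'k) set set" where
  "chi_class K W \<chi> E d u = chi_rels K W \<chi> E d +>\<^bsub>tensor_power K E d\<^esub> tensor_class K E d u"

definition conc :: "('k, 'm) ring_scheme \<Rightarrow> ('k, 'e, 'n) module_scheme \<Rightarrow> nat \<Rightarrow> nat
    \<Rightarrow> ('e list \<Rightarrow> 'k) \<Rightarrow> ('e list \<Rightarrow> 'k) \<Rightarrow> 'e list \<Rightarrow> 'k" where
  "conc K E d e = bil_ext K (free_tensors K E (d + e)) (\<lambda>w w'. gen K (w @ w'))"

context
  fixes K :: "('k, 'm) ring_scheme" and E :: "('k, 'e, 'n) module_scheme"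
  assumes K: "cring K" and E: "module K E"
begin

interpretation K: cring K by (rule K)
interpretation E: module K E by (rule E)

lemma free_tensors_module: "module K (free_tensors K E d)"
  by (rule free_module_module[OF K])

lemma multilinear_rels_submodule: "submodule (multilinear_rels K E d) K (free_tensors K E d)"
proof -
  interpret F: module K "free_tensors K E d" by (rule free_tensors_module)
  show ?thesis
    unfolding multilinear_rels_def
    by (rule generated_submodule_submodule[OF free_tensors_module])
      (auto intro!: F.M.minus_closed F.M.a_closed F.smult_closed gen_closed[OF K] tuples_update)
qed

lemma tensor_power_module: "module K (tensor_power K E d)"
  unfolding tensor_power_def by (rule quot_module_module[OF free_tensors_module multilinear_rels_submodule])

lemma tensor_class_lin_map: "lin_map K (free_tensors K E d) (tensor_power K E d) (tensor_class K E d)"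
  unfolding tensor_power_def tensor_class_def
  by (rule quot_lin_map[OF free_tensors_module multilinear_rels_submodule])

lemma tensor_class_zero_iff:
  "u \<in> carrier (free_tensors K E d) \<Longrightarrow> tensor_class K E d u = \<zero>\<^bsub>tensor_power K E d\<^esub> \<longleftrightarrow> u \<in> multilinear_rels K E d"
  unfolding tensor_power_def tensor_class_def
  by (rule quot_eq_zero_iff[OF free_tensors_module multilinear_rels_submodule])

lemma tensor_power_carrier: "carrier (tensor_power K E d) = tensor_class K E d ` carrier (free_tensors K E d)"
  unfolding tensor_power_def quot_carrier[OF free_tensors_module multilinear_rels_submodule]
  by (simp add: tensor_class_def)

text \<open>The universal property of the tensor power in kernel form: the kernel of
  \<open>f\<close> is a submodule, and multilinearity on generators says that it contains the
  defining relations.\<close>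

lemma multilin_vanish:
  assumes M: "module K M" and f: "lin_map K (free_tensors K E d) M f"
    and g: "multilin K E d M (\<lambda>w. f (gen K w))"
    and u: "u \<in> carrier (free_tensors K E d)" "tensor_class K E d u = \<zero>\<^bsub>tensor_power K E d\<^esub>"
  shows "f u = \<zero>\<^bsub>M\<^esub>"
proof -
  let ?F = "free_tensors K E d"
  interpret M: module K M by (rule M)
  interpret F: module K ?F by (rule free_tensors_module)
  have gc: "gen K w \<in> carrier ?F" if "w \<in> tuples E d" for w
    using gen_closed[OF K that] .
  have "multilinear_rels K E d \<subseteq> {u \<in> carrier ?F. f u = \<zero>\<^bsub>M\<^esub>}"
    unfolding multilinear_rels_def
  proof (rule generated_submodule_minimal[OF submodule_ker[OF free_tensors_module M f]], safe)
    fix w i x y assume a: "w \<in> tuples E d" "i < d" "x \<in> carrier E" "y \<in> carrier E"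
    then have t: "w[i := x \<oplus>\<^bsub>E\<^esub> y] \<in> tuples E d" "w[i := x] \<in> tuples E d" "w[i := y] \<in> tuples E d"
      by (auto intro: tuples_update)
    show c: "gen K (w[i := x \<oplus>\<^bsub>E\<^esub> y]) \<ominus>\<^bsub>?F\<^esub> (gen K (w[i := x]) \<oplus>\<^bsub>?F\<^esub> gen K (w[i := y])) \<in> carrier ?F"
      using t gc by simp
    show "f (gen K (w[i := x \<oplus>\<^bsub>E\<^esub> y]) \<ominus>\<^bsub>?F\<^esub> (gen K (w[i := x]) \<oplus>\<^bsub>?F\<^esub> gen K (w[i := y]))) = \<zero>\<^bsub>M\<^esub>"
      using lin_map_kernel_eq[OF free_tensors_module M f] t gc lin_map_add[OF f] multilinD(1)[OF g a] by simp
  next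
    fix w i k x assume a: "w \<in> tuples E d" "i < d" "k \<in> carrier K" "x \<in> carrier E"
    then have t: "w[i := k \<odot>\<^bsub>E\<^esub> x] \<in> tuples E d" "w[i := x] \<in> tuples E d"
      by (auto intro: tuples_update)
    show c: "gen K (w[i := k \<odot>\<^bsub>E\<^esub> x]) \<ominus>\<^bsub>?F\<^esub> (k \<odot>\<^bsub>?F\<^esub> gen K (w[i := x])) \<in> carrier ?F"
      using t gc a by simp
    show "f (gen K (w[i := k \<odot>\<^bsub>E\<^esub> x]) \<ominus>\<^bsub>?F\<^esub> (k \<odot>\<^bsub>?F\<^esub> gen K (w[i := x]))) = \<zero>\<^bsub>M\<^esub>"
      using lin_map_kernel_eq[OF free_tensors_module M f] t gc a lin_map_smult[OF f] multilinD(2)[OF g a(1,2,4,3)] by simp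
  qed
  then show ?thesis using u tensor_class_zero_iff by blast
qed

lemma multilin_tensor_class: "multilin K E d (tensor_power K E d) (\<lambda>w. tensor_class K E d (gen K w))"
proof (rule multilinI)
  let ?F = "free_tensors K E d"
  interpret F: module K ?F by (rule free_tensors_module)
  note tl = tensor_class_lin_map[of d]
  note ke = lin_map_kernel_eq[OF free_tensors_module tensor_power_module tl]
  have gc: "gen K w \<in> carrier ?F" if "w \<in> tuples E d" for w
    using gen_closed[OF K that] .
  show "tensor_class K E d (gen K w) \<in> carrier (tensor_power K E d)" if "w \<in> tuples E d" for w
    using gc[OF that] lin_map_closed[OF tl] by blast
  fix w i x assume a: "w \<in> tuples E d" "i < d" "x \<in> carrier E"
  then have t: "gen K (w[i := x]) \<in> carrier ?F" by (intro gc tuples_update)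
  { fix y assume y: "y \<in> carrier E"
    have t': "gen K (w[i := y]) \<in> carrier ?F" "gen K (w[i := x \<oplus>\<^bsub>E\<^esub> y]) \<in> carrier ?F"
      using a y by (auto intro!: gc tuples_update)
    have "gen K (w[i := x \<oplus>\<^bsub>E\<^esub> y]) \<ominus>\<^bsub>?F\<^esub> (gen K (w[i := x]) \<oplus>\<^bsub>?F\<^esub> gen K (w[i := y])) \<in> multilinear_rels K E d"
      unfolding multilinear_rels_def by (rule subsetD[OF generated_submodule_incl]) (use a y in blast)
    then show "tensor_class K E d (gen K (w[i := x \<oplus>\<^bsub>E\<^esub> y])) =
        tensor_class K E d (gen K (w[i := x])) \<oplus>\<^bsub>tensor_power K E d\<^esub> tensor_class K E d (gen K (w[i := y]))"
      using ke t t' tensor_class_zero_iff by (simp add: lin_map_add[OF tl, symmetric]) }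
  { fix k assume k: "k \<in> carrier K"
    have t': "gen K (w[i := k \<odot>\<^bsub>E\<^esub> x]) \<in> carrier ?F"
      using a k by (auto intro!: gc tuples_update)
    have "gen K (w[i := k \<odot>\<^bsub>E\<^esub> x]) \<ominus>\<^bsub>?F\<^esub> (k \<odot>\<^bsub>?F\<^esub> gen K (w[i := x])) \<in> multilinear_rels K E d"
      unfolding multilinear_rels_def by (rule subsetD[OF generated_submodule_incl]) (use a k in blast)
    then show "tensor_class K E d (gen K (w[i := k \<odot>\<^bsub>E\<^esub> x])) =
        k \<odot>\<^bsub>tensor_power K E d\<^esub> tensor_class K E d (gen K (w[i := x]))"
      using ke t t' k tensor_class_zero_iff by (simp add: lin_map_smult[OF tl, symmetric]) }
qed

lemma conc_bilin: "bilin K (free_tensors K E d) (free_tensors K E e) (free_tensors K E (d + e)) (conc K E d e)"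
  unfolding conc_def
  by (rule bil_ext_bilin(1)[OF K free_tensors_module]) (auto intro: gen_closed[OF K] tuples_append)

lemma conc_gen: "w \<in> tuples E d \<Longrightarrow> w' \<in> tuples E e \<Longrightarrow> conc K E d e (gen K w) (gen K w') = gen K (w @ w')"
  unfolding conc_def
  by (rule bil_ext_bilin(2)[OF K free_tensors_module]) (auto intro: gen_closed[OF K] tuples_append)

lemma conc_closed:
  "u \<in> carrier (free_tensors K E d) \<Longrightarrow> v \<in> carrier (free_tensors K E e) \<Longrightarrow> conc K E d e u v \<in> carrier (free_tensors K E (d + e))"
  by (rule bilin_closed[OF conc_bilin])

text \<open>Both sides are linear in each argument, and on generators this is associativity of list
  append. The arguments are freed one at a time, from the last to the first.\<close>

lemma conc_assoc:
  assumes u: "u \<in> carrier (free_tensors K E d)" and v: "v \<in> carrier (free_tensors K E e)"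
    and t: "t \<in> carrier (free_tensors K E f)"
  shows "conc K E (d + e) f (conc K E d e u v) t = conc K E d (e + f) u (conc K E e f v t)"
proof -
  note M = free_tensors_module[of "d + e + f"]
  note lc1 = bilinD(1)[OF conc_bilin] and lc2 = bilinD(2)[OF conc_bilin]
  \<comment> \<open>The two bracketings of the degree occur in the modules themselves and have to be
    identified before linear maps into them can be compared.\<close>
  have M': "free_tensors K E (d + (e + f)) = free_tensors K E (d + e + f)" by (simp add: add.assoc)
  have 1: "conc K E (d + e) f (conc K E d e (gen K w) (gen K w')) t = conc K E d (e + f) (gen K w) (conc K E e f (gen K w') t)"
    if w: "w \<in> tuples E d" "w' \<in> tuples E e" for w w'
  proof (rule free_lin_map_eq[OF K M _ _ _ t])
    note g = gen_closed[OF K w(1)] gen_closed[OF K w(2)]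
    show "lin_map K (free_tensors K E f) (free_tensors K E (d + e + f))
        (conc K E (d + e) f (conc K E d e (gen K w) (gen K w')))"
      by (intro lc2 conc_closed g)
    show "lin_map K (free_tensors K E f) (free_tensors K E (d + e + f))
        (\<lambda>t. conc K E d (e + f) (gen K w) (conc K E e f (gen K w') t))"
      unfolding M'[symmetric] by (rule lin_map_comp[OF lc2 lc2]; rule g)
  qed (simp add: conc_gen w tuples_append)
  have 2: "conc K E (d + e) f (conc K E d e (gen K w) v) t = conc K E d (e + f) (gen K w) (conc K E e f v t)"
    if w: "w \<in> tuples E d" for w
  proof (rule free_lin_map_eq[OF K M _ _ _ v])
    note g = gen_closed[OF K w]
    show "lin_map K (free_tensors K E e) (free_tensors K E (d + e + f))
        (\<lambda>v. conc K E (d + e) f (conc K E d e (gen K w) v) t)"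
      by (rule lin_map_comp[OF lc2[OF g] lc1[OF t]])
    show "lin_map K (free_tensors K E e) (free_tensors K E (d + e + f))
        (\<lambda>v. conc K E d (e + f) (gen K w) (conc K E e f v t))"
      unfolding M'[symmetric] by (rule lin_map_comp[OF lc1[OF t] lc2[OF g]])
  qed (simp add: 1 w)
  show ?thesis
  proof (rule free_lin_map_eq[OF K M _ _ _ u])
    show "lin_map K (free_tensors K E d) (free_tensors K E (d + e + f))
        (\<lambda>u. conc K E (d + e) f (conc K E d e u v) t)"
      by (rule lin_map_comp[OF lc1[OF v] lc1[OF t]])
    show "lin_map K (free_tensors K E d) (free_tensors K E (d + e + f))
        (\<lambda>u. conc K E d (e + f) u (conc K E e f v t))"
      unfolding M'[symmetric] by (intro lc1 conc_closed v t)
  qed (simp add: 2)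
qed

lemma conc_nil:
  assumes u: "u \<in> carrier (free_tensors K E d)"
  shows "conc K E 0 d (gen K []) u = u" "conc K E d 0 u (gen K []) = u"
proof -
  have n: "[] \<in> tuples E 0" by (simp add: tuples_def)
  note M = free_tensors_module[of d]
  have i: "lin_map K (free_tensors K E d) (free_tensors K E d) (\<lambda>u. u)" by (auto intro: lin_mapI)
  show "conc K E 0 d (gen K []) u = u"
    using bilinD(2)[OF conc_bilin[of 0 d] gen_closed[OF K n]]
    by (intro free_lin_map_eq[OF K M _ i _ u]) (simp_all add: conc_gen n)
  show "conc K E d 0 u (gen K []) = u"
    using bilinD(1)[OF conc_bilin[of d 0] gen_closed[OF K n]]
    by (intro free_lin_map_eq[OF K M _ i _ u]) (simp_all add: conc_gen n)
qed

lemma tensor_class_UN: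
  assumes "u \<in> carrier (free_tensors K E d)"
    "\<And>u'. u' \<in> carrier (free_tensors K E d) \<Longrightarrow> tensor_class K E d u' = tensor_class K E d u \<Longrightarrow> g u' = c"
  shows "(\<Union>u'\<in>tensor_class K E d u. g u') = c"
  using UN_coset_const[OF free_tensors_module multilinear_rels_submodule assms(1), of g c] assms(2)
  by (simp add: tensor_class_def)

text \<open>Independence of representatives: with a generator fixed in one argument, concatenation
  is multilinear in the other and so kills its relations. Induction over the generators of the fixed
  argument extends this to all of its elements.\<close>

lemma tensor_mult_class:
  assumes u: "u \<in> carrier (free_tensors K E d)" and v: "v \<in> carrier (free_tensors K E e)"
  shows "tensor_mult K E d e (tensor_class K E d u) (tensor_class K E e v) = tensor_class K E (d + e) (conc K E d e u v)"
proof -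
  let ?b = "\<lambda>u v. tensor_class K E (d + e) (conc K E d e u v)"
  note T = tensor_power_module[of "d + e"]
  have b: "bilin K (free_tensors K E d) (free_tensors K E e) (tensor_power K E (d + e)) ?b"
    by (rule bilin_comp[OF conc_bilin tensor_class_lin_map])
  have bg: "?b (gen K w) (gen K w') = tensor_class K E (d + e) (gen K (w @ w'))"
    if "w \<in> tuples E d" "w' \<in> tuples E e" for w w'
    using that by (simp add: conc_gen)
  have l: "?b u v = \<zero>\<^bsub>tensor_power K E (d + e)\<^esub>"
    if u: "u \<in> carrier (free_tensors K E d)" "tensor_class K E d u = \<zero>\<^bsub>tensor_power K E d\<^esub>"
      and v: "v \<in> carrier (free_tensors K E e)" for u v
  proof (rule subsetD[OF free_module_induct[OF K submodule_ker[OF free_tensors_module T bilinD(2)[OF b u(1)]]] v, THEN CollectD, THEN conjunct2])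
    fix w' assume w': "w' \<in> tuples E e"
    note g = gen_closed[OF K w']
    have "multilin K E d (tensor_power K E (d + e)) (\<lambda>w. ?b (gen K w) (gen K w'))"
      by (rule multilin_cong[OF E multilin_append(1)[OF multilin_tensor_class w']]) (simp add: conc_gen w')
    then show "gen K w' \<in> {v \<in> carrier (free_tensors K E e). ?b u v = \<zero>\<^bsub>tensor_power K E (d + e)\<^esub>}"
      using multilin_vanish[OF T bilinD(1)[OF b g] _ u] g by simp
  qed
  have r: "?b u v = \<zero>\<^bsub>tensor_power K E (d + e)\<^esub>"
    if u: "u \<in> carrier (free_tensors K E d)" 
      and v: "v \<in> carrier (free_tensors K E e)" "tensor_class K E e v = \<zero>\<^bsub>tensor_power K E e\<^esub>" for u v
  proof (rule subsetD[OF free_module_induct[OF K submodule_ker[OF free_tensors_module T bilinD(1)[OF b v(1)]]] u, THEN CollectD, THEN conjunct2])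
    fix w' assume w': "w' \<in> tuples E d"
    note g = gen_closed[OF K w']
    have "multilin K E e (tensor_power K E (d + e)) (\<lambda>w. ?b (gen K w') (gen K w))"
      by (rule multilin_cong[OF E multilin_append(2)[OF multilin_tensor_class w']]) (simp add: conc_gen w')
    then show "gen K w' \<in> {u \<in> carrier (free_tensors K E d). ?b u v = \<zero>\<^bsub>tensor_power K E (d + e)\<^esub>}"
      using multilin_vanish[OF T bilinD(2)[OF b g] _ v] g by simp
  qed
  note eq = bilin_factor_eq[OF free_tensors_module free_tensors_module T tensor_power_module tensor_power_module b
      tensor_class_lin_map tensor_class_lin_map _ _ u]
  show ?thesis
    unfolding tensor_mult_def
  proof (rule tensor_class_UN[OF u], rule tensor_class_UN[OF v])
    fix u' v'
    assume a: "u' \<in> carrier (free_tensors K E d)" "tensor_class K E d u' = tensor_class K E d u"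
      "v' \<in> carrier (free_tensors K E e)" "tensor_class K E e v' = tensor_class K E e v"
    have "?b u' v' = ?b u v" by (rule eq[OF _ _ a(1,2) v a(3,4)]) (rule l r; assumption)+
    then show "multilinear_rels K E (d + e) +>\<^bsub>free_tensors K E (d + e)\<^esub>
        lin_ext K (free_tensors K E (d + e)) (\<lambda>w. lin_ext K (free_tensors K E (d + e)) (\<lambda>w'. gen K (w @ w')) v') u' = ?b u v"
      by (simp add: conc_def bil_ext_def tensor_class_def)
  qed
qed

end

section \<open>The quotients by the character and their product\<close>

context omega_character
begin

definition act :: "('k, 'e, 'n) module_scheme \<Rightarrow> nat \<Rightarrow> (nat \<Rightarrow> nat) \<Rightarrow> ('e list \<Rightarrow> 'k) \<Rightarrow> ('e list \<Rightarrow> 'k)" where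
  "act E d \<sigma> = lin_ext K (free_tensors K E d) (\<lambda>w. gen K (perm_tuple \<sigma> w))"

text \<open>What a map on tuples has to satisfy, besides multilinearity, to descend to
  \<open>chi_power\<close>; as in \<open>chi_rels\<close>, nothing is demanded in degree 0.\<close>

definition equivar :: "('k, 'e, 'n) module_scheme \<Rightarrow> nat \<Rightarrow> ('k, 'a, 'p) module_scheme \<Rightarrow> ('e list \<Rightarrow> 'a) \<Rightarrow> bool" where
  "equivar E d M g \<longleftrightarrow>
    (\<forall>\<sigma>\<in>W d. \<forall>w\<in>tuples E d. d \<ge> 1 \<longrightarrow> g (perm_tuple \<sigma> w) = inv\<^bsub>K\<^esub> (\<chi> d \<sigma>) \<odot>\<^bsub>M\<^esub> g w)"

context
  fixes E :: "('k, 'e, 'n) module_scheme"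
  assumes E: "module K E"
begin

interpretation E: module K E by (rule E)

abbreviation (input) "FT d \<equiv> free_tensors K E d"
abbreviation (input) "TP d \<equiv> tensor_power K E d"
abbreviation (input) "CP d \<equiv> chi_power K W \<chi> E d"
abbreviation (input) "tc d \<equiv> tensor_class K E d"
abbreviation (input) "cc d \<equiv> chi_class K W \<chi> E d"

lemmas FT_module = free_tensors_module[OF K.is_cring E]
lemmas TP_module = tensor_power_module[OF K.is_cring E]
lemmas tc_lin_map = tensor_class_lin_map[OF K.is_cring E]
lemmas gen_FT = gen_closed[OF K.is_cring]

lemma act_lin_map:
  assumes "\<sigma> permutes {1..d}" shows "lin_map K (FT d) (FT d) (act E d \<sigma>)"
    and "w \<in> tuples E d \<Longrightarrow> act E d \<sigma> (gen K w) = gen K (perm_tuple \<sigma> w)"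
proof -
  have *: "(\<lambda>w. gen K (perm_tuple \<sigma> w)) \<in> tuples E d \<rightarrow> carrier (FT d)"
    by (intro Pi_I gen_FT perm_tuple_tuples[OF assms])
  show "lin_map K (FT d) (FT d) (act E d \<sigma>)"
    unfolding act_def by (rule lin_ext_lin_map[OF K.is_cring FT_module *])
  show "w \<in> tuples E d \<Longrightarrow> act E d \<sigma> (gen K w) = gen K (perm_tuple \<sigma> w)"
    unfolding act_def by (rule lin_ext_gen[OF K.is_cring FT_module *])
qed

lemma tensor_act_class:
  assumes s: "\<sigma> permutes {1..d}" and u: "u \<in> carrier (FT d)"
  shows "tensor_act K E d \<sigma> (tc d u) = tc d (act E d \<sigma> u)"
proof -
  let ?f = "\<lambda>u. tc d (act E d \<sigma> u)"
  interpret F: module K "FT d" by (rule FT_module)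
  have f: "lin_map K (FT d) (TP d) ?f" by (rule lin_map_comp[OF act_lin_map(1)[OF s] tc_lin_map])
  have "multilin K E d (TP d) (\<lambda>w. tc d (gen K (perm_tuple \<sigma> w)))"
    by (rule multilin_perm[OF multilin_tensor_class[OF K.is_cring E] s])
  then have ml: "multilin K E d (TP d) (\<lambda>w. ?f (gen K w))"
    by (rule multilin_cong[OF E]) (simp add: act_lin_map(2)[OF s])
  have eq: "?f u' = ?f u" if u': "u' \<in> carrier (FT d)" "tc d u' = tc d u" for u'
  proof -
    have "tc d (u' \<ominus>\<^bsub>FT d\<^esub> u) = \<zero>\<^bsub>TP d\<^esub>"
      using lin_map_kernel_eq[OF FT_module TP_module tc_lin_map] u u' by blast
    then have "?f (u' \<ominus>\<^bsub>FT d\<^esub> u) = \<zero>\<^bsub>TP d\<^esub>"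
      by (intro multilin_vanish[OF K.is_cring E TP_module f ml]) (use u u' in auto)
    then show ?thesis using lin_map_kernel_eq[OF FT_module TP_module f u'(1) u] by blast
  qed
  show ?thesis
    unfolding tensor_act_def
    by (rule tensor_class_UN[OF K.is_cring E u]) (use eq in \<open>simp add: tensor_class_def act_def\<close>)
qed

lemma chi_rels_submodule: "submodule (chi_rels K W \<chi> E d) K (TP d)"
proof -
  interpret T: module K "TP d" by (rule TP_module)
  have "tensor_act K E d \<sigma> z \<in> carrier (TP d)" if a: "d \<ge> 1" "\<sigma> \<in> W d" "z \<in> carrier (TP d)" for \<sigma> z
  proof -
    obtain u where u: "u \<in> carrier (FT d)" "z = tc d u"
      using a(3) tensor_power_carrier[OF K.is_cring E] by blast
    show ?thesis
      using tensor_act_class[OF W_permutes[OF a(1,2)] u(1)] u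
        lin_map_closed[OF tc_lin_map] lin_map_closed[OF act_lin_map(1)[OF W_permutes[OF a(1,2)]]] by simp
  qed
  then show ?thesis
    unfolding chi_rels_def
    by (intro generated_submodule_submodule[OF TP_module]) (auto intro!: T.M.minus_closed T.smult_closed chi_inv_closed)
qed

lemma CP_module: "module K (CP d)"
  unfolding chi_power_def by (rule quot_module_module[OF TP_module chi_rels_submodule])

lemma cc_lin_map: "lin_map K (FT d) (CP d) (cc d)"
  unfolding chi_power_def chi_class_def
  by (rule lin_map_comp[OF tc_lin_map quot_lin_map[OF TP_module chi_rels_submodule]])

lemma CP_carrier: "carrier (CP d) = cc d ` carrier (FT d)"
  unfolding chi_power_def quot_carrier[OF TP_module chi_rels_submodule]
  by (simp add: tensor_power_carrier[OF K.is_cring E] chi_class_def image_image)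

lemma multilin_cc: "multilin K E d (CP d) (\<lambda>w. cc d (gen K w))"
  unfolding chi_power_def chi_class_def
  by (rule multilin_lin_map[OF multilin_tensor_class[OF K.is_cring E] quot_lin_map[OF TP_module chi_rels_submodule]])

lemma cc_act:
  assumes d: "d \<ge> 1" "\<sigma> \<in> W d" and u: "u \<in> carrier (FT d)"
  shows "cc d (act E d \<sigma> u) = inv\<^bsub>K\<^esub> (\<chi> d \<sigma>) \<odot>\<^bsub>CP d\<^esub> cc d u"
proof -
  let ?k = "inv\<^bsub>K\<^esub> (\<chi> d \<sigma>)"
  interpret F: module K "FT d" by (rule FT_module)
  note p = W_permutes[OF d]
  note k = chi_inv_closed[OF d]
  have au: "act E d \<sigma> u \<in> carrier (FT d)" by (rule lin_map_closed[OF act_lin_map(1)[OF p] u])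
  have "?k \<odot>\<^bsub>TP d\<^esub> tc d u \<ominus>\<^bsub>TP d\<^esub> tensor_act K E d \<sigma> (tc d u) \<in> chi_rels K W \<chi> E d"
    unfolding chi_rels_def
    by (rule subsetD[OF generated_submodule_incl]) (use d lin_map_closed[OF tc_lin_map u] in blast)
  also have "?k \<odot>\<^bsub>TP d\<^esub> tc d u \<ominus>\<^bsub>TP d\<^esub> tensor_act K E d \<sigma> (tc d u) = tc d (?k \<odot>\<^bsub>FT d\<^esub> u \<ominus>\<^bsub>FT d\<^esub> act E d \<sigma> u)"
    using u k au
    by (simp add: tensor_act_class[OF p] lin_map_diff[OF FT_module TP_module tc_lin_map] lin_map_smult[OF tc_lin_map])
  finally have "cc d (?k \<odot>\<^bsub>FT d\<^esub> u \<ominus>\<^bsub>FT d\<^esub> act E d \<sigma> u) = \<zero>\<^bsub>CP d\<^esub>"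
    unfolding chi_power_def chi_class_def
    using quot_eq_zero_iff[OF TP_module chi_rels_submodule] lin_map_closed[OF tc_lin_map] u k au by simp
  then have "cc d (?k \<odot>\<^bsub>FT d\<^esub> u) = cc d (act E d \<sigma> u)"
    using lin_map_kernel_eq[OF FT_module CP_module cc_lin_map _ au] u k by simp
  then show ?thesis using lin_map_smult[OF cc_lin_map k u] by simp
qed

lemma equivar_cc: "equivar E d (CP d) (\<lambda>w. cc d (gen K w))"
  unfolding equivar_def
proof (intro ballI impI)
  fix \<sigma> w assume a: "\<sigma> \<in> W d" "w \<in> tuples E d" "d \<ge> 1"
  show "cc d (gen K (perm_tuple \<sigma> w)) = inv\<^bsub>K\<^esub> (\<chi> d \<sigma>) \<odot>\<^bsub>CP d\<^esub> cc d (gen K w)"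
    using cc_act[OF a(3,1) gen_FT[OF a(2)]] act_lin_map(2)[OF W_permutes[OF a(3,1)] a(2)] by simp
qed

text \<open>The way back from \<open>equivar_vanish\<close>: a linear map that kills the kernel of
  the class map takes equal values on equal classes, and so inherits multilinearity from the class
  map. It serves for functionals that are not given by a formula on tuples.\<close>

lemma linear_factor:
  assumes M: "module K M" and f: "lin_map K (FT d) M f"
    and null: "\<And>u. u \<in> carrier (FT d) \<Longrightarrow> cc d u = \<zero>\<^bsub>CP d\<^esub> \<Longrightarrow> f u = \<zero>\<^bsub>M\<^esub>"
  shows linear_factor_eq: "u \<in> carrier (FT d) \<Longrightarrow> v \<in> carrier (FT d) \<Longrightarrow> cc d u = cc d v \<Longrightarrow> f u = f v"
    and linear_factor_multilin: "multilin K E d M (\<lambda>w. f (gen K w))"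
proof -
  interpret F: module K "FT d" by (rule FT_module)
  show fac: "f u = f v" if "u \<in> carrier (FT d)" "v \<in> carrier (FT d)" "cc d u = cc d v" for u v
    using lin_map_kernel_eq[OF FT_module M f that(1,2)] lin_map_kernel_eq[OF FT_module CP_module cc_lin_map that(1,2)]
      null that by simp
  show "multilin K E d M (\<lambda>w. f (gen K w))"
  proof (rule multilinI)
    show "f (gen K w) \<in> carrier M" if "w \<in> tuples E d" for w using lin_map_closed[OF f gen_FT[OF that]] .
    fix w i x assume w: "w \<in> tuples E d" "i < d" "x \<in> carrier E"
    note t = gen_FT[OF tuples_update[OF w(1)]]
    show "f (gen K (w[i := x \<oplus>\<^bsub>E\<^esub> y])) = f (gen K (w[i := x])) \<oplus>\<^bsub>M\<^esub> f (gen K (w[i := y]))"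
      if y: "y \<in> carrier E" for y
      unfolding lin_map_add[OF f t[OF w(3)] t[OF y], symmetric]
      by (rule fac) (use multilinD(1)[OF multilin_cc w y] t w y lin_map_add[OF cc_lin_map] in auto)
    show "f (gen K (w[i := k \<odot>\<^bsub>E\<^esub> x])) = k \<odot>\<^bsub>M\<^esub> f (gen K (w[i := x]))"
      if k: "k \<in> carrier K" for k
      unfolding lin_map_smult[OF f k t[OF w(3)], symmetric]
      by (rule fac) (use multilinD(2)[OF multilin_cc w k] t w k lin_map_smult[OF cc_lin_map] in auto)
  qed
qed

text \<open>The universal property of \<open>chi_power\<close> in kernel form. By multilinearity
  \<open>f\<close> depends only on the tensor class, and by \<open>equivar\<close> it kills the
  additional relations.\<close>

lemma equivar_vanish:
  assumes M: "module K M" and f: "lin_map K (FT d) M f"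
    and g: "multilin K E d M (\<lambda>w. f (gen K w))" and eq: "equivar E d M (\<lambda>w. f (gen K w))"
    and u: "u \<in> carrier (FT d)" "cc d u = \<zero>\<^bsub>CP d\<^esub>"
  shows "f u = \<zero>\<^bsub>M\<^esub>"
proof -
  interpret M: module K M by (rule M)
  interpret F: module K "FT d" by (rule FT_module)
  interpret T: module K "TP d" by (rule TP_module)
  have fac: "f v = f v'" if "v \<in> carrier (FT d)" "v' \<in> carrier (FT d)" "tc d v = tc d v'" for v v'
    using lin_map_kernel_eq[OF FT_module M f that(1,2)] lin_map_kernel_eq[OF FT_module TP_module tc_lin_map that(1,2)] that(3)
      multilin_vanish[OF K.is_cring E M f g] that by simp
  \<comment> \<open>The relations are generated inside the tensor power, not inside the free module,
    so the kernel of \<open>f\<close> is replaced by its image there.\<close>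
  define N where "N = {z \<in> carrier (TP d). \<exists>v\<in>carrier (FT d). z = tc d v \<and> f v = \<zero>\<^bsub>M\<^esub>}"
  have N: "submodule N K (TP d)"
  proof (rule T.submoduleI)
    show "N \<subseteq> carrier (TP d)" by (auto simp: N_def)
    show "\<zero>\<^bsub>TP d\<^esub> \<in> N"
      using lin_map_zero[OF FT_module TP_module tc_lin_map] lin_map_zero[OF FT_module M f]
      by (auto simp: N_def intro!: bexI[of _ "\<zero>\<^bsub>FT d\<^esub>"])
  next
    fix a assume "a \<in> N"
    then obtain v where v: "v \<in> carrier (FT d)" "a = tc d v" "f v = \<zero>\<^bsub>M\<^esub>" by (auto simp: N_def)
    note c = lin_map_closed[OF tc_lin_map v(1)]
    show "\<ominus>\<^bsub>TP d\<^esub> a \<in> N"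
      using v c lin_map_minus[OF FT_module TP_module tc_lin_map v(1)] lin_map_minus[OF FT_module M f v(1)] M.M.minus_equality[of "\<zero>\<^bsub>M\<^esub>" "\<zero>\<^bsub>M\<^esub>"]
      by (auto simp: N_def intro!: bexI[of _ "\<ominus>\<^bsub>FT d\<^esub> v"])
    { fix k assume k: "k \<in> carrier K"
      show "k \<odot>\<^bsub>TP d\<^esub> a \<in> N"
        using v c k lin_map_smult[OF tc_lin_map k v(1)] lin_map_smult[OF f k v(1)]
        by (auto simp: N_def intro!: bexI[of _ "k \<odot>\<^bsub>FT d\<^esub> v"]) }
    { fix b assume "b \<in> N"
      then obtain v' where v': "v' \<in> carrier (FT d)" "b = tc d v'" "f v' = \<zero>\<^bsub>M\<^esub>" by (auto simp: N_def)
      show "a \<oplus>\<^bsub>TP d\<^esub> b \<in> N"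
        using v v' c lin_map_closed[OF tc_lin_map v'(1)] lin_map_add[OF tc_lin_map v(1) v'(1)] lin_map_add[OF f v(1) v'(1)]
        by (auto simp: N_def intro!: bexI[of _ "v \<oplus>\<^bsub>FT d\<^esub> v'"]) }
  qed
  have "chi_rels K W \<chi> E d \<subseteq> N"
    unfolding chi_rels_def
  proof (rule generated_submodule_minimal[OF N], safe)
    fix \<sigma> z assume d: "1 \<le> d" "\<sigma> \<in> W d" and z: "z \<in> carrier (TP d)"
    let ?k = "inv\<^bsub>K\<^esub> (\<chi> d \<sigma>)"
    obtain v where v: "v \<in> carrier (FT d)" "z = tc d v"
      using z tensor_power_carrier[OF K.is_cring E] by blast
    note p = W_permutes[OF d] and k = chi_inv_closed[OF d]
    note al = act_lin_map(1)[OF p]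
    note av = lin_map_closed[OF al v(1)]
    have "f (act E d \<sigma> v) = ?k \<odot>\<^bsub>M\<^esub> f v"
      by (rule free_lin_map_eq[OF K.is_cring M lin_map_comp[OF al f] lin_map_scale[OF M f k] _ v(1)])
        (use eq d in \<open>auto simp: equivar_def act_lin_map(2)[OF p]\<close>)
    then have "f (?k \<odot>\<^bsub>FT d\<^esub> v \<ominus>\<^bsub>FT d\<^esub> act E d \<sigma> v) = \<zero>\<^bsub>M\<^esub>"
      using lin_map_kernel_eq[OF FT_module M f _ av] v k lin_map_smult[OF f k v(1)] by simp
    moreover have "?k \<odot>\<^bsub>TP d\<^esub> z \<ominus>\<^bsub>TP d\<^esub> tensor_act K E d \<sigma> z = tc d (?k \<odot>\<^bsub>FT d\<^esub> v \<ominus>\<^bsub>FT d\<^esub> act E d \<sigma> v)"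
      using v k av
      by (simp add: tensor_act_class[OF p] lin_map_diff[OF FT_module TP_module tc_lin_map] lin_map_smult[OF tc_lin_map])
    ultimately show "?k \<odot>\<^bsub>TP d\<^esub> z \<ominus>\<^bsub>TP d\<^esub> tensor_act K E d \<sigma> z \<in> N"
      using lin_map_closed[OF tc_lin_map] v k av by (auto simp: N_def)
  qed
  moreover have "tc d u \<in> chi_rels K W \<chi> E d"
    using u quot_eq_zero_iff[OF TP_module chi_rels_submodule lin_map_closed[OF tc_lin_map u(1)]]
    by (simp add: chi_power_def chi_class_def)
  \<comment> \<open>This only gives some representative of the tensor class of \<open>u\<close> on
    which \<open>f\<close> vanishes; \<open>fac\<close> carries the value over to \<open>u\<close>
    itself.\<close>
  ultimately obtain v where "v \<in> carrier (FT d)" "tc d u = tc d v" "f v = \<zero>\<^bsub>M\<^esub>" by (auto simp: N_def)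
  then show ?thesis using fac u by metis
qed

text \<open>The hypotheses concern generators in both arguments: \<open>equivar_vanish\<close>
  handles the first, induction over generators the second. With \<open>bilin_flip\<close> it covers
  both sides of the product and of the form.\<close>

lemma bilin_equivar_vanish:
  assumes L: "module K L" and b: "bilin K (FT d) (free_module K Y) L b"
    and g: "\<And>y. y \<in> Y \<Longrightarrow> multilin K E d L (\<lambda>w. b (gen K w) (gen K y))"
      "\<And>y. y \<in> Y \<Longrightarrow> equivar E d L (\<lambda>w. b (gen K w) (gen K y))"
    and u: "u \<in> carrier (FT d)" "cc d u = \<zero>\<^bsub>CP d\<^esub>" and v: "v \<in> carrier (free_module K Y)"
  shows "b u v = \<zero>\<^bsub>L\<^esub>"
proof -
  have "carrier (free_module K Y) \<subseteq> {v \<in> carrier (free_module K Y). b u v = \<zero>\<^bsub>L\<^esub>}"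
    using equivar_vanish[OF L bilinD(1)[OF b gen_FT] g u] gen_FT
    by (intro free_module_induct[OF K.is_cring submodule_ker[OF free_module_module[OF K.is_cring] L bilinD(2)[OF b u(1)]]])
      simp
  then show ?thesis using v by blast
qed

text \<open>A permutation of the left factor acts on the product as itself in degree
  \<open>d + e\<close>, one of the right factor as its \<open>d\<close>-fold shift. The character
  takes the same value on all of these, so the relations of either factor are sent to relations of
  the product.\<close>

lemma chi_mult_class:
  assumes u: "u \<in> carrier (FT d)" and v: "v \<in> carrier (FT e)"
  shows "chi_mult K W \<chi> E d e (cc d u) (cc e v) = cc (d + e) (conc K E d e u v)"
proof -
  let ?b = "\<lambda>u v. cc (d + e) (conc K E d e u v)"
  note conc_bilin = conc_bilin[OF K.is_cring E] and conc_gen = conc_gen[OF K.is_cring E]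
  have b: "bilin K (FT d) (FT e) (CP (d + e)) ?b" by (rule bilin_comp[OF conc_bilin cc_lin_map])
  have l: "?b u v = \<zero>\<^bsub>CP (d + e)\<^esub>"
    if u: "u \<in> carrier (FT d)" and v: "v \<in> carrier (FT e)" and uz: "cc d u = \<zero>\<^bsub>CP d\<^esub>" for u v
  proof (rule bilin_equivar_vanish[OF CP_module b _ _ u uz v])
    fix w' assume w': "w' \<in> tuples E e"
    show "multilin K E d (CP (d + e)) (\<lambda>w. ?b (gen K w) (gen K w'))"
      by (rule multilin_cong[OF E multilin_append(1)[OF multilin_cc w']]) (simp add: conc_gen w')
    show "equivar E d (CP (d + e)) (\<lambda>w. ?b (gen K w) (gen K w'))"
      unfolding equivar_def
    proof (intro ballI impI)
      fix \<sigma> w assume a: "\<sigma> \<in> W d" "w \<in> tuples E d" "d \<ge> 1"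
      note p = W_permutes[OF a(3,1)] and Wa = W_add[OF a(3,1), of e]
      have "cc (d + e) (gen K (perm_tuple \<sigma> (w @ w'))) = inv\<^bsub>K\<^esub> (\<chi> d \<sigma>) \<odot>\<^bsub>CP (d + e)\<^esub> cc (d + e) (gen K (w @ w'))"
        using equivar_cc[of "d + e"] Wa tuples_append[OF a(2) w'] a(3) by (auto simp: equivar_def)
      then show "?b (gen K (perm_tuple \<sigma> w)) (gen K w') = inv\<^bsub>K\<^esub> (\<chi> d \<sigma>) \<odot>\<^bsub>CP (d + e)\<^esub> ?b (gen K w) (gen K w')"
        using conc_gen[OF _ w'] a(2) perm_tuple_tuples[OF p a(2)] perm_tuple_append[OF p tuples_length[OF a(2)]] by simp
    qed
  qed
  have r: "?b u v = \<zero>\<^bsub>CP (d + e)\<^esub>"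
    if u: "u \<in> carrier (FT d)" and v: "v \<in> carrier (FT e)" and vz: "cc e v = \<zero>\<^bsub>CP e\<^esub>" for u v
  proof (rule bilin_equivar_vanish[OF CP_module bilin_flip[OF b] _ _ v vz u])
    fix w' assume w': "w' \<in> tuples E d"
    show "multilin K E e (CP (d + e)) (\<lambda>w. ?b (gen K w') (gen K w))"
      by (rule multilin_cong[OF E multilin_append(2)[OF multilin_cc w']]) (simp add: conc_gen w')
    show "equivar E e (CP (d + e)) (\<lambda>w. ?b (gen K w') (gen K w))"
      unfolding equivar_def
    proof (intro ballI impI)
      fix \<sigma> w assume a: "\<sigma> \<in> W e" "w \<in> tuples E e" "e \<ge> 1"
      note p = W_permutes[OF a(3,1)] and Wa = W_omega_add[OF a(3,1), of d]
      have "cc (d + e) (gen K (perm_tuple ((omega ^^ d) \<sigma>) (w' @ w))) = inv\<^bsub>K\<^esub> (\<chi> e \<sigma>) \<odot>\<^bsub>CP (d + e)\<^esub> cc (d + e) (gen K (w' @ w))"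
        using equivar_cc[of "d + e"] Wa tuples_append[OF w' a(2)] a(3) by (auto simp: equivar_def add.commute)
      then show "?b (gen K w') (gen K (perm_tuple \<sigma> w)) = inv\<^bsub>K\<^esub> (\<chi> e \<sigma>) \<odot>\<^bsub>CP (d + e)\<^esub> ?b (gen K w') (gen K w)"
        using conc_gen[OF w'] a(2) perm_tuple_tuples[OF p a(2)] perm_tuple_omega[OF p tuples_length[OF a(2)] tuples_length[OF w']] by simp
    qed
  qed
  note fac = bilin_factor_eq[OF FT_module FT_module CP_module CP_module CP_module b cc_lin_map cc_lin_map _ _ u]
  have eq: "?b u' v' = ?b u v"
    if "u' \<in> carrier (FT d)" "cc d u' = cc d u" "v' \<in> carrier (FT e)" "cc e v' = cc e v" for u' v'
    by (rule fac[OF _ _ that(1,2) v that(3,4)])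
      (rule l r; assumption)+
  have UN: "(\<Union>z\<in>cc n t. g z) = c"
    if t: "t \<in> carrier (FT n)" and g: "\<And>t'. t' \<in> carrier (FT n) \<Longrightarrow> cc n t' = cc n t \<Longrightarrow> g (tc n t') = c" for n t g c
    unfolding chi_class_def
    by (rule UN_coset_const[OF TP_module chi_rels_submodule lin_map_closed[OF tc_lin_map t]])
      (use g in \<open>auto simp: tensor_power_carrier[OF K.is_cring E] chi_class_def\<close>)
  show ?thesis
    unfolding chi_mult_def
  proof (rule UN[OF u], rule UN[OF v])
    fix u' v' assume a: "u' \<in> carrier (FT d)" "cc d u' = cc d u" "v' \<in> carrier (FT e)" "cc e v' = cc e v"
    show "chi_rels K W \<chi> E (d + e) +>\<^bsub>TP (d + e)\<^esub> tensor_mult K E d e (tc d u') (tc e v') = ?b u v"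
      using eq[OF a] tensor_mult_class[OF K.is_cring E a(1,3)] by (simp add: chi_class_def)
  qed
qed

text \<open>Flattening a class of classes gives a fibre of the class map on the free module;
  \<open>chi_power_form\<close> quantifies over exactly this set.\<close>

lemma Union_cc:
  assumes u: "u \<in> carrier (FT d)"
  shows "\<Union>(cc d u) = {u' \<in> carrier (FT d). cc d u' = cc d u}"
proof (intro equalityI subsetI)
  fix u' assume "u' \<in> \<Union>(cc d u)"
  then obtain z where z: "z \<in> cc d u" "u' \<in> z" by blast
  note tu = lin_map_closed[OF tc_lin_map u]
  have zz: "z \<in> carrier (TP d)" "chi_rels K W \<chi> E d +>\<^bsub>TP d\<^esub> z = cc d u"
    using coset_memD[OF TP_module chi_rels_submodule tu] z(1) by (auto simp: chi_class_def)
  then obtain t where t: "t \<in> carrier (FT d)" "z = tc d t"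
    using tensor_power_carrier[OF K.is_cring E] by blast
  have "u' \<in> carrier (FT d)" "tc d u' = tc d t"
    using coset_memD[OF FT_module multilinear_rels_submodule[OF K.is_cring E] t(1)] z(2) t(2)
    by (auto simp: tensor_class_def)
  then show "u' \<in> {u' \<in> carrier (FT d). cc d u' = cc d u}"
    using zz t by (simp add: chi_class_def)
next
  fix u' assume "u' \<in> {u' \<in> carrier (FT d). cc d u' = cc d u}"
  then have u': "u' \<in> carrier (FT d)" "cc d u' = cc d u" by auto
  have "tc d u' \<in> cc d u"
    using u' coset_eq_iff_mem[OF TP_module chi_rels_submodule lin_map_closed[OF tc_lin_map u] lin_map_closed[OF tc_lin_map u'(1)]]
    by (simp add: chi_class_def)
  moreover have "u' \<in> tc d u'"
    using coset_eq_iff_mem[OF FT_module multilinear_rels_submodule[OF K.is_cring E] u'(1) u'(1)]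
    by (simp add: tensor_class_def)
  ultimately show "u' \<in> \<Union>(cc d u)" by blast
qed

end

end

section \<open>The bilinear form\<close>

lemma dual_carrier_iff:
  "f \<in> carrier (dual_module K E) \<longleftrightarrow> f \<in> carrier E \<rightarrow>\<^sub>E carrier K \<and>
    (\<forall>x\<in>carrier E. \<forall>y\<in>carrier E. f (x \<oplus>\<^bsub>E\<^esub> y) = f x \<oplus>\<^bsub>K\<^esub> f y) \<and>
    (\<forall>k\<in>carrier K. \<forall>x\<in>carrier E. f (k \<odot>\<^bsub>E\<^esub> x) = k \<otimes>\<^bsub>K\<^esub> f x)"
  by (simp add: dual_module_def)

lemma dual_apply:
  shows "f \<in> carrier (dual_module K E) \<Longrightarrow> x \<in> carrier E \<Longrightarrow> f x \<in> carrier K"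
    and "f \<in> carrier (dual_module K E) \<Longrightarrow> x \<in> carrier E \<Longrightarrow> y \<in> carrier E \<Longrightarrow> f (x \<oplus>\<^bsub>E\<^esub> y) = f x \<oplus>\<^bsub>K\<^esub> f y"
    and "f \<in> carrier (dual_module K E) \<Longrightarrow> k \<in> carrier K \<Longrightarrow> x \<in> carrier E \<Longrightarrow> f (k \<odot>\<^bsub>E\<^esub> x) = k \<otimes>\<^bsub>K\<^esub> f x"
    and "x \<in> carrier E \<Longrightarrow> (f \<oplus>\<^bsub>dual_module K E\<^esub> g) x = f x \<oplus>\<^bsub>K\<^esub> g x"
    and "x \<in> carrier E \<Longrightarrow> (k \<odot>\<^bsub>dual_module K E\<^esub> f) x = k \<otimes>\<^bsub>K\<^esub> f x"
    and "x \<in> carrier E \<Longrightarrow> \<zero>\<^bsub>dual_module K E\<^esub> x = \<zero>\<^bsub>K\<^esub>"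
  by (auto simp: dual_module_def PiE_iff)

lemma dual_ext:
  assumes "f \<in> carrier (dual_module K E)" "g \<in> carrier (dual_module K E)" "\<And>x. x \<in> carrier E \<Longrightarrow> f x = g x"
  shows "f = g"
proof (rule extensionalityI[of _ "carrier E"])
  show "f \<in> extensional (carrier E)" "g \<in> extensional (carrier E)"
    using assms(1,2) by (simp_all add: dual_carrier_iff PiE_iff)
qed (rule assms(3))

lemma dual_module_module:
  assumes "module K E" shows "module K (dual_module K E)"
proof -
  interpret E: module K E by fact
  let ?D = "dual_module K E"
  have add: "f \<oplus>\<^bsub>?D\<^esub> g \<in> carrier ?D" if "f \<in> carrier ?D" "g \<in> carrier ?D" for f g
    using that by (auto simp: dual_module_def PiE_iff Pi_iff E.R.a_ac E.r_distr)
  have smult: "k \<odot>\<^bsub>?D\<^esub> f \<in> carrier ?D" if "k \<in> carrier K" "f \<in> carrier ?D" for k f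
    using that by (auto simp: dual_module_def PiE_iff Pi_iff E.r_distr E.m_lcomm)
  have zero: "\<zero>\<^bsub>?D\<^esub> \<in> carrier ?D" by (auto simp: dual_module_def)
  note cl = add smult zero dual_apply
  have neg: "\<exists>g\<in>carrier ?D. g \<oplus>\<^bsub>?D\<^esub> f = \<zero>\<^bsub>?D\<^esub>" if f: "f \<in> carrier ?D" for f
  proof (rule bexI[of _ "(\<ominus>\<^bsub>K\<^esub> \<one>\<^bsub>K\<^esub>) \<odot>\<^bsub>?D\<^esub> f"])
    show c: "(\<ominus>\<^bsub>K\<^esub> \<one>\<^bsub>K\<^esub>) \<odot>\<^bsub>?D\<^esub> f \<in> carrier ?D" by (rule smult[OF _ f]) simp
    show "(\<ominus>\<^bsub>K\<^esub> \<one>\<^bsub>K\<^esub>) \<odot>\<^bsub>?D\<^esub> f \<oplus>\<^bsub>?D\<^esub> f = \<zero>\<^bsub>?D\<^esub>"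
      by (rule dual_ext[OF add[OF c f] zero]) (use f in \<open>simp add: dual_apply E.l_minus E.R.l_neg\<close>)
  qed
  have "abelian_group ?D"
  proof (rule abelian_groupI)
    fix f g h assume "f \<in> carrier ?D" "g \<in> carrier ?D" "h \<in> carrier ?D"
    then show "f \<oplus>\<^bsub>?D\<^esub> g \<oplus>\<^bsub>?D\<^esub> h = f \<oplus>\<^bsub>?D\<^esub> (g \<oplus>\<^bsub>?D\<^esub> h)"
      by (intro dual_ext[of _ K E]) (auto simp: cl E.R.a_assoc)
  next
    fix f g assume "f \<in> carrier ?D" "g \<in> carrier ?D"
    then show "f \<oplus>\<^bsub>?D\<^esub> g = g \<oplus>\<^bsub>?D\<^esub> f"
      by (intro dual_ext[of _ K E]) (auto simp: cl E.R.a_comm)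
  next
    fix f assume "f \<in> carrier ?D"
    then show "\<zero>\<^bsub>?D\<^esub> \<oplus>\<^bsub>?D\<^esub> f = f" by (intro dual_ext[of _ K E]) (auto simp: cl)
  qed (use cl neg in auto)
  moreover have "(a \<oplus>\<^bsub>K\<^esub> b) \<odot>\<^bsub>?D\<^esub> f = a \<odot>\<^bsub>?D\<^esub> f \<oplus>\<^bsub>?D\<^esub> b \<odot>\<^bsub>?D\<^esub> f"
    if "a \<in> carrier K" "b \<in> carrier K" "f \<in> carrier ?D" for a b f
    using that by (intro dual_ext[of _ K E]) (auto simp: cl E.l_distr)
  moreover have "a \<odot>\<^bsub>?D\<^esub> (f \<oplus>\<^bsub>?D\<^esub> g) = a \<odot>\<^bsub>?D\<^esub> f \<oplus>\<^bsub>?D\<^esub> a \<odot>\<^bsub>?D\<^esub> g"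
    if "a \<in> carrier K" "f \<in> carrier ?D" "g \<in> carrier ?D" for a f g
    using that by (intro dual_ext[of _ K E]) (auto simp: cl E.r_distr)
  moreover have "(a \<otimes>\<^bsub>K\<^esub> b) \<odot>\<^bsub>?D\<^esub> f = a \<odot>\<^bsub>?D\<^esub> (b \<odot>\<^bsub>?D\<^esub> f)"
    if "a \<in> carrier K" "b \<in> carrier K" "f \<in> carrier ?D" for a b f
    using that by (intro dual_ext[of _ K E]) (auto simp: cl E.m_assoc)
  moreover have "\<one>\<^bsub>K\<^esub> \<odot>\<^bsub>?D\<^esub> f = f" if "f \<in> carrier ?D" for f
    using that by (intro dual_ext[of _ K E]) (auto simp: cl)
  ultimately show ?thesis using smult by (intro moduleI E.is_cring)
qed

lemma (in comm_monoid) finprod_remove: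
  assumes "finite A" "a \<in> A" "f \<in> A \<rightarrow> carrier G"
  shows "finprod G f A = f a \<otimes> finprod G f (A - {a})"
proof -
  have "finprod G f (insert a (A - {a})) = f a \<otimes> finprod G f (A - {a})"
    using assms by (intro finprod_insert) auto
  then show ?thesis using assms(2) by (simp add: insert_absorb)
qed

lemma multilin_finsum:
  assumes M: "module K M" and E: "module K E" and "finite A" "\<And>a. a \<in> A \<Longrightarrow> multilin K E d M (g a)"
  shows "multilin K E d M (\<lambda>w. \<Oplus>\<^bsub>M\<^esub>a\<in>A. g a w)"
proof -
  interpret M: module K M by (rule M)
  interpret E: module K E by (rule E)
  note c = multilin_closed[OF assms(4)] and m = multilinD[OF assms(4)]
  show ?thesis
  proof (rule multilinI)
    show "(\<Oplus>\<^bsub>M\<^esub>a\<in>A. g a w) \<in> carrier M" if "w \<in> tuples E d" for w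
      using c that by (intro M.M.finsum_closed) auto
    fix w i x assume w: "w \<in> tuples E d" "i < d" "x \<in> carrier E"
    { fix y assume y: "y \<in> carrier E"
      have "(\<Oplus>\<^bsub>M\<^esub>a\<in>A. g a (w[i := x \<oplus>\<^bsub>E\<^esub> y])) = (\<Oplus>\<^bsub>M\<^esub>a\<in>A. g a (w[i := x]) \<oplus>\<^bsub>M\<^esub> g a (w[i := y]))"
        by (rule M.M.finsum_cong') (use m w y c in \<open>auto simp: tuples_update\<close>)
      also have "\<dots> = (\<Oplus>\<^bsub>M\<^esub>a\<in>A. g a (w[i := x])) \<oplus>\<^bsub>M\<^esub> (\<Oplus>\<^bsub>M\<^esub>a\<in>A. g a (w[i := y]))"
        by (rule M.M.finsum_addf) (use w y c in \<open>auto simp: tuples_update\<close>)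
      finally show "(\<Oplus>\<^bsub>M\<^esub>a\<in>A. g a (w[i := x \<oplus>\<^bsub>E\<^esub> y])) =
        (\<Oplus>\<^bsub>M\<^esub>a\<in>A. g a (w[i := x])) \<oplus>\<^bsub>M\<^esub> (\<Oplus>\<^bsub>M\<^esub>a\<in>A. g a (w[i := y]))" . }
    { fix k assume k: "k \<in> carrier K"
      have "(\<Oplus>\<^bsub>M\<^esub>a\<in>A. g a (w[i := k \<odot>\<^bsub>E\<^esub> x])) = (\<Oplus>\<^bsub>M\<^esub>a\<in>A. k \<odot>\<^bsub>M\<^esub> g a (w[i := x]))"
        by (rule M.M.finsum_cong') (use m w k c in \<open>auto simp: tuples_update\<close>)
      also have "\<dots> = k \<odot>\<^bsub>M\<^esub> (\<Oplus>\<^bsub>M\<^esub>a\<in>A. g a (w[i := x]))"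
        by (rule M.finsum_smult_ldistr[symmetric]) (use w k c assms(3) in \<open>auto simp: tuples_update\<close>)
      finally show "(\<Oplus>\<^bsub>M\<^esub>a\<in>A. g a (w[i := k \<odot>\<^bsub>E\<^esub> x])) = k \<odot>\<^bsub>M\<^esub> (\<Oplus>\<^bsub>M\<^esub>a\<in>A. g a (w[i := x]))" . }
  qed
qed

lemma lin_map_self_mult: "cring K \<Longrightarrow> c \<in> carrier K \<Longrightarrow> lin_map K (self_module K) (self_module K) (\<lambda>x. c \<otimes>\<^bsub>K\<^esub> x)"
proof -
  assume "cring K" and c: "c \<in> carrier K"
  then interpret K: cring K by simp
  show ?thesis by (rule lin_mapI) (use c in \<open>auto simp: K.r_distr K.m_lcomm\<close>)
qed

lemma perm_tuple_id [simp]: "perm_tuple id w = w"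
  by (rule nth_equalityI) (auto simp: perm_tuple_nth)

text \<open>Inverting the permutation in the index makes this a left action: the reversal of order
  under inversion cancels the one under substitution of indices.\<close>

lemma perm_tuple_comp:
  assumes "\<sigma> permutes {1..d}" "\<tau> permutes {1..d}" "length w = d"
  shows "perm_tuple \<tau> (perm_tuple \<sigma> w) = perm_tuple (\<tau> \<circ> \<sigma>) w"
proof (rule nth_equalityI)
  fix s assume "s < length (perm_tuple \<tau> (perm_tuple \<sigma> w))"
  then have s: "s < d" using assms by simp
  obtain j where j: "inv' \<tau> (Suc s) = Suc j" "j < d"
    using permutes_inv_range[OF assms(2) s] by (metis Suc_le_D One_nat_def diff_Suc_1)
  have "inv' (\<tau> \<circ> \<sigma>) = inv' \<sigma> \<circ> inv' \<tau>"
    using o_inv_distrib[OF permutes_bij[OF assms(2)] permutes_bij[OF assms(1)]] .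
  then show "perm_tuple \<tau> (perm_tuple \<sigma> w) ! s = perm_tuple (\<tau> \<circ> \<sigma>) w ! s"
    using s j assms(3) by (simp add: perm_tuple_nth)
qed simp

lemma perm_tuple_map:
  assumes "\<sigma> permutes {1..d}" "length w = d"
  shows "perm_tuple \<sigma> (map f w) = map f (perm_tuple \<sigma> w)"
  by (rule nth_equalityI) (use assms permutes_inv_range[OF assms(1)] in \<open>auto simp: perm_tuple_nth\<close>)

section \<open>The form on tuples and its invariance\<close>

context omega_character
begin

text \<open>Uniform extension of the data to degree 0, where the trivial group acts.\<close>

definition W0 :: "nat \<Rightarrow> (nat \<Rightarrow> nat) set" where "W0 d = (if d = 0 then {id} else W d)"

definition chi0 :: "nat \<Rightarrow> (nat \<Rightarrow> nat) \<Rightarrow> 'k" where "chi0 d \<sigma> = (if d = 0 then \<one>\<^bsub>K\<^esub> else \<chi> d \<sigma>)"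

lemma
  shows W0_permutes: "\<sigma> \<in> W0 d \<Longrightarrow> \<sigma> permutes {1..d}"
    and W0_comp: "\<sigma> \<in> W0 d \<Longrightarrow> \<tau> \<in> W0 d \<Longrightarrow> \<sigma> \<circ> \<tau> \<in> W0 d"
    and W0_inv: "\<sigma> \<in> W0 d \<Longrightarrow> inv' \<sigma> \<in> W0 d"
    and chi0_closed: "\<sigma> \<in> W0 d \<Longrightarrow> chi0 d \<sigma> \<in> carrier K"
    and chi0_comp: "\<sigma> \<in> W0 d \<Longrightarrow> \<tau> \<in> W0 d \<Longrightarrow> chi0 d (\<sigma> \<circ> \<tau>) = chi0 d \<sigma> \<otimes>\<^bsub>K\<^esub> chi0 d \<tau>"
    and chi0_square: "\<sigma> \<in> W0 d \<Longrightarrow> chi0 d \<sigma> \<otimes>\<^bsub>K\<^esub> chi0 d \<sigma> = \<one>\<^bsub>K\<^esub>"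
    and finite_W0: "finite (W0 d)"
    and W0_nonempty: "id \<in> W0 d"
  using W_permutes[of d] W_comp[of d] W_inv[of d] chi_closed[of d] chi_comp[of d] chi_square[of d] finite_W[of d] W_id[of d]
  by (auto simp: W0_def chi0_def permutes_id Suc_le_eq split: if_splits)

lemma chi0_inv: 
  assumes "\<sigma> \<in> W0 d" shows "chi0 d (inv' \<sigma>) = chi0 d \<sigma>"
proof -
  have "id = \<sigma> \<circ> inv' \<sigma>" using permutes_inv_o(1)[OF W0_permutes[OF assms]] by simp
  then have "chi0 d \<sigma> \<otimes>\<^bsub>K\<^esub> chi0 d (inv' \<sigma>) = chi0 d id"
    using chi0_comp[OF assms W0_inv[OF assms]] by simp
  also have "chi0 d id = \<one>\<^bsub>K\<^esub>" using chi_id[of d] by (auto simp: chi0_def)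
  also have "\<dots> = chi0 d \<sigma> \<otimes>\<^bsub>K\<^esub> chi0 d \<sigma>" using chi0_square[OF assms] by simp
  finally have "chi0 d \<sigma> \<otimes>\<^bsub>K\<^esub> (chi0 d \<sigma> \<otimes>\<^bsub>K\<^esub> chi0 d (inv' \<sigma>)) = chi0 d \<sigma> \<otimes>\<^bsub>K\<^esub> (chi0 d \<sigma> \<otimes>\<^bsub>K\<^esub> chi0 d \<sigma>)"
    by simp
  then show ?thesis
    using chi0_closed[OF assms] chi0_closed[OF W0_inv[OF assms]] chi0_square[OF assms]
    by (simp add: K.m_assoc[symmetric])
qed

lemma equivar_cong:
  assumes "equivar E d M h" "\<And>w. w \<in> tuples E d \<Longrightarrow> g w = h w"
  shows "equivar E d M g"
  unfolding equivar_def
proof (intro ballI impI)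
  fix \<sigma> w assume a: "\<sigma> \<in> W d" "w \<in> tuples E d" "1 \<le> d"
  then have "g (perm_tuple \<sigma> w) = h (perm_tuple \<sigma> w)"
    by (intro assms(2) perm_tuple_tuples W_permutes)
  then show "g (perm_tuple \<sigma> w) = inv\<^bsub>K\<^esub> (\<chi> d \<sigma>) \<odot>\<^bsub>M\<^esub> g w"
    using assms a by (simp add: equivar_def)
qed

text \<open>The inverse of the character may be replaced by the character itself since its square is
  trivial; in degree 0 the only permutation is the identity.\<close>

lemma equivar_W0:
  assumes "module K M" "equivar E d M g" "\<sigma> \<in> W0 d" "w \<in> tuples E d" "g w \<in> carrier M"
  shows "g (perm_tuple \<sigma> w) = chi0 d \<sigma> \<odot>\<^bsub>M\<^esub> g w"
proof -
  interpret M: module K M by fact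
  show ?thesis
  proof (cases "d = 0")
    case True
    then show ?thesis using assms by (simp add: W0_def chi0_def)
  next
    case False
    then show ?thesis using assms chi_inv_eq[of d \<sigma>] by (simp add: W0_def chi0_def equivar_def)
  qed
qed

lemma equivar_W0I:
  assumes "\<And>\<sigma> w. \<sigma> \<in> W0 d \<Longrightarrow> w \<in> tuples E d \<Longrightarrow> g (perm_tuple \<sigma> w) = chi0 d \<sigma> \<odot>\<^bsub>M\<^esub> g w"
  shows "equivar E d M g"
  using assms chi_inv_eq[of d] by (auto simp: equivar_def W0_def chi0_def)

text \<open>The product attached to a single permutation in \<open>tuple_form\<close>.
  Multilinearity is shown for each such product separately, invariance by reindexing their
  sum.\<close>

definition pairing :: "nat \<Rightarrow> (nat \<Rightarrow> nat) \<Rightarrow> 'e list \<Rightarrow> ('e \<Rightarrow> 'k) list \<Rightarrow> 'k" where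
  "pairing d \<sigma> w w' = (\<Otimes>\<^bsub>K\<^esub>t\<in>{1..d}. (w' ! (t - 1)) (w ! (inv' \<sigma> t - 1)))"

context
  fixes E :: "('k, 'e, 'n) module_scheme"
  assumes E: "module K E"
begin

interpretation E: module K E by (rule E)

abbreviation (input) "D \<equiv> dual_module K E"
abbreviation (input) "KM \<equiv> self_module K"

lemmas D = dual_module_module[OF E]

interpretation D: module K D by (rule D)

lemmas KM = self_module_module[OF K.is_cring]

lemma pairing_factor:
  assumes "w \<in> tuples E d" "w' \<in> tuples D d" "\<sigma> permutes {1..d}" "t \<in> {1..d}"
  shows "w ! (inv' \<sigma> t - 1) \<in> carrier E" "w' ! (t - 1) \<in> carrier D" "(w' ! (t - 1)) (w ! (inv' \<sigma> t - 1)) \<in> carrier K"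
proof -
  obtain s where s: "t = Suc s" "s < d" using assms(4) by (cases t) auto
  show 1: "w ! (inv' \<sigma> t - 1) \<in> carrier E"
    using permutes_inv_range[OF assms(3) s(2)] s by (intro tuples_nth[OF assms(1)]) simp
  show 2: "w' ! (t - 1) \<in> carrier D"
    using s by (intro tuples_nth[OF assms(2)]) simp
  show "(w' ! (t - 1)) (w ! (inv' \<sigma> t - 1)) \<in> carrier K" using dual_apply(1)[OF 2 1] .
qed

lemma pairing_closed:
  assumes "w \<in> tuples E d" "w' \<in> tuples D d" "\<sigma> permutes {1..d}"
  shows "pairing d \<sigma> w w' \<in> carrier K"
  unfolding pairing_def by (rule K.finprod_closed) (use pairing_factor[OF assms] in auto)

lemma pairing_multilin_left:
  assumes w': "w' \<in> tuples D d" and p: "\<sigma> permutes {1..d}"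
  shows "multilin K E d KM (\<lambda>w. pairing d \<sigma> w w')"
proof -
  \<comment> \<open>The entry of \<open>w\<close> at \<open>i\<close> occurs in exactly one factor,
    the one for \<open>t = \<sigma> (Suc i)\<close>; the remaining factors form the constant
    \<open>r\<close>.\<close>
  have upd: "\<exists>r\<in>carrier K. \<exists>f\<in>carrier D. \<forall>z\<in>carrier E. pairing d \<sigma> (w[i := z]) w' = f z \<otimes>\<^bsub>K\<^esub> r"
    if w: "w \<in> tuples E d" "i < d" for w i
  proof -
    let ?t = "\<sigma> (Suc i)"
    let ?r = "\<Otimes>\<^bsub>K\<^esub>t\<in>{1..d} - {?t}. (w' ! (t - 1)) (w ! (inv' \<sigma> t - 1))"
    have t: "?t \<in> {1..d}" "inv' \<sigma> ?t = Suc i"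
      using permutes_range[OF p w(2)] permutes_inverses(2)[OF p] by auto
    have "pairing d \<sigma> (w[i := z]) w' = (w' ! (?t - 1)) z \<otimes>\<^bsub>K\<^esub> ?r" if z: "z \<in> carrier E" for z
    proof -
      note wz = tuples_update[OF w(1) z, of i]
      have "pairing d \<sigma> (w[i := z]) w' = (w' ! (?t - 1)) (w[i := z] ! (inv' \<sigma> ?t - 1)) \<otimes>\<^bsub>K\<^esub>
          (\<Otimes>\<^bsub>K\<^esub>t\<in>{1..d} - {?t}. (w' ! (t - 1)) (w[i := z] ! (inv' \<sigma> t - 1)))"
        unfolding pairing_def by (rule K.finprod_remove) (use t pairing_factor[OF wz w' p] in auto)
      also have "(\<Otimes>\<^bsub>K\<^esub>t\<in>{1..d} - {?t}. (w' ! (t - 1)) (w[i := z] ! (inv' \<sigma> t - 1))) = ?r"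
      proof (rule K.finprod_cong')
        fix t' assume t': "t' \<in> {1..d} - {?t}"
        then obtain s where s: "t' = Suc s" "s < d" by (cases t') auto
        have "inv' \<sigma> t' \<noteq> Suc i" using t' permutes_inv_eq[OF p, of t' "Suc i"] by auto
        then have "inv' \<sigma> t' - 1 \<noteq> i" using permutes_inv_range[OF p s(2)] s by auto
        then show "(w' ! (t' - 1)) (w[i := z] ! (inv' \<sigma> t' - 1)) = (w' ! (t' - 1)) (w ! (inv' \<sigma> t' - 1))"
          by simp
      qed (use pairing_factor[OF w(1) w' p] in auto)
      finally show ?thesis using t w by (simp add: tuples_length)
    qed
    moreover have "?r \<in> carrier K"
      by (rule K.finprod_closed) (use pairing_factor[OF w(1) w' p] in auto)
    moreover have "w' ! (?t - 1) \<in> carrier D" using pairing_factor(2)[OF w(1) w' p t(1)] .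
    ultimately show ?thesis by blast
  qed
  show ?thesis
  proof (rule multilinI)
    show "pairing d \<sigma> w w' \<in> carrier KM" if "w \<in> tuples E d" for w
      using pairing_closed[OF that w' p] by simp
    fix w i x assume w: "w \<in> tuples E d" "i < d" and x: "x \<in> carrier E"
    obtain r f where rf: "r \<in> carrier K" "f \<in> carrier D" "\<And>z. z \<in> carrier E \<Longrightarrow> pairing d \<sigma> (w[i := z]) w' = f z \<otimes>\<^bsub>K\<^esub> r"
      using upd[OF w] by blast
    show "pairing d \<sigma> (w[i := x \<oplus>\<^bsub>E\<^esub> y]) w' = pairing d \<sigma> (w[i := x]) w' \<oplus>\<^bsub>KM\<^esub> pairing d \<sigma> (w[i := y]) w'"
      if y: "y \<in> carrier E" for y
      using x y rf by (simp add: dual_apply[OF rf(2)] K.l_distr)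
    show "pairing d \<sigma> (w[i := k \<odot>\<^bsub>E\<^esub> x]) w' = k \<odot>\<^bsub>KM\<^esub> pairing d \<sigma> (w[i := x]) w'"
      if k: "k \<in> carrier K" for k
      using x k rf by (simp add: dual_apply[OF rf(2)] K.m_assoc)
  qed
qed

lemma pairing_multilin_right:
  assumes w: "w \<in> tuples E d" and p: "\<sigma> permutes {1..d}"
  shows "multilin K D d KM (\<lambda>w'. pairing d \<sigma> w w')"
proof -
  \<comment> \<open>Here the entry at \<open>i\<close> occurs only in the factor for
    \<open>t = Suc i\<close>, and it is the functional that varies.\<close>
  have upd: "\<exists>r\<in>carrier K. \<exists>x\<in>carrier E. \<forall>f\<in>carrier D. pairing d \<sigma> w (w'[i := f]) = f x \<otimes>\<^bsub>K\<^esub> r"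
    if w': "w' \<in> tuples D d" "i < d" for w' i
  proof -
    let ?r = "\<Otimes>\<^bsub>K\<^esub>t\<in>{1..d} - {Suc i}. (w' ! (t - 1)) (w ! (inv' \<sigma> t - 1))"
    have t: "Suc i \<in> {1..d}" using w'(2) by simp
    have "pairing d \<sigma> w (w'[i := f]) = f (w ! (inv' \<sigma> (Suc i) - 1)) \<otimes>\<^bsub>K\<^esub> ?r" if f: "f \<in> carrier D" for f
    proof -
      note wf = tuples_update[OF w'(1) f, of i]
      have "pairing d \<sigma> w (w'[i := f]) = (w'[i := f] ! (Suc i - 1)) (w ! (inv' \<sigma> (Suc i) - 1)) \<otimes>\<^bsub>K\<^esub>
          (\<Otimes>\<^bsub>K\<^esub>t\<in>{1..d} - {Suc i}. (w'[i := f] ! (t - 1)) (w ! (inv' \<sigma> t - 1)))"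
        unfolding pairing_def by (rule K.finprod_remove) (use t pairing_factor[OF w wf p] in auto)
      also have "(\<Otimes>\<^bsub>K\<^esub>t\<in>{1..d} - {Suc i}. (w'[i := f] ! (t - 1)) (w ! (inv' \<sigma> t - 1))) = ?r"
      proof (rule K.finprod_cong')
        fix t' assume "t' \<in> {1..d} - {Suc i}"
        then have "t' - 1 \<noteq> i" by auto
        then show "(w'[i := f] ! (t' - 1)) (w ! (inv' \<sigma> t' - 1)) = (w' ! (t' - 1)) (w ! (inv' \<sigma> t' - 1))"
          by simp
      qed (use pairing_factor[OF w w'(1) p] in auto)
      finally show ?thesis using t w' by (simp add: tuples_length)
    qed
    moreover have "?r \<in> carrier K"
      by (rule K.finprod_closed) (use pairing_factor[OF w w'(1) p] in auto)
    moreover have "w ! (inv' \<sigma> (Suc i) - 1) \<in> carrier E" using pairing_factor(1)[OF w w'(1) p t] .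
    ultimately show ?thesis by blast
  qed
  show ?thesis
  proof (rule multilinI)
    show "pairing d \<sigma> w w' \<in> carrier KM" if "w' \<in> tuples D d" for w'
      using pairing_closed[OF w that p] by simp
    fix w' i f assume w': "w' \<in> tuples D d" "i < d" and f: "f \<in> carrier D"
    obtain r x where rx: "r \<in> carrier K" "x \<in> carrier E" "\<And>f. f \<in> carrier D \<Longrightarrow> pairing d \<sigma> w (w'[i := f]) = f x \<otimes>\<^bsub>K\<^esub> r"
      using upd[OF w'] by blast
    show "pairing d \<sigma> w (w'[i := f \<oplus>\<^bsub>D\<^esub> g]) = pairing d \<sigma> w (w'[i := f]) \<oplus>\<^bsub>KM\<^esub> pairing d \<sigma> w (w'[i := g])"
      if g: "g \<in> carrier D" for g
      using f g rx by (simp add: dual_apply(1)[OF f] dual_apply(1)[OF g] dual_apply(4) K.l_distr)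
    show "pairing d \<sigma> w (w'[i := k \<odot>\<^bsub>D\<^esub> f]) = k \<odot>\<^bsub>KM\<^esub> pairing d \<sigma> w (w'[i := f])"
      if k: "k \<in> carrier K" for k
      using f k rx by (simp add: dual_apply(1)[OF f] dual_apply(5) K.m_assoc)
  qed
qed

lemma pairing_perm_left:
  assumes "w \<in> tuples E d" "w' \<in> tuples D d" "\<sigma> permutes {1..d}" "\<tau> permutes {1..d}"
  shows "pairing d \<tau> (perm_tuple \<sigma> w) w' = pairing d (\<tau> \<circ> \<sigma>) w w'"
  unfolding pairing_def
proof (rule K.finprod_cong')
  fix t assume "t \<in> {1..d}"
  then obtain s where s: "t = Suc s" "s < d" by (cases t) auto
  have "perm_tuple \<tau> (perm_tuple \<sigma> w) ! s = perm_tuple (\<tau> \<circ> \<sigma>) w ! s"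
    using perm_tuple_comp[OF assms(3,4) tuples_length[OF assms(1)]] by simp
  then show "(w' ! (t - 1)) (perm_tuple \<sigma> w ! (inv' \<tau> t - 1)) = (w' ! (t - 1)) (w ! (inv' (\<tau> \<circ> \<sigma>) t - 1))"
    using s by (simp add: perm_tuple_nth tuples_length[OF assms(1)])
qed (use pairing_factor[OF assms(1,2) permutes_compose[OF assms(3,4)]] in auto)

text \<open>Substituting \<open>\<sigma> t\<close> for \<open>t\<close> in the product moves the
  permutation from the functionals to the vectors. It arrives as its inverse on the left of
  \<open>\<tau>\<close>, whereas permuting the vectors multiplies \<open>\<tau>\<close> by
  \<open>\<sigma>\<close> on the right.\<close>

lemma pairing_perm_right:
  assumes w: "w \<in> tuples E d" "w' \<in> tuples D d" and p: "\<sigma> permutes {1..d}" "\<tau> permutes {1..d}"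
  shows "pairing d \<tau> w (perm_tuple \<sigma> w') = pairing d (inv' \<sigma> \<circ> \<tau>) w w'"
proof -
  have i: "inv' (inv' \<sigma> \<circ> \<tau>) = inv' \<tau> \<circ> \<sigma>"
    using o_inv_distrib[OF permutes_bij[OF permutes_inv[OF p(1)]] permutes_bij[OF p(2)]] permutes_inv_inv[OF p(1)] by simp
  let ?f = "\<lambda>t. (perm_tuple \<sigma> w' ! (t - 1)) (w ! (inv' \<tau> t - 1))"
  have im: "\<sigma> ` {1..d} = {1..d}" by (rule permutes_image[OF p(1)])
  have "pairing d \<tau> w (perm_tuple \<sigma> w') = finprod K ?f (\<sigma> ` {1..d})"
    unfolding pairing_def im ..
  also have "\<dots> = (\<Otimes>\<^bsub>K\<^esub>t\<in>{1..d}. ?f (\<sigma> t))"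
    by (rule K.finprod_reindex) (use pairing_factor(3)[OF w(1) perm_tuple_tuples[OF p(1) w(2)] p(2)] im permutes_inj_on[OF p(1)] in auto)
  also have "\<dots> = pairing d (inv' \<sigma> \<circ> \<tau>) w w'"
    unfolding pairing_def i
  proof (rule K.finprod_cong')
    fix t assume "t \<in> {1..d}"
    then obtain s where s: "t = Suc s" "s < d" by (cases t) auto
    have r: "1 \<le> \<sigma> t" "\<sigma> t - 1 < d" using permutes_range[OF p(1) s(2)] s by auto
    have "perm_tuple \<sigma> w' ! (\<sigma> t - 1) = w' ! (t - 1)"
      using r by (simp add: perm_tuple_nth tuples_length[OF w(2)] permutes_inverses(2)[OF p(1)])
    then show "?f (\<sigma> t) = (w' ! (t - 1)) (w ! ((inv' \<tau> \<circ> \<sigma>) t - 1))" by simp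
  qed (use pairing_factor[OF w permutes_compose[OF p(2) permutes_inv[OF p(1)]]] in \<open>auto simp: i\<close>)
  finally show ?thesis .
qed

lemma tuple_form_W0:
  "tuple_form K W \<chi> d w w' = (\<Oplus>\<^bsub>K\<^esub>\<sigma>\<in>W0 d. chi0 d \<sigma> \<otimes>\<^bsub>K\<^esub> pairing d \<sigma> w w')"
proof (cases "d = 0")
  case True
  have "(\<Oplus>\<^bsub>K\<^esub>\<sigma>\<in>{id}. \<one>\<^bsub>K\<^esub> \<otimes>\<^bsub>K\<^esub> (\<one>\<^bsub>K\<^esub> :: 'k)) = \<one>\<^bsub>K\<^esub>"
    by (subst K.finsum_insert) auto
  then show ?thesis using True by (simp add: tuple_form_def W0_def chi0_def pairing_def)
next
  case False
  then show ?thesis by (simp add: tuple_form_def W0_def chi0_def pairing_def)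
qed

lemma tuple_form_closed:
  assumes "w \<in> tuples E d" "w' \<in> tuples D d" shows "tuple_form K W \<chi> d w w' \<in> carrier K"
  unfolding tuple_form_W0 
  by (rule K.finsum_closed) (use pairing_closed[OF assms W0_permutes] chi0_closed in auto)

lemma tuple_form_multilin:
  shows "w' \<in> tuples D d \<Longrightarrow> multilin K E d KM (\<lambda>w. tuple_form K W \<chi> d w w')"
    and "w \<in> tuples E d \<Longrightarrow> multilin K D d KM (\<lambda>w'. tuple_form K W \<chi> d w w')"
proof -
  have eq: "tuple_form K W \<chi> d w w' = (\<Oplus>\<^bsub>KM\<^esub>\<sigma>\<in>W0 d. chi0 d \<sigma> \<otimes>\<^bsub>K\<^esub> pairing d \<sigma> w w')" for w w'
    by (simp add: tuple_form_W0)
  note s = multilin_lin_map[OF _ lin_map_self_mult[OF K.is_cring chi0_closed]]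
  show "multilin K E d KM (\<lambda>w. tuple_form K W \<chi> d w w')" if w': "w' \<in> tuples D d"
    unfolding eq by (rule multilin_finsum[OF KM E finite_W0], rule s[OF pairing_multilin_left[OF w' W0_permutes]])
  show "multilin K D d KM (\<lambda>w'. tuple_form K W \<chi> d w w')" if w: "w \<in> tuples E d"
    unfolding eq by (rule multilin_finsum[OF KM D finite_W0], rule s[OF pairing_multilin_right[OF w W0_permutes]])
qed

text \<open>Reindexing the sum over the group by \<open>\<tau> \<circ> \<sigma>\<close> produces the
  inverse of \<open>chi0 d \<sigma>\<close>, as the relations demand; reindexing by
  \<open>inv' \<sigma> \<circ> \<tau>\<close> for the second argument produces
  \<open>chi0 d \<sigma>\<close> itself. The two factors agree because the character has trivial
  square, and one reindexing step then serves both arguments.\<close>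

lemma tuple_form_equivar:
  shows "w' \<in> tuples D d \<Longrightarrow> equivar E d KM (\<lambda>w. tuple_form K W \<chi> d w w')"
    and "w \<in> tuples E d \<Longrightarrow> equivar D d KM (\<lambda>w'. tuple_form K W \<chi> d w w')"
proof -
  \<comment> \<open>Here \<open>h\<close> is right translation by \<open>\<sigma>\<close> or left
    translation by its inverse; in both cases the character changes by the factor
    \<open>chi0 d \<sigma>\<close>.\<close>
  have reindex: "(\<Oplus>\<^bsub>K\<^esub>\<tau>\<in>W0 d. chi0 d \<tau> \<otimes>\<^bsub>K\<^esub> pairing d (h \<tau>) w w') = chi0 d \<sigma> \<otimes>\<^bsub>K\<^esub> tuple_form K W \<chi> d w w'"
    if w: "w \<in> tuples E d" "w' \<in> tuples D d" and s: "\<sigma> \<in> W0 d"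
      and h: "bij_betw h (W0 d) (W0 d)" "\<And>\<tau>. \<tau> \<in> W0 d \<Longrightarrow> chi0 d (h \<tau>) = chi0 d \<sigma> \<otimes>\<^bsub>K\<^esub> chi0 d \<tau>" for w w' \<sigma> h
  proof -
    have hW: "h \<tau> \<in> W0 d" if "\<tau> \<in> W0 d" for \<tau> using h(1) that by (auto simp: bij_betw_def)
    note c = chi0_closed pairing_closed[OF w W0_permutes]
    have "(\<Oplus>\<^bsub>K\<^esub>\<tau>\<in>W0 d. chi0 d \<tau> \<otimes>\<^bsub>K\<^esub> pairing d (h \<tau>) w w') =
        (\<Oplus>\<^bsub>K\<^esub>\<tau>\<in>W0 d. chi0 d \<sigma> \<otimes>\<^bsub>K\<^esub> (chi0 d (h \<tau>) \<otimes>\<^bsub>K\<^esub> pairing d (h \<tau>) w w'))"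
    proof (rule K.finsum_cong')
      fix \<tau> assume t: "\<tau> \<in> W0 d"
      have "chi0 d \<sigma> \<otimes>\<^bsub>K\<^esub> (chi0 d \<sigma> \<otimes>\<^bsub>K\<^esub> chi0 d \<tau>) = chi0 d \<tau>"
        using c(1)[OF s] c(1)[OF t] chi0_square[OF s] by (simp add: K.m_assoc[symmetric])
      then show "chi0 d \<tau> \<otimes>\<^bsub>K\<^esub> pairing d (h \<tau>) w w' = chi0 d \<sigma> \<otimes>\<^bsub>K\<^esub> (chi0 d (h \<tau>) \<otimes>\<^bsub>K\<^esub> pairing d (h \<tau>) w w')"
        using c(1)[OF s] c(1)[OF t] c(2)[OF hW[OF t]] h(2)[OF t] by (simp add: K.m_assoc[symmetric])
    qed (use c hW s in auto)
    also have "\<dots> = chi0 d \<sigma> \<otimes>\<^bsub>K\<^esub> (\<Oplus>\<^bsub>K\<^esub>\<tau>\<in>W0 d. chi0 d (h \<tau>) \<otimes>\<^bsub>K\<^esub> pairing d (h \<tau>) w w')"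
      by (rule K.finsum_rdistr[symmetric]) (use c hW s finite_W0 in auto)
    also have "(\<Oplus>\<^bsub>K\<^esub>\<tau>\<in>W0 d. chi0 d (h \<tau>) \<otimes>\<^bsub>K\<^esub> pairing d (h \<tau>) w w') = 
        (\<Oplus>\<^bsub>K\<^esub>\<rho>\<in>h ` W0 d. chi0 d \<rho> \<otimes>\<^bsub>K\<^esub> pairing d \<rho> w w')"
      by (rule K.finsum_reindex[symmetric]) (use c hW h(1) in \<open>auto simp: bij_betw_def\<close>)
    finally show ?thesis using h(1) by (simp add: bij_betw_def tuple_form_W0)
  qed
  have canc: "\<sigma> \<circ> inv' \<sigma> = id" "inv' \<sigma> \<circ> \<sigma> = id" if "\<sigma> \<in> W0 d" for \<sigma>
    using permutes_inv_o[OF W0_permutes[OF that]] by auto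
  show "equivar E d KM (\<lambda>w. tuple_form K W \<chi> d w w')" if w': "w' \<in> tuples D d"
  proof (rule equivar_W0I)
    fix \<sigma> w assume s: "\<sigma> \<in> W0 d" and w: "w \<in> tuples E d"
    have "tuple_form K W \<chi> d (perm_tuple \<sigma> w) w' = (\<Oplus>\<^bsub>K\<^esub>\<tau>\<in>W0 d. chi0 d \<tau> \<otimes>\<^bsub>K\<^esub> pairing d (\<tau> \<circ> \<sigma>) w w')"
      unfolding tuple_form_W0
      by (rule K.finsum_cong') (use pairing_perm_left[OF w w' W0_permutes[OF s] W0_permutes] pairing_closed[OF w w' W0_permutes] 
          chi0_closed W0_comp s in auto)
    also have "\<dots> = chi0 d \<sigma> \<otimes>\<^bsub>K\<^esub> tuple_form K W \<chi> d w w'"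
    proof (rule reindex[OF w w' s])
      show "bij_betw (\<lambda>\<tau>. \<tau> \<circ> \<sigma>) (W0 d) (W0 d)"
        by (rule bij_betwI[of _ _ _ "\<lambda>\<tau>. \<tau> \<circ> inv' \<sigma>"])
          (use canc[OF s] W0_comp W0_inv s in \<open>auto simp: comp_assoc\<close>)
      show "chi0 d (\<tau> \<circ> \<sigma>) = chi0 d \<sigma> \<otimes>\<^bsub>K\<^esub> chi0 d \<tau>" if "\<tau> \<in> W0 d" for \<tau>
        using chi0_comp[OF that s] chi0_closed[OF that] chi0_closed[OF s] by (simp add: K.m_comm)
    qed
    finally show "tuple_form K W \<chi> d (perm_tuple \<sigma> w) w' = chi0 d \<sigma> \<odot>\<^bsub>KM\<^esub> tuple_form K W \<chi> d w w'" by simp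
  qed
  show "equivar D d KM (\<lambda>w'. tuple_form K W \<chi> d w w')" if w: "w \<in> tuples E d"
  proof (rule equivar_W0I)
    fix \<sigma> w' assume s: "\<sigma> \<in> W0 d" and w': "w' \<in> tuples D d"
    have "tuple_form K W \<chi> d w (perm_tuple \<sigma> w') = (\<Oplus>\<^bsub>K\<^esub>\<tau>\<in>W0 d. chi0 d \<tau> \<otimes>\<^bsub>K\<^esub> pairing d (inv' \<sigma> \<circ> \<tau>) w w')"
      unfolding tuple_form_W0
      by (rule K.finsum_cong') (use pairing_perm_right[OF w w' W0_permutes[OF s] W0_permutes] pairing_closed[OF w w' W0_permutes] 
          chi0_closed W0_comp W0_inv s in auto)
    also have "\<dots> = chi0 d \<sigma> \<otimes>\<^bsub>K\<^esub> tuple_form K W \<chi> d w w'"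
    proof (rule reindex[OF w w' s])
      show "bij_betw (\<lambda>\<tau>. inv' \<sigma> \<circ> \<tau>) (W0 d) (W0 d)"
        by (rule bij_betwI[of _ _ _ "\<lambda>\<tau>. \<sigma> \<circ> \<tau>"])
          (use canc[OF s] W0_comp W0_inv s in \<open>auto simp: comp_assoc[symmetric]\<close>)
      show "chi0 d (inv' \<sigma> \<circ> \<tau>) = chi0 d \<sigma> \<otimes>\<^bsub>K\<^esub> chi0 d \<tau>" if "\<tau> \<in> W0 d" for \<tau>
        using chi0_comp[OF W0_inv[OF s] that] chi0_inv[OF s] by simp
    qed
    finally show "tuple_form K W \<chi> d w (perm_tuple \<sigma> w') = chi0 d \<sigma> \<odot>\<^bsub>KM\<^esub> tuple_form K W \<chi> d w w'" by simp
  qed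
qed

lemma free_form_bil_ext:
  assumes u: "u \<in> carrier (free_tensors K E d)" and v: "v \<in> carrier (free_tensors K D d)"
  shows "free_form K W \<chi> d u v = bil_ext K KM (tuple_form K W \<chi> d) u v"
  unfolding free_form_def bil_ext_def lin_ext_def self_module_simps
proof (rule K.finsum_cong')
  note u' = free_carrierD[OF K.is_cring u] and v' = free_carrierD[OF K.is_cring v]
  let ?B = "{w'. v w' \<noteq> \<zero>\<^bsub>K\<^esub>}"
  fix w assume "w \<in> {w. u w \<noteq> \<zero>\<^bsub>K\<^esub>}"
  then have w: "w \<in> tuples E d" using u' by blast
  have c: "tuple_form K W \<chi> d w w' \<in> carrier K" if "w' \<in> ?B" for w'
    using tuple_form_closed[OF w] v' that by blast
  have "u w \<otimes>\<^bsub>K\<^esub> (\<Oplus>\<^bsub>K\<^esub>w'\<in>?B. v w' \<otimes>\<^bsub>K\<^esub> tuple_form K W \<chi> d w w') =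
    (\<Oplus>\<^bsub>K\<^esub>w'\<in>?B. u w \<otimes>\<^bsub>K\<^esub> (v w' \<otimes>\<^bsub>K\<^esub> tuple_form K W \<chi> d w w'))"
    by (rule K.finsum_rdistr) (use c u' v' in auto)
  also have "\<dots> = (\<Oplus>\<^bsub>K\<^esub>w'\<in>?B. u w \<otimes>\<^bsub>K\<^esub> v w' \<otimes>\<^bsub>K\<^esub> tuple_form K W \<chi> d w w')"
    by (rule K.finsum_cong') (use c u' v' in \<open>auto simp: K.m_assoc\<close>)
  finally show "(\<Oplus>\<^bsub>K\<^esub>w'\<in>?B. u w \<otimes>\<^bsub>K\<^esub> v w' \<otimes>\<^bsub>K\<^esub> tuple_form K W \<chi> d w w') =
    u w \<otimes>\<^bsub>K\<^esub> (\<Oplus>\<^bsub>K\<^esub>w'\<in>?B. v w' \<otimes>\<^bsub>K\<^esub> tuple_form K W \<chi> d w w')" ..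
next
  note u' = free_carrierD[OF K.is_cring u] and v' = free_carrierD[OF K.is_cring v]
  show "(\<lambda>w. u w \<otimes>\<^bsub>K\<^esub> (\<Oplus>\<^bsub>K\<^esub>w'\<in>{w'. v w' \<noteq> \<zero>\<^bsub>K\<^esub>}. v w' \<otimes>\<^bsub>K\<^esub> tuple_form K W \<chi> d w w')) \<in> {w. u w \<noteq> \<zero>\<^bsub>K\<^esub>} \<rightarrow> carrier K"
    by (intro Pi_I K.m_closed K.finsum_closed tuple_form_closed) (use u' v' in blast)+
qed simp

lemma free_form_bilin: "bilin K (free_tensors K E d) (free_tensors K D d) KM (free_form K W \<chi> d)"
  and free_form_gen: "w \<in> tuples E d \<Longrightarrow> w' \<in> tuples D d \<Longrightarrow> free_form K W \<chi> d (gen K w) (gen K w') = tuple_form K W \<chi> d w w'"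
proof -
  have c: "\<And>w w'. w \<in> tuples E d \<Longrightarrow> w' \<in> tuples D d \<Longrightarrow> tuple_form K W \<chi> d w w' \<in> carrier KM"
    using tuple_form_closed by simp
  note b = bil_ext_bilin[of K KM "tuples E d" "tuples D d" "tuple_form K W \<chi> d", OF K.is_cring KM c]
  interpret FE: module K "free_tensors K E d" by (rule free_module_module[OF K.is_cring])
  interpret FD: module K "free_tensors K D d" by (rule free_module_module[OF K.is_cring])
  show "bilin K (free_tensors K E d) (free_tensors K D d) KM (free_form K W \<chi> d)"
    using b(1) by (simp add: bilin_def lin_map_def Pi_iff free_form_bil_ext)
  show "w \<in> tuples E d \<Longrightarrow> w' \<in> tuples D d \<Longrightarrow> free_form K W \<chi> d (gen K w) (gen K w') = tuple_form K W \<chi> d w w'"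
    using b(2) by (simp add: free_form_bil_ext gen_closed[OF K.is_cring])
qed

end

context
  fixes E :: "('k, 'e, 'n) module_scheme"
  assumes E: "module K E"
begin

lemma free_form_null:
  assumes u: "u \<in> carrier (free_tensors K E d)" and v: "v \<in> carrier (free_tensors K (dual_module K E) d)"
  shows "chi_class K W \<chi> E d u = \<zero>\<^bsub>chi_power K W \<chi> E d\<^esub> \<Longrightarrow> free_form K W \<chi> d u v = \<zero>\<^bsub>K\<^esub>"
    and "chi_class K W \<chi> (dual_module K E) d v = \<zero>\<^bsub>chi_power K W \<chi> (dual_module K E) d\<^esub> \<Longrightarrow> free_form K W \<chi> d u v = \<zero>\<^bsub>K\<^esub>"
proof -
  note b = free_form_bilin[OF E, of d]
  assume z: "chi_class K W \<chi> E d u = \<zero>\<^bsub>chi_power K W \<chi> E d\<^esub>"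
  have "free_form K W \<chi> d u v = \<zero>\<^bsub>self_module K\<^esub>"
  proof (rule bilin_equivar_vanish[OF E KM[OF E] b _ _ u z v])
    fix w' assume w': "w' \<in> tuples (dual_module K E) d"
    show "multilin K E d (self_module K) (\<lambda>w. free_form K W \<chi> d (gen K w) (gen K w'))"
      by (rule multilin_cong[OF E tuple_form_multilin(1)[OF E w']]) (rule free_form_gen[OF E _ w'])
    show "equivar E d (self_module K) (\<lambda>w. free_form K W \<chi> d (gen K w) (gen K w'))"
      by (rule equivar_cong[OF tuple_form_equivar(1)[OF E w']]) (rule free_form_gen[OF E _ w'])
  qed
  then show "free_form K W \<chi> d u v = \<zero>\<^bsub>K\<^esub>" by simp
next
  note b = free_form_bilin[OF E, of d]
  assume z: "chi_class K W \<chi> (dual_module K E) d v = \<zero>\<^bsub>chi_power K W \<chi> (dual_module K E) d\<^esub>"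
  have "free_form K W \<chi> d u v = \<zero>\<^bsub>self_module K\<^esub>"
  proof (rule bilin_equivar_vanish[OF D[OF E] KM[OF E] bilin_flip[OF b] _ _ v z u])
    fix w assume w: "w \<in> tuples E d"
    show "multilin K (dual_module K E) d (self_module K) (\<lambda>w'. free_form K W \<chi> d (gen K w) (gen K w'))"
      by (rule multilin_cong[OF D[OF E] tuple_form_multilin(2)[OF E w]]) (rule free_form_gen[OF E w])
    show "equivar (dual_module K E) d (self_module K) (\<lambda>w'. free_form K W \<chi> d (gen K w) (gen K w'))"
      by (rule equivar_cong[OF tuple_form_equivar(2)[OF E w]]) (rule free_form_gen[OF E w])
  qed
  then show "free_form K W \<chi> d u v = \<zero>\<^bsub>K\<^esub>" by simp
qed

text \<open>By \<open>free_form_null\<close> the form is constant on pairs of representatives, so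
  the definite description in \<open>chi_power_form\<close> has exactly one solution.\<close>

lemma chi_power_form_class:
  assumes u: "u \<in> carrier (free_tensors K E d)" and v: "v \<in> carrier (free_tensors K (dual_module K E) d)"
  shows "chi_power_form K W \<chi> d (chi_class K W \<chi> E d u) (chi_class K W \<chi> (dual_module K E) d v) = free_form K W \<chi> d u v"
proof -
  note fac = bilin_factor_eq[OF FT_module[OF E] FT_module[OF D[OF E]] KM[OF E] CP_module[OF E] CP_module[OF D[OF E]]
      free_form_bilin[OF E] cc_lin_map[OF E] cc_lin_map[OF D[OF E]] _ _ u]
  have eq: "free_form K W \<chi> d u' v' = free_form K W \<chi> d u v"
    if "u' \<in> carrier (free_tensors K E d)" "chi_class K W \<chi> E d u' = chi_class K W \<chi> E d u"
      "v' \<in> carrier (free_tensors K (dual_module K E) d)"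
      "chi_class K W \<chi> (dual_module K E) d v' = chi_class K W \<chi> (dual_module K E) d v" for u' v'
    by (rule fac[OF _ _ that(1,2) v that(3,4)]) (simp_all add: free_form_null)
  show ?thesis
    unfolding chi_power_form_def Union_cc[OF E u] Union_cc[OF D[OF E] v]
  proof (rule the_equality)
    show "\<forall>u'\<in>{u' \<in> carrier (free_tensors K E d). chi_class K W \<chi> E d u' = chi_class K W \<chi> E d u}.
       \<forall>v'\<in>{v' \<in> carrier (free_tensors K (dual_module K E) d).
          chi_class K W \<chi> (dual_module K E) d v' = chi_class K W \<chi> (dual_module K E) d v}.
       free_form K W \<chi> d u v = free_form K W \<chi> d u' v'"
      using eq by simp
  qed (use u v in blast)
qed

end

end

section \<open>Nondegeneracy of the bilinear form\<close>

lemma submodule_finsum: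
  assumes "module K M" "submodule N K M" "finite A" "\<And>a. a \<in> A \<Longrightarrow> f a \<in> N"
  shows "(\<Oplus>\<^bsub>M\<^esub>a\<in>A. f a) \<in> N"
proof -
  interpret M: module K M by fact
  note N = M.submoduleE[OF assms(2)]
  have z: "\<zero>\<^bsub>M\<^esub> \<in> N"
    using subgroup.one_closed[OF submodule.axioms(1)[OF assms(2)]] by simp
  from assms(3,4) show ?thesis
  proof induction
    case (insert a A)
    then have "f \<in> A \<rightarrow> carrier M" "f a \<in> carrier M" using N(1) by auto
    then show ?case using insert N(5) by simp
  qed (use z in simp)
qed

text \<open>The order of a finite set, as an element of \<open>K\<close>, is kept in the form of a
  sum of ones throughout.\<close>

lemma finsum_const_module:
  assumes "module K M" "finite A" "m \<in> carrier M"
  shows "(\<Oplus>\<^bsub>M\<^esub>a\<in>A. m) = (\<Oplus>\<^bsub>K\<^esub>a\<in>A. \<one>\<^bsub>K\<^esub>) \<odot>\<^bsub>M\<^esub> m"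
proof -
  interpret M: module K M by fact
  from assms(2) show ?thesis
    by induction (simp_all add: assms(3) M.smult_l_distr Pi_def)
qed

lemma lin_map_sum:
  assumes N: "module K N" and A: "finite A" and g: "\<And>a. a \<in> A \<Longrightarrow> lin_map K M N (g a)"
  shows "lin_map K M N (\<lambda>x. \<Oplus>\<^bsub>N\<^esub>a\<in>A. g a x)"
proof -
  interpret N: module K N by (rule N)
  note c = lin_map_closed[OF g] and add = lin_map_add[OF g] and smult = lin_map_smult[OF g]
  show ?thesis
  proof (rule lin_mapI)
    fix x assume x: "x \<in> carrier M"
    show "(\<Oplus>\<^bsub>N\<^esub>a\<in>A. g a x) \<in> carrier N" using c x by (intro N.M.finsum_closed) auto
    show "(\<Oplus>\<^bsub>N\<^esub>a\<in>A. g a (x \<oplus>\<^bsub>M\<^esub> y)) = (\<Oplus>\<^bsub>N\<^esub>a\<in>A. g a x) \<oplus>\<^bsub>N\<^esub> (\<Oplus>\<^bsub>N\<^esub>a\<in>A. g a y)"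
      if y: "y \<in> carrier M" for y
    proof -
      have "(\<Oplus>\<^bsub>N\<^esub>a\<in>A. g a (x \<oplus>\<^bsub>M\<^esub> y)) = (\<Oplus>\<^bsub>N\<^esub>a\<in>A. g a x \<oplus>\<^bsub>N\<^esub> g a y)"
        by (rule N.M.finsum_cong') (use add x y c in auto)
      then show ?thesis using N.M.finsum_addf[of "\<lambda>a. g a x" A "\<lambda>a. g a y"] c x y by auto
    qed
    show "(\<Oplus>\<^bsub>N\<^esub>a\<in>A. g a (k \<odot>\<^bsub>M\<^esub> x)) = k \<odot>\<^bsub>N\<^esub> (\<Oplus>\<^bsub>N\<^esub>a\<in>A. g a x)" if k: "k \<in> carrier K" for k
    proof -
      have "(\<Oplus>\<^bsub>N\<^esub>a\<in>A. g a (k \<odot>\<^bsub>M\<^esub> x)) = (\<Oplus>\<^bsub>N\<^esub>a\<in>A. k \<odot>\<^bsub>N\<^esub> g a x)"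
        by (rule N.M.finsum_cong') (use smult x k c in auto)
      then show ?thesis using N.finsum_smult_ldistr[OF A k, of "\<lambda>a. g a x"] c x by auto
    qed
  qed
qed

text \<open>The coefficient at \<open>x\<close> collects the weights of all \<open>a\<close> with
  \<open>s a = x\<close>. The map \<open>s\<close> may repeat values: it will send
  \<open>\<sigma>\<close> to a permuted word, and a word with equal letters can have a nontrivial
  stabilizer.\<close>

lemma finsum_kronecker:
  assumes M: "module K M" and X: "finite X" and A: "finite A"
    and s: "\<And>a. a \<in> A \<Longrightarrow> s a \<in> X" and c: "\<And>a. a \<in> A \<Longrightarrow> c a \<in> carrier K"
    and h: "\<And>x. x \<in> X \<Longrightarrow> h x \<in> carrier M"
  shows "(\<Oplus>\<^bsub>M\<^esub>x\<in>X. (\<Oplus>\<^bsub>K\<^esub>a\<in>A. c a \<otimes>\<^bsub>K\<^esub> (if x = s a then \<one>\<^bsub>K\<^esub> else \<zero>\<^bsub>K\<^esub>)) \<odot>\<^bsub>M\<^esub> h x) = (\<Oplus>\<^bsub>M\<^esub>a\<in>A. c a \<odot>\<^bsub>M\<^esub> h (s a))"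
proof -
  interpret M: module K M by (rule M)
  let ?k = "\<lambda>a x. c a \<otimes>\<^bsub>K\<^esub> (if x = s a then \<one>\<^bsub>K\<^esub> else \<zero>\<^bsub>K\<^esub>)"
  from A s c show ?thesis
  proof induction
    case empty
    have "(\<Oplus>\<^bsub>M\<^esub>x\<in>X. \<zero>\<^bsub>K\<^esub> \<odot>\<^bsub>M\<^esub> h x) = (\<Oplus>\<^bsub>M\<^esub>x\<in>X. \<zero>\<^bsub>M\<^esub>)"
      by (rule M.M.finsum_cong') (auto simp: h)
    then show ?case by simp
  next
    case (insert a A)
    have k: "?k b x \<in> carrier K" if "b \<in> insert a A" for b x using insert.prems(2)[OF that] by simp
    have S: "(\<Oplus>\<^bsub>K\<^esub>b\<in>A. ?k b x) \<in> carrier K" for x by (rule M.R.finsum_closed) (use k in auto)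
    have "(\<Oplus>\<^bsub>M\<^esub>x\<in>X. (\<Oplus>\<^bsub>K\<^esub>b\<in>insert a A. ?k b x) \<odot>\<^bsub>M\<^esub> h x) =
        (\<Oplus>\<^bsub>M\<^esub>x\<in>X. ?k a x \<odot>\<^bsub>M\<^esub> h x \<oplus>\<^bsub>M\<^esub> (\<Oplus>\<^bsub>K\<^esub>b\<in>A. ?k b x) \<odot>\<^bsub>M\<^esub> h x)"
    proof (rule M.M.finsum_cong')
      fix x assume x: "x \<in> X"
      have "(\<Oplus>\<^bsub>K\<^esub>b\<in>insert a A. ?k b x) = ?k a x \<oplus>\<^bsub>K\<^esub> (\<Oplus>\<^bsub>K\<^esub>b\<in>A. ?k b x)"
        by (rule M.R.finsum_insert) (use insert.hyps k in auto)
      then show "(\<Oplus>\<^bsub>K\<^esub>b\<in>insert a A. ?k b x) \<odot>\<^bsub>M\<^esub> h x = ?k a x \<odot>\<^bsub>M\<^esub> h x \<oplus>\<^bsub>M\<^esub> (\<Oplus>\<^bsub>K\<^esub>b\<in>A. ?k b x) \<odot>\<^bsub>M\<^esub> h x"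
        using M.smult_l_distr[OF k[of a] S h[OF x]] by simp
    qed (use k S h in auto)
    also have "\<dots> = (\<Oplus>\<^bsub>M\<^esub>x\<in>X. ?k a x \<odot>\<^bsub>M\<^esub> h x) \<oplus>\<^bsub>M\<^esub> (\<Oplus>\<^bsub>M\<^esub>x\<in>X. (\<Oplus>\<^bsub>K\<^esub>b\<in>A. ?k b x) \<odot>\<^bsub>M\<^esub> h x)"
      by (rule M.M.finsum_addf) (use k S h in auto)
    also have "(\<Oplus>\<^bsub>M\<^esub>x\<in>X. (\<Oplus>\<^bsub>K\<^esub>b\<in>A. ?k b x) \<odot>\<^bsub>M\<^esub> h x) = (\<Oplus>\<^bsub>M\<^esub>b\<in>A. c b \<odot>\<^bsub>M\<^esub> h (s b))"
      using insert by simp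
    also have "(\<Oplus>\<^bsub>M\<^esub>x\<in>X. ?k a x \<odot>\<^bsub>M\<^esub> h x) = (\<Oplus>\<^bsub>M\<^esub>x\<in>X. if s a = x then c a \<odot>\<^bsub>M\<^esub> h x else \<zero>\<^bsub>M\<^esub>)"
      by (rule M.M.finsum_cong') (use insert.prems h in auto)
    also have "\<dots> = c a \<odot>\<^bsub>M\<^esub> h (s a)"
      by (rule M.M.finsum_singleton) (use insert.prems h X in auto)
    finally show ?case
      using insert.hyps insert.prems h by (subst M.M.finsum_insert) auto
  qed
qed

section \<open>Dual bases and reduction to basis words\<close>

definition dual_basis :: "('k, 'm) ring_scheme \<Rightarrow> ('k, 'e, 'n) module_scheme \<Rightarrow> 'e set \<Rightarrow> ('e \<Rightarrow> 'e \<Rightarrow> 'k) \<Rightarrow> bool" where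
  "dual_basis K E B \<delta> \<longleftrightarrow> finite B \<and> B \<subseteq> carrier E \<and> \<delta> \<in> B \<rightarrow> carrier (dual_module K E) \<and>
    (\<forall>b\<in>B. \<forall>b'\<in>B. \<delta> b b' = (if b = b' then \<one>\<^bsub>K\<^esub> else \<zero>\<^bsub>K\<^esub>)) \<and>
    (\<forall>x\<in>carrier E. x = (\<Oplus>\<^bsub>E\<^esub>b\<in>B. \<delta> b x \<odot>\<^bsub>E\<^esub> b))"

text \<open>A basis makes the linear extension from the free module on \<open>B\<close> to
  \<open>E\<close> bijective; the members of the dual basis are the coordinates of its
  inverse.\<close>

lemma module_basis_dual_basis:
  assumes E: "module K E" and B: "finite B" "module_basis K E B"
  shows "\<exists>\<delta>. dual_basis K E B \<delta>"
proof -
  interpret E: module K E by (rule E)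
  let ?F = "free_module K B"
  note K = E.is_cring
  note F = free_module_module[OF K, of B]
  interpret F: module K ?F by (rule F)
  have BE: "B \<subseteq> carrier E" using B(2) by (simp add: module_basis_def)
  then have id: "(\<lambda>b. b) \<in> B \<rightarrow> carrier E" by blast
  let ?f = "lin_ext K E (\<lambda>b. b)"
  note f = lin_ext_lin_map[OF K E id]
  have f_sum: "?f u = (\<Oplus>\<^bsub>E\<^esub>b\<in>B. u b \<odot>\<^bsub>E\<^esub> b)" if "u \<in> carrier ?F" for u
    using lin_ext_superset[OF K E id B(1) subset_refl that] free_carrierD(2)[OF K that] by blast
  have inj: "u = v" if uv: "u \<in> carrier ?F" "v \<in> carrier ?F" "?f u = ?f v" for u v
  proof -
    let ?w = "u \<ominus>\<^bsub>?F\<^esub> v"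
    have w: "?w \<in> carrier ?F" using uv by simp
    have "?f ?w = \<zero>\<^bsub>E\<^esub>" using lin_map_kernel_eq[OF F E f uv(1,2)] uv(3) by simp
    then have "(\<Oplus>\<^bsub>E\<^esub>b\<in>B. ?w b \<odot>\<^bsub>E\<^esub> b) = \<zero>\<^bsub>E\<^esub>" using f_sum[OF w] by simp
    moreover have "?w \<in> B \<rightarrow> carrier K" using free_carrierD(1)[OF K w] by blast
    moreover have "\<forall>S c. finite S \<and> S \<subseteq> B \<and> c \<in> S \<rightarrow> carrier K \<and> (\<Oplus>\<^bsub>E\<^esub>b\<in>S. c b \<odot>\<^bsub>E\<^esub> b) = \<zero>\<^bsub>E\<^esub>
      \<longrightarrow> (\<forall>b\<in>S. c b = \<zero>\<^bsub>K\<^esub>)"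
      using B(2) unfolding module_basis_def by (elim conjE)
    ultimately have "\<forall>b\<in>B. ?w b = \<zero>\<^bsub>K\<^esub>" using B(1) by blast
    then have "?w b = \<zero>\<^bsub>?F\<^esub> b" for b
      using free_carrierD(2)[OF K w, of b] by (cases "b \<in> B") (auto simp: free_zero[OF K])
    then have "?w = \<zero>\<^bsub>?F\<^esub>" by (rule ext)
    then show ?thesis using F.M.diff_eq_zero_iff[OF uv(1,2)] by simp
  qed
  have surj: "\<exists>u\<in>carrier ?F. ?f u = x" if x: "x \<in> carrier E" for x
  proof -
    have "\<forall>x\<in>carrier E. \<exists>S c. finite S \<and> S \<subseteq> B \<and> c \<in> S \<rightarrow> carrier K \<and> x = (\<Oplus>\<^bsub>E\<^esub>b\<in>S. c b \<odot>\<^bsub>E\<^esub> b)"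
      using B(2) unfolding module_basis_def by (elim conjE)
    from bspec[OF this x]
    obtain S c where S: "finite S" "S \<subseteq> B" "c \<in> S \<rightarrow> carrier K" "x = (\<Oplus>\<^bsub>E\<^esub>b\<in>S. c b \<odot>\<^bsub>E\<^esub> b)"
      by (elim exE conjE)
    define u where "u b = (if b \<in> S then c b else \<zero>\<^bsub>K\<^esub>)" for b
    have u: "u \<in> carrier ?F" by (rule free_carrierI[OF K _ S(1,2)]) (use S(3) in \<open>auto simp: u_def\<close>)
    have "?f u = (\<Oplus>\<^bsub>E\<^esub>b\<in>S. u b \<odot>\<^bsub>E\<^esub> b)"
      by (rule lin_ext_superset[OF K E id S(1,2) u]) (simp add: u_def)
    also have "\<dots> = x"
      unfolding S(4) by (rule E.M.finsum_cong') (use S BE in \<open>auto simp: u_def\<close>)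
    finally show ?thesis using u by blast
  qed
  \<comment> \<open>The coordinate vector is chosen arbitrarily; its additivity and homogeneity then
    follow from \<open>inj\<close>.\<close>
  define co where "co x = (SOME u. u \<in> carrier ?F \<and> ?f u = x)" for x
  have co: "co x \<in> carrier ?F" "?f (co x) = x" if "x \<in> carrier E" for x
    using someI_ex[of "\<lambda>u. u \<in> carrier ?F \<and> ?f u = x"] surj[OF that] unfolding co_def by blast+
  have co_add: "co (x \<oplus>\<^bsub>E\<^esub> y) = co x \<oplus>\<^bsub>?F\<^esub> co y" if "x \<in> carrier E" "y \<in> carrier E" for x y
    by (rule inj) (use that co in \<open>auto simp: lin_map_add[OF f]\<close>)
  have co_smult: "co (k \<odot>\<^bsub>E\<^esub> x) = k \<odot>\<^bsub>?F\<^esub> co x" if "x \<in> carrier E" "k \<in> carrier K" for x k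
    by (rule inj) (use that co in \<open>auto simp: lin_map_smult[OF f]\<close>)
  have co_gen: "co b = gen K b" if b: "b \<in> B" for b
    by (rule inj) (use b co BE gen_closed[OF K b] lin_ext_gen[OF K E id b] in auto)
  define \<delta> where "\<delta> b = (\<lambda>x\<in>carrier E. co x b)" for b
  have "dual_basis K E B \<delta>"
    unfolding dual_basis_def
  proof (intro conjI B BE Pi_I ballI)
    show "\<delta> b \<in> carrier (dual_module K E)" for b
      using co free_carrierD(1)[OF K co(1)]
      by (auto simp: dual_carrier_iff \<delta>_def co_add co_smult free_add[OF K] free_smult[OF K])
    show "\<delta> b b' = (if b = b' then \<one>\<^bsub>K\<^esub> else \<zero>\<^bsub>K\<^esub>)" if "b \<in> B" "b' \<in> B" for b b'
      using that BE by (auto simp: \<delta>_def co_gen gen_def)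
    fix x assume x: "x \<in> carrier E"
    have "(\<Oplus>\<^bsub>E\<^esub>b\<in>B. \<delta> b x \<odot>\<^bsub>E\<^esub> b) = (\<Oplus>\<^bsub>E\<^esub>b\<in>B. co x b \<odot>\<^bsub>E\<^esub> b)"
      using x by (simp add: \<delta>_def)
    then show "x = (\<Oplus>\<^bsub>E\<^esub>b\<in>B. \<delta> b x \<odot>\<^bsub>E\<^esub> b)" using f_sum[OF co(1)[OF x]] co(2)[OF x] by simp
  qed
  then show ?thesis by blast
qed

text \<open>For the dual, a functional \<open>f\<close> is the sum of the \<open>\<delta> b\<close>
  with coefficients \<open>f b\<close>, as evaluation on the expansion of a vector shows. Generation
  is phrased through submodules because it will be applied to equalizers of linear maps.\<close>

lemma dual_basis_span:
  assumes E: "module K E" and \<delta>: "dual_basis K E B \<delta>"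
  shows "submodule N K E \<Longrightarrow> B \<subseteq> N \<Longrightarrow> carrier E \<subseteq> N"
    and "submodule N' K (dual_module K E) \<Longrightarrow> \<delta> ` B \<subseteq> N' \<Longrightarrow> carrier (dual_module K E) \<subseteq> N'"
proof -
  interpret E: module K E by (rule E)
  note K = E.is_cring and D = dual_module_module[OF E] and KM = self_module_module[OF E.is_cring]
  interpret D: module K "dual_module K E" by (rule D)
  have B: "finite B" "B \<subseteq> carrier E" and \<delta>D: "\<And>b. b \<in> B \<Longrightarrow> \<delta> b \<in> carrier (dual_module K E)"
    and x: "\<And>x. x \<in> carrier E \<Longrightarrow> x = (\<Oplus>\<^bsub>E\<^esub>b\<in>B. \<delta> b x \<odot>\<^bsub>E\<^esub> b)"
    using \<delta> by (auto simp: dual_basis_def)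
  show "carrier E \<subseteq> N" if N: "submodule N K E" "B \<subseteq> N"
  proof
    fix y assume y: "y \<in> carrier E"
    have "(\<Oplus>\<^bsub>E\<^esub>b\<in>B. \<delta> b y \<odot>\<^bsub>E\<^esub> b) \<in> N"
      by (rule submodule_finsum[OF E N(1) B(1)])
        (use N(2) E.submoduleE(4)[OF N(1)] dual_apply(1)[OF \<delta>D y] in blast)
    then show "y \<in> N" using x[OF y] by simp
  qed
  show "carrier (dual_module K E) \<subseteq> N'" if N: "submodule N' K (dual_module K E)" "\<delta> ` B \<subseteq> N'"
  proof
    fix f assume f: "f \<in> carrier (dual_module K E)"
    let ?D = "dual_module K E"
    let ?g = "\<Oplus>\<^bsub>?D\<^esub>b\<in>B. f b \<odot>\<^bsub>?D\<^esub> \<delta> b"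
    have fb: "f b \<in> carrier K" if "b \<in> B" for b using dual_apply(1)[OF f] B that by blast
    have g: "?g \<in> N'"
      by (rule submodule_finsum[OF D N(1) B(1)]) (use N(2) D.submoduleE(4)[OF N(1)] fb in blast)
    have "f = ?g"
    proof (rule dual_ext[OF f])
      show "?g \<in> carrier ?D" using g submodule_subset[OF N(1)] by blast
      fix y assume y: "y \<in> carrier E"
      have ev: "lin_map K ?D (self_module K) (\<lambda>f. f y)"
        by (rule lin_mapI) (use y in \<open>auto simp: dual_apply\<close>)
      have fl: "lin_map K E (self_module K) f"
        by (rule lin_mapI) (use f in \<open>auto simp: dual_apply\<close>)
      have "f y = f (\<Oplus>\<^bsub>E\<^esub>b\<in>B. \<delta> b y \<odot>\<^bsub>E\<^esub> b)" using x[OF y] by simp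
      also have "\<dots> = (\<Oplus>\<^bsub>K\<^esub>b\<in>B. f (\<delta> b y \<odot>\<^bsub>E\<^esub> b))"
        using lin_map_finsum[OF E KM fl B(1), of "\<lambda>b. \<delta> b y \<odot>\<^bsub>E\<^esub> b"] B(2) dual_apply(1)[OF \<delta>D y] by auto
      also have "\<dots> = (\<Oplus>\<^bsub>K\<^esub>b\<in>B. (f b \<odot>\<^bsub>?D\<^esub> \<delta> b) y)"
      proof (rule E.R.finsum_cong')
        fix b assume b: "b \<in> B"
        then have "b \<in> carrier E" using B by blast
        then show "f (\<delta> b y \<odot>\<^bsub>E\<^esub> b) = (f b \<odot>\<^bsub>?D\<^esub> \<delta> b) y"
          using dual_apply(3)[OF f dual_apply(1)[OF \<delta>D[OF b] y]] dual_apply(1)[OF \<delta>D[OF b] y] fb[OF b] y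
          by (simp add: dual_apply(5) E.m_comm)
      qed (use fb y dual_apply(1)[OF \<delta>D y] in \<open>auto simp: dual_apply(5)\<close>)
      also have "\<dots> = ?g y"
        using lin_map_finsum[OF D KM ev B(1), of "\<lambda>b. f b \<odot>\<^bsub>?D\<^esub> \<delta> b"] fb \<delta>D by simp
      finally show "f y = ?g y" .
    qed
    then show "f \<in> N'" using g by simp
  qed
qed

lemma multilin_eq_on_words:
  assumes E: "module K E" and M: "module K M" and BE: "B \<subseteq> carrier E"
    and span: "\<And>N. submodule N K E \<Longrightarrow> B \<subseteq> N \<Longrightarrow> carrier E \<subseteq> N"
    and g: "multilin K E d M g" and h: "multilin K E d M h"
    and eq: "\<And>w. length w = d \<Longrightarrow> set w \<subseteq> B \<Longrightarrow> g w = h w"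
    and w: "w \<in> tuples E d"
  shows "g w = h w"
proof -
  \<comment> \<open>The first \<open>n\<close> entries are arbitrary and the rest lie in the
    generating set. For \<open>n = 0\<close> the tuple is a word, for \<open>n = d\<close> there is
    no restriction; the step frees the entry at \<open>n\<close>, in which both maps are
    linear.\<close>
  have "n \<le> d \<Longrightarrow> w \<in> tuples E d \<Longrightarrow> (\<And>i. n \<le> i \<Longrightarrow> i < d \<Longrightarrow> w ! i \<in> B) \<Longrightarrow> g w = h w" for n w
  proof (induction n arbitrary: w)
    case 0
    then have "length w = d" "set w \<subseteq> B" by (auto simp: tuples_def in_set_conv_nth)
    then show ?case by (rule eq)
  next
    case (Suc n)
    have lin: "lin_map K E M (\<lambda>x. k (w[n := x]))" if "multilin K E d M k" for k
      by (rule lin_mapI)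
        (use Suc.prems multilin_closed[OF that tuples_update] multilinD[OF that] in auto)
    let ?N = "{x \<in> carrier E. g (w[n := x]) = h (w[n := x])}"
    have "B \<subseteq> ?N"
    proof
      fix b assume b: "b \<in> B"
      have "g (w[n := b]) = h (w[n := b])"
      proof (rule Suc.IH)
        show "w[n := b] \<in> tuples E d" using b BE by (intro tuples_update Suc.prems) auto
        show "w[n := b] ! i \<in> B" if "n \<le> i" "i < d" for i
          using that b Suc.prems tuples_length[OF Suc.prems(2)] by (cases "i = n") auto
      qed (use Suc.prems in auto)
      then show "b \<in> ?N" using b BE by blast
    qed
    then have "carrier E \<subseteq> ?N" by (rule span[OF submodule_equalizer[OF E M lin[OF g] lin[OF h]]])
    moreover have "w ! n \<in> carrier E" using Suc.prems by (intro tuples_nth[OF Suc.prems(2)]) auto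
    ultimately show ?case by auto
  qed
  from this[of d w] w show ?thesis by auto
qed

text \<open>The inverse is the image of the rational \<open>1 / card A\<close>. Applied to the
  finite groups acting in each degree, it allows averaging over them.\<close>

lemma contains_rat_card_unit:
  assumes K: "cring K" and rat: "contains_rat K" and A: "finite A" "A \<noteq> {}"
  shows "\<exists>q\<in>carrier K. q \<otimes>\<^bsub>K\<^esub> (\<Oplus>\<^bsub>K\<^esub>a\<in>A. \<one>\<^bsub>K\<^esub>) = \<one>\<^bsub>K\<^esub>"
proof -
  interpret K: cring K by (rule K)
  obtain h where h: "h \<in> ring_hom rat_ring K" using rat by (auto simp: contains_rat_def)
  have hc: "h x \<in> carrier K" and hm: "h (x * y) = h x \<otimes>\<^bsub>K\<^esub> h y" and ha: "h (x + y) = h x \<oplus>\<^bsub>K\<^esub> h y"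
    and h1: "h 1 = \<one>\<^bsub>K\<^esub>" for x y
    using h by (auto simp: ring_hom_def rat_ring_def)
  have h0: "h 0 = \<zero>\<^bsub>K\<^esub>" using ha[of 0 0] hc[of 0] by (metis add.right_neutral K.add.r_cancel_one')
  have "(\<Oplus>\<^bsub>K\<^esub>a\<in>A. \<one>\<^bsub>K\<^esub>) = h (of_nat (card A))"
    using A(1) by induction (simp_all add: h0 h1 ha Pi_def)
  moreover have "h (1 / of_nat (card A)) \<otimes>\<^bsub>K\<^esub> h (of_nat (card A)) = \<one>\<^bsub>K\<^esub>"
    using A hm[symmetric] h1 by simp
  ultimately show ?thesis using hc by metis
qed

section \<open>The form on basis words\<close>

context omega_character
begin

context
  fixes E :: "('k, 'e, 'n) module_scheme" and B and \<delta> :: "'e \<Rightarrow> 'e \<Rightarrow> 'k"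
  assumes E: "module K E" and \<delta>: "dual_basis K E B \<delta>" and rat: "contains_rat K"
begin

interpretation E: module K E by (rule E)

lemma basis_facts:
  shows "finite B" "B \<subseteq> carrier E" "b \<in> B \<Longrightarrow> \<delta> b \<in> carrier (dual_module K E)"
    "b \<in> B \<Longrightarrow> b' \<in> B \<Longrightarrow> \<delta> b b' = (if b = b' then \<one>\<^bsub>K\<^esub> else \<zero>\<^bsub>K\<^esub>)"
  using \<delta> by (auto simp: dual_basis_def)

abbreviation (input) "words d \<equiv> {w. set w \<subseteq> B \<and> length w = d}"

lemma words_tuples:
  assumes "w \<in> words d" shows "w \<in> tuples E d" "map \<delta> w \<in> tuples (dual_module K E) d"
  using assms basis_facts by (auto simp: tuples_def)

lemma finite_words: "finite (words d)"
  by (rule finite_lists_length_eq[OF basis_facts(1)])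

lemma perm_words:
  assumes "\<sigma> permutes {1..d}" "w \<in> words d" shows "perm_tuple \<sigma> w \<in> words d"
proof -
  have "perm_tuple \<sigma> w ! s \<in> B" if "s < d" for s
    using assms(2) permutes_inv_range[OF assms(1) that] that nth_mem[of "inv' \<sigma> (Suc s) - 1" w]
    by (auto simp: perm_tuple_nth)
  then show ?thesis using assms(2) by (auto simp: in_set_conv_nth)
qed

text \<open>Each factor is a Kronecker delta comparing one letter of \<open>w\<close> with one
  letter of the permuted \<open>v\<close>, so a single disagreement annihilates the product.\<close>

lemma pairing_basis:
  assumes v: "v \<in> words d" and w: "w \<in> words d" and p: "\<sigma> permutes {1..d}"
  shows "pairing d \<sigma> v (map \<delta> w) = (if w = perm_tuple \<sigma> v then \<one>\<^bsub>K\<^esub> else \<zero>\<^bsub>K\<^esub>)"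
proof -
  have f: "(map \<delta> w ! s) (v ! (inv' \<sigma> (Suc s) - 1)) = (if w ! s = perm_tuple \<sigma> v ! s then \<one>\<^bsub>K\<^esub> else \<zero>\<^bsub>K\<^esub>)"
    if s: "s < d" for s
  proof -
    have m: "w ! s \<in> B" "perm_tuple \<sigma> v ! s \<in> B"
      using s w perm_words[OF p v] nth_mem[of s w] nth_mem[of s "perm_tuple \<sigma> v"] by auto
    have "map \<delta> w ! s = \<delta> (w ! s)" "v ! (inv' \<sigma> (Suc s) - 1) = perm_tuple \<sigma> v ! s"
      using s v w by (simp_all add: perm_tuple_nth)
    then show ?thesis using basis_facts(4)[OF m] by (simp only:)
  qed
  show ?thesis
  proof (cases "w = perm_tuple \<sigma> v")
    case True
    have "(map \<delta> w ! (t - 1)) (v ! (inv' \<sigma> t - 1)) = \<one>\<^bsub>K\<^esub>" if t: "t \<in> {1..d}" for t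
    proof -
      obtain s where s: "t = Suc s" "s < d" using t by (cases t) auto
      show ?thesis using f[OF s(2)] unfolding s(1) True[symmetric] diff_Suc_1 by (simp only: if_True refl)
    qed
    then have "pairing d \<sigma> v (map \<delta> w) = \<one>\<^bsub>K\<^esub>" unfolding pairing_def by (rule K.finprod_one_eqI)
    then show ?thesis using True by (simp only: if_True refl)
  next
    case False
    then obtain s where s: "s < d" "w ! s \<noteq> perm_tuple \<sigma> v ! s"
      using v w nth_equalityI[of w "perm_tuple \<sigma> v"] by auto
    note c = pairing_factor(3)[OF E words_tuples(1)[OF v] words_tuples(2)[OF w] p]
    have "pairing d \<sigma> v (map \<delta> w) = (map \<delta> w ! (Suc s - 1)) (v ! (inv' \<sigma> (Suc s) - 1)) \<otimes>\<^bsub>K\<^esub>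
      (\<Otimes>\<^bsub>K\<^esub>t\<in>{1..d} - {Suc s}. (map \<delta> w ! (t - 1)) (v ! (inv' \<sigma> t - 1)))"
      unfolding pairing_def by (rule K.finprod_remove) (use s c in auto)
    moreover have "(\<Otimes>\<^bsub>K\<^esub>t\<in>{1..d} - {Suc s}. (map \<delta> w ! (t - 1)) (v ! (inv' \<sigma> t - 1))) \<in> carrier K"
      by (rule K.finprod_closed) (use c in auto)
    ultimately show ?thesis using f[OF s(1)] s False by simp
  qed
qed

text \<open>Both formulas compare the variable word \<open>w\<close> with a permutation of a fixed
  \<open>v\<close>, whichever argument of the form \<open>v\<close> occupies. In this shape
  \<open>finsum_kronecker\<close> can sum over \<open>w\<close>.\<close>

lemma tuple_form_basis:
  assumes v: "v \<in> words d" and w: "w \<in> words d"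
  shows "tuple_form K W \<chi> d v (map \<delta> w) =
      (\<Oplus>\<^bsub>K\<^esub>\<sigma>\<in>W0 d. chi0 d \<sigma> \<otimes>\<^bsub>K\<^esub> (if w = perm_tuple \<sigma> v then \<one>\<^bsub>K\<^esub> else \<zero>\<^bsub>K\<^esub>))"
    and "tuple_form K W \<chi> d w (map \<delta> v) =
      (\<Oplus>\<^bsub>K\<^esub>\<sigma>\<in>W0 d. chi0 d \<sigma> \<otimes>\<^bsub>K\<^esub> (if w = perm_tuple (inv' \<sigma>) v then \<one>\<^bsub>K\<^esub> else \<zero>\<^bsub>K\<^esub>))"
proof -
  show "tuple_form K W \<chi> d v (map \<delta> w) =
      (\<Oplus>\<^bsub>K\<^esub>\<sigma>\<in>W0 d. chi0 d \<sigma> \<otimes>\<^bsub>K\<^esub> (if w = perm_tuple \<sigma> v then \<one>\<^bsub>K\<^esub> else \<zero>\<^bsub>K\<^esub>))"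
    unfolding tuple_form_W0[OF E]
    by (rule K.finsum_cong') (use pairing_basis[OF v w W0_permutes] chi0_closed in auto)
  have "v = perm_tuple \<sigma> w \<longleftrightarrow> w = perm_tuple (inv' \<sigma>) v" if "\<sigma> \<in> W0 d" for \<sigma>
  proof -
    note p = W0_permutes[OF that]
    have "perm_tuple (inv' \<sigma>) (perm_tuple \<sigma> w) = w"
      using perm_tuple_comp[OF p permutes_inv[OF p], of w] permutes_inv_o(2)[OF p] w by simp
    moreover have "perm_tuple \<sigma> (perm_tuple (inv' \<sigma>) v) = v"
      using perm_tuple_comp[OF permutes_inv[OF p] p, of v] permutes_inv_o(1)[OF p] v by simp
    ultimately show ?thesis by metis
  qed
  then show "tuple_form K W \<chi> d w (map \<delta> v) =
      (\<Oplus>\<^bsub>K\<^esub>\<sigma>\<in>W0 d. chi0 d \<sigma> \<otimes>\<^bsub>K\<^esub> (if w = perm_tuple (inv' \<sigma>) v then \<one>\<^bsub>K\<^esub> else \<zero>\<^bsub>K\<^esub>))"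
    unfolding tuple_form_W0[OF E]
    by (intro K.finsum_cong') (use pairing_basis[OF w v W0_permutes] chi0_closed in auto)
qed

text \<open>Pairing a word \<open>v\<close> with the sum of all \<open>\<phi>(w)\<close> times the
  dual word of \<open>w\<close> leaves the sum over \<open>\<sigma>\<close> of
  \<open>chi0 d \<sigma>\<close> times the value of \<open>\<phi>\<close> at the permuted
  \<open>v\<close>. That value is again \<open>chi0 d \<sigma>\<close> times the one at
  \<open>v\<close>, so each \<open>\<sigma>\<close> contributes \<open>\<phi>(v)\<close> and the
  factor \<open>q\<close> normalizes the total.\<close>

lemma form_representable:
  assumes \<phi>: "lin_map K (free_tensors K E d) (self_module K) \<phi>"
    and null: "\<And>u. u \<in> carrier (free_tensors K E d) \<Longrightarrow> chi_class K W \<chi> E d u = \<zero>\<^bsub>chi_power K W \<chi> E d\<^esub> \<Longrightarrow> \<phi> u = \<zero>\<^bsub>K\<^esub>"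
  shows "\<exists>c\<in>carrier (free_tensors K (dual_module K E) d). \<forall>u\<in>carrier (free_tensors K E d). free_form K W \<chi> d u c = \<phi> u"
proof -
  let ?F = "free_tensors K E d" and ?C = "chi_power K W \<chi> E d" and ?c = "chi_class K W \<chi> E d"
  let ?D = "dual_module K E"
  let ?FD = "free_tensors K ?D d"
  note D = dual_module_module[OF E] and KM = self_module_module[OF K.is_cring]
  note F = FT_module[OF E, of d] and FD = FT_module[OF D, of d]
  interpret F: module K ?F by (rule F)
  interpret FD: module K ?FD by (rule FD)
  interpret C: module K ?C by (rule CP_module[OF E])
  note cl = cc_lin_map[OF E, of d]
  have null': "\<phi> u = \<zero>\<^bsub>self_module K\<^esub>" if "u \<in> carrier ?F" "?c u = \<zero>\<^bsub>?C\<^esub>" for u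
    using null[OF that] by simp
  note fac = linear_factor_eq[OF E KM \<phi> null'] and ml = linear_factor_multilin[OF E KM \<phi> null']
  have gc: "gen K w \<in> carrier ?F" if "w \<in> tuples E d" for w using gen_closed[OF K.is_cring that] .
  have pc: "\<phi> (gen K w) \<in> carrier K" if "w \<in> tuples E d" for w using lin_map_closed[OF \<phi> gc[OF that]] by simp
  have eqv: "\<phi> (gen K (perm_tuple \<sigma> w)) = chi0 d \<sigma> \<otimes>\<^bsub>K\<^esub> \<phi> (gen K w)" if s: "\<sigma> \<in> W0 d" and w: "w \<in> tuples E d" for \<sigma> w
  proof -
    have "\<phi> (gen K (perm_tuple \<sigma> w)) = \<phi> (chi0 d \<sigma> \<odot>\<^bsub>?F\<^esub> gen K w)"
      using equivar_W0[OF CP_module[OF E] equivar_cc[OF E] s w lin_map_closed[OF cl gc[OF w]]]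
        lin_map_smult[OF cl] chi0_closed[OF s] gc w perm_tuple_tuples[OF W0_permutes[OF s] w]
      by (intro fac) auto
    then show ?thesis using lin_map_smult[OF \<phi> chi0_closed[OF s] gc[OF w]] by simp
  qed
  let ?N = "\<Oplus>\<^bsub>K\<^esub>\<sigma>\<in>W0 d. \<one>\<^bsub>K\<^esub>"
  obtain q where q: "q \<in> carrier K" "q \<otimes>\<^bsub>K\<^esub> ?N = \<one>\<^bsub>K\<^esub>"
    using contains_rat_card_unit[OF K.is_cring rat finite_W0] W0_nonempty by blast
  let ?X = "words d"
  define h where "h w = q \<otimes>\<^bsub>K\<^esub> \<phi> (gen K w)" for w
  have hc: "h w \<in> carrier K" if "w \<in> ?X" for w using q pc words_tuples(1)[OF that] by (simp add: h_def)
  have gd: "gen K (map \<delta> w) \<in> carrier ?FD" if "w \<in> ?X" for w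
    using gen_closed[OF K.is_cring words_tuples(2)[OF that]] .
  define c where "c = (\<Oplus>\<^bsub>?FD\<^esub>w\<in>?X. h w \<odot>\<^bsub>?FD\<^esub> gen K (map \<delta> w))"
  have c: "c \<in> carrier ?FD" unfolding c_def by (rule FD.M.finsum_closed) (use hc gd in auto)
  note b = free_form_bilin[OF E, of d]
  have key: "free_form K W \<chi> d (gen K v) c = \<phi> (gen K v)" if v: "v \<in> ?X" for v
  proof -
    note vt = words_tuples(1)[OF v]
    have sv: "perm_tuple \<sigma> v \<in> ?X" if "\<sigma> \<in> W0 d" for \<sigma> using perm_words[OF W0_permutes[OF that] v] .
    have "free_form K W \<chi> d (gen K v) c = (\<Oplus>\<^bsub>self_module K\<^esub>w\<in>?X. free_form K W \<chi> d (gen K v) (h w \<odot>\<^bsub>?FD\<^esub> gen K (map \<delta> w)))"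
      unfolding c_def by (rule lin_map_finsum[OF FD KM bilinD(2)[OF b gc[OF vt]] finite_words]) (use hc gd in auto)
    also have "\<dots> = (\<Oplus>\<^bsub>self_module K\<^esub>w\<in>?X. tuple_form K W \<chi> d v (map \<delta> w) \<odot>\<^bsub>self_module K\<^esub> h w)"
      unfolding self_module_simps
    proof (rule K.finsum_cong')
      fix w assume w: "w \<in> ?X"
      show "free_form K W \<chi> d (gen K v) (h w \<odot>\<^bsub>?FD\<^esub> gen K (map \<delta> w)) = tuple_form K W \<chi> d v (map \<delta> w) \<otimes>\<^bsub>K\<^esub> h w"
        using lin_map_smult[OF bilinD(2)[OF b gc[OF vt]] hc[OF w] gd[OF w]] free_form_gen[OF E vt words_tuples(2)[OF w]]
          tuple_form_closed[OF E vt words_tuples(2)[OF w]] hc[OF w] by (simp add: K.m_comm)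
    qed (use tuple_form_closed[OF E vt words_tuples(2)] hc in auto)
    also have "\<dots> = (\<Oplus>\<^bsub>self_module K\<^esub>w\<in>?X.
        (\<Oplus>\<^bsub>K\<^esub>\<sigma>\<in>W0 d. chi0 d \<sigma> \<otimes>\<^bsub>K\<^esub> (if w = perm_tuple \<sigma> v then \<one>\<^bsub>K\<^esub> else \<zero>\<^bsub>K\<^esub>)) \<odot>\<^bsub>self_module K\<^esub> h w)"
      unfolding self_module_simps
      by (rule K.finsum_cong') (use tuple_form_basis(1)[OF v] hc chi0_closed in \<open>auto intro!: K.m_closed K.finsum_closed\<close>)
    also have "\<dots> = (\<Oplus>\<^bsub>self_module K\<^esub>\<sigma>\<in>W0 d. chi0 d \<sigma> \<odot>\<^bsub>self_module K\<^esub> h (perm_tuple \<sigma> v))"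
      by (rule finsum_kronecker[OF KM finite_words finite_W0 sv chi0_closed]) (use hc in auto)
    also have "\<dots> = (\<Oplus>\<^bsub>self_module K\<^esub>\<sigma>\<in>W0 d. h v)"
      unfolding self_module_simps
    proof (rule K.finsum_cong')
      fix \<sigma> assume s: "\<sigma> \<in> W0 d"
      have "chi0 d \<sigma> \<otimes>\<^bsub>K\<^esub> (q \<otimes>\<^bsub>K\<^esub> (chi0 d \<sigma> \<otimes>\<^bsub>K\<^esub> \<phi> (gen K v))) = (chi0 d \<sigma> \<otimes>\<^bsub>K\<^esub> chi0 d \<sigma>) \<otimes>\<^bsub>K\<^esub> (q \<otimes>\<^bsub>K\<^esub> \<phi> (gen K v))"
        using chi0_closed[OF s] q(1) pc[OF vt] by (simp add: K.m_ac)
      then show "chi0 d \<sigma> \<otimes>\<^bsub>K\<^esub> h (perm_tuple \<sigma> v) = h v"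
        using eqv[OF s vt] chi0_square[OF s] q(1) pc[OF vt] by (simp add: h_def)
    qed (use hc v in auto)
    also have "\<dots> = ?N \<otimes>\<^bsub>K\<^esub> h v"
      using finsum_const_module[OF KM finite_W0, of "h v"] hc[OF v] by simp
    also have "\<dots> = \<phi> (gen K v)"
    proof -
      have N: "?N \<in> carrier K" by simp
      have "?N \<otimes>\<^bsub>K\<^esub> h v = (q \<otimes>\<^bsub>K\<^esub> ?N) \<otimes>\<^bsub>K\<^esub> \<phi> (gen K v)"
        using N q(1) pc[OF vt] unfolding h_def by (simp add: K.m_ac del: K.finsum_closed)
      then show ?thesis using q(2) pc[OF vt] by simp
    qed
    finally show ?thesis .
  qed
  \<comment> \<open>Passage from basis words to all tuples: both sides vanish on the kernel of the
    class map, hence are multilinear by \<open>linear_factor\<close>, and multilinear maps are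
    determined by their values on words.\<close>
  have "free_form K W \<chi> d (gen K w) c = \<phi> (gen K w)" if w: "w \<in> tuples E d" for w
  proof (rule multilin_eq_on_words[OF E KM basis_facts(2) dual_basis_span(1)[OF E \<delta>] _ ml _ w])
    show "multilin K E d (self_module K) (\<lambda>w. free_form K W \<chi> d (gen K w) c)"
      by (rule linear_factor_multilin[OF E KM bilinD(1)[OF b c]]) (use free_form_null(1)[OF E _ c] in simp)
  qed (use key in auto)
  then have "free_form K W \<chi> d u c = \<phi> u" if "u \<in> carrier ?F" for u
    by (rule free_lin_map_eq[OF K.is_cring KM bilinD(1)[OF b c] \<phi> _ that])
  then show ?thesis using c by blast
qed

text \<open>The class of \<open>v\<close> multiplied by the group order is recovered from the values
  of the form at \<open>v\<close>. If all of these vanish, the class is zero because the group order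
  is invertible.\<close>

lemma form_nondegenerate:
  assumes v: "v \<in> carrier (free_tensors K (dual_module K E) d)"
    and null: "\<And>u. u \<in> carrier (free_tensors K E d) \<Longrightarrow> free_form K W \<chi> d u v = \<zero>\<^bsub>K\<^esub>"
  shows "chi_class K W \<chi> (dual_module K E) d v = \<zero>\<^bsub>chi_power K W \<chi> (dual_module K E) d\<^esub>"
proof -
  let ?D = "dual_module K E"
  let ?FD = "free_tensors K ?D d" and ?C = "chi_power K W \<chi> ?D d" and ?c = "chi_class K W \<chi> ?D d"
  note D = dual_module_module[OF E] and KM = self_module_module[OF K.is_cring]
  note FD = FT_module[OF D, of d] and C = CP_module[OF D, of d]
  interpret FD: module K ?FD by (rule FD)
  interpret C: module K ?C by (rule C)
  note cl = cc_lin_map[OF D, of d]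
  note b = free_form_bilin[OF E, of d]
  have gc: "gen K w \<in> carrier (free_tensors K E d)" if "w \<in> tuples E d" for w using gen_closed[OF K.is_cring that] .
  let ?N = "\<Oplus>\<^bsub>K\<^esub>\<sigma>\<in>W0 d. \<one>\<^bsub>K\<^esub>"
  have N: "?N \<in> carrier K" by simp
  let ?X = "words d"
  have m: "?c (gen K (map \<delta> w)) \<in> carrier ?C" if "w \<in> ?X" for w
    using lin_map_closed[OF cl gen_closed[OF K.is_cring words_tuples(2)[OF that]]] .
  \<comment> \<open>The reconstruction from the values of the form, linear in \<open>v\<close>; it
    takes values in the quotient, where the words of an orbit have proportional classes.\<close>
  let ?R = "\<lambda>v. \<Oplus>\<^bsub>?C\<^esub>w\<in>?X. free_form K W \<chi> d (gen K w) v \<odot>\<^bsub>?C\<^esub> ?c (gen K (map \<delta> w))"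
  have smult_lin: "lin_map K (self_module K) ?C (\<lambda>k. k \<odot>\<^bsub>?C\<^esub> x)" if "x \<in> carrier ?C" for x
    by (rule lin_mapI) (use that in \<open>auto simp: C.smult_l_distr C.smult_assoc1\<close>)
  have t: "lin_map K ?FD ?C (\<lambda>v. free_form K W \<chi> d (gen K w) v \<odot>\<^bsub>?C\<^esub> ?c (gen K (map \<delta> w)))" if "w \<in> ?X" for w
    by (rule lin_map_comp[OF bilinD(2)[OF b gc[OF words_tuples(1)[OF that]]] smult_lin[OF m[OF that]]])
  have R_lin: "lin_map K ?FD ?C ?R" by (rule lin_map_sum[OF C finite_words t])
  have key: "?N \<odot>\<^bsub>?C\<^esub> ?c (gen K (map \<delta> v)) = ?R (gen K (map \<delta> v))" if v: "v \<in> ?X" for v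
  proof -
    note vt = words_tuples(2)[OF v]
    have sv: "perm_tuple (inv' \<sigma>) v \<in> ?X" if "\<sigma> \<in> W0 d" for \<sigma> using perm_words[OF permutes_inv[OF W0_permutes[OF that]] v] .
    have "?R (gen K (map \<delta> v)) = (\<Oplus>\<^bsub>?C\<^esub>w\<in>?X.
        (\<Oplus>\<^bsub>K\<^esub>\<sigma>\<in>W0 d. chi0 d \<sigma> \<otimes>\<^bsub>K\<^esub> (if w = perm_tuple (inv' \<sigma>) v then \<one>\<^bsub>K\<^esub> else \<zero>\<^bsub>K\<^esub>)) \<odot>\<^bsub>?C\<^esub> ?c (gen K (map \<delta> w)))"
      by (rule C.M.finsum_cong')
        (use tuple_form_basis(2)[OF v] free_form_gen[OF E words_tuples(1) vt] m chi0_closed in \<open>auto intro!: C.smult_closed K.finsum_closed\<close>)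
    also have "\<dots> = (\<Oplus>\<^bsub>?C\<^esub>\<sigma>\<in>W0 d. chi0 d \<sigma> \<odot>\<^bsub>?C\<^esub> ?c (gen K (map \<delta> (perm_tuple (inv' \<sigma>) v))))"
      by (rule finsum_kronecker[OF C finite_words finite_W0 sv chi0_closed]) (use m in auto)
    also have "\<dots> = (\<Oplus>\<^bsub>?C\<^esub>\<sigma>\<in>W0 d. ?c (gen K (map \<delta> v)))"
    proof (rule C.M.finsum_cong')
      fix \<sigma> assume s: "\<sigma> \<in> W0 d"
      note p = permutes_inv[OF W0_permutes[OF s]]
      have "?c (gen K (map \<delta> (perm_tuple (inv' \<sigma>) v))) = chi0 d \<sigma> \<odot>\<^bsub>?C\<^esub> ?c (gen K (map \<delta> v))"
        using equivar_W0[OF C equivar_cc[OF D] W0_inv[OF s] vt m[OF v]] perm_tuple_map[OF p, of v \<delta>] v chi0_inv[OF s] by simp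
      then show "chi0 d \<sigma> \<odot>\<^bsub>?C\<^esub> ?c (gen K (map \<delta> (perm_tuple (inv' \<sigma>) v))) = ?c (gen K (map \<delta> v))"
        using m[OF v] chi0_closed[OF s] chi0_square[OF s] by (simp add: C.smult_assoc1[symmetric])
    qed (use m[OF v] in auto)
    also have "\<dots> = ?N \<odot>\<^bsub>?C\<^esub> ?c (gen K (map \<delta> v))"
      by (rule finsum_const_module[OF C finite_W0 m[OF v]])
    finally show ?thesis ..
  qed
  have "?N \<odot>\<^bsub>?C\<^esub> ?c (gen K w') = ?R (gen K w')" if w': "w' \<in> tuples ?D d" for w'
  proof (rule multilin_eq_on_words[OF D C _ dual_basis_span(2)[OF E \<delta>] _ _ _ w'])
    show "\<delta> ` B \<subseteq> carrier ?D" using basis_facts(3) by blast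
    have idl: "lin_map K ?C ?C (\<lambda>x. x)" by (auto intro: lin_mapI)
    show "multilin K ?D d ?C (\<lambda>w'. ?N \<odot>\<^bsub>?C\<^esub> ?c (gen K w'))"
      by (rule multilin_lin_map[OF multilin_cc[OF D] lin_map_scale[OF C idl N]])
    show "multilin K ?D d ?C (\<lambda>w'. ?R (gen K w'))"
    proof (rule multilin_finsum[OF C D finite_words])
      fix w assume w: "w \<in> ?X"
      show "multilin K ?D d ?C (\<lambda>w'. free_form K W \<chi> d (gen K w) (gen K w') \<odot>\<^bsub>?C\<^esub> ?c (gen K (map \<delta> w)))"
        by (rule multilin_lin_map[OF multilin_cong[OF D tuple_form_multilin(2)[OF E words_tuples(1)[OF w]]] smult_lin[OF m[OF w]]])
          (rule free_form_gen[OF E words_tuples(1)[OF w]])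
    qed
    fix w' :: "('e \<Rightarrow> 'k) list" assume w': "length w' = d" "set w' \<subseteq> \<delta> ` B"
    \<comment> \<open>The multilinear comparison is over words in the functionals
      \<open>\<delta> b\<close>; any word of basis vectors mapping onto \<open>w'\<close> makes
      \<open>key\<close> applicable.\<close>
    let ?v = "map (inv_into B \<delta>) w'"
    have "map \<delta> ?v = w'"
      unfolding map_map by (rule map_idI) (use w'(2) in \<open>auto simp: f_inv_into_f subset_iff\<close>)
    moreover have "?v \<in> ?X" using w' by (auto intro!: inv_into_into)
    ultimately show "?N \<odot>\<^bsub>?C\<^esub> ?c (gen K w') = ?R (gen K w')" using key[of ?v] by simp
  qed
  then have "?N \<odot>\<^bsub>?C\<^esub> ?c v = ?R v"
    by (rule free_lin_map_eq[OF K.is_cring C lin_map_scale[OF C cl N] R_lin _ v])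
  also have "\<dots> = (\<Oplus>\<^bsub>?C\<^esub>w\<in>?X. \<zero>\<^bsub>?C\<^esub>)"
  proof (rule C.M.finsum_cong')
    fix w assume w: "w \<in> ?X"
    show "free_form K W \<chi> d (gen K w) v \<odot>\<^bsub>?C\<^esub> ?c (gen K (map \<delta> w)) = \<zero>\<^bsub>?C\<^esub>"
      using null[OF gc[OF words_tuples(1)[OF w]]] C.smult_l_null[OF m[OF w]] by simp
  qed simp_all
  finally have z: "?N \<odot>\<^bsub>?C\<^esub> ?c v = \<zero>\<^bsub>?C\<^esub>" by simp
  obtain q where q: "q \<in> carrier K" "q \<otimes>\<^bsub>K\<^esub> ?N = \<one>\<^bsub>K\<^esub>"
    using contains_rat_card_unit[OF K.is_cring rat finite_W0] W0_nonempty by blast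
  have "?c v = (q \<otimes>\<^bsub>K\<^esub> ?N) \<odot>\<^bsub>?C\<^esub> ?c v" using q(2) lin_map_closed[OF cl v] by simp
  also have "\<dots> = \<zero>\<^bsub>?C\<^esub>" using z q(1) N lin_map_closed[OF cl v] by (simp add: C.smult_assoc1)
  finally show ?thesis .
qed

end

end

section \<open>The graded algebra and its action\<close>

lemma lin_map_descend:
  assumes M: "module K M" and g: "lin_map K M L g" and p: "lin_map K M M' p" "carrier M' = p ` carrier M"
    and h: "\<And>u. u \<in> carrier M \<Longrightarrow> h (p u) = g u"
  shows "lin_map K M' L h"
proof (rule lin_mapI)
  interpret M: module K M by (rule M)
  fix a assume "a \<in> carrier M'"
  then obtain u where u: "u \<in> carrier M" "a = p u" using p(2) by blast
  show "h a \<in> carrier L" using u h lin_map_closed[OF g] by simp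
  show "h (k \<odot>\<^bsub>M'\<^esub> a) = k \<odot>\<^bsub>L\<^esub> h a" if k: "k \<in> carrier K" for k
    using h[OF M.smult_closed[OF k u(1)]] h[OF u(1)] lin_map_smult[OF p(1) k u(1)] lin_map_smult[OF g k u(1)] u(2)
    by simp
  fix b assume "b \<in> carrier M'"
  then obtain v where v: "v \<in> carrier M" "b = p v" using p(2) by blast
  show "h (a \<oplus>\<^bsub>M'\<^esub> b) = h a \<oplus>\<^bsub>L\<^esub> h b"
    using h[OF M.M.a_closed[OF u(1) v(1)]] h[OF u(1)] h[OF v(1)]
      lin_map_add[OF p(1) u(1) v(1)] lin_map_add[OF g u(1) v(1)] u(2) v(2) by simp
qed

lemma bilin_descend:
  assumes M: "module K M" and N: "module K N" and b: "bilin K M N L b" and f: "lin_map K L L' f"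
    and p: "lin_map K M M' p" "carrier M' = p ` carrier M"
    and q: "lin_map K N N' q" "carrier N' = q ` carrier N"
    and c: "\<And>u v. u \<in> carrier M \<Longrightarrow> v \<in> carrier N \<Longrightarrow> c (p u) (q v) = f (b u v)"
  shows "bilin K M' N' L' c"
  unfolding bilin_def p(2) q(2)
proof (safe)
  note fb = bilin_comp[OF b f]
  show "lin_map K M' L' (\<lambda>a. c a (q v))" if "v \<in> carrier N" for v
    by (rule lin_map_descend[OF M bilinD(1)[OF fb that] p]) (rule c[OF _ that])
  show "lin_map K N' L' (c (p u))" if "u \<in> carrier M" for u
    by (rule lin_map_descend[OF N bilinD(2)[OF fb that] q]) (rule c[OF that])
qed

lemma bilin_zero:
  assumes "module K M" "module K N" "module K L" "bilin K M N L b"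
  shows "v \<in> carrier N \<Longrightarrow> b \<zero>\<^bsub>M\<^esub> v = \<zero>\<^bsub>L\<^esub>" "u \<in> carrier M \<Longrightarrow> b u \<zero>\<^bsub>N\<^esub> = \<zero>\<^bsub>L\<^esub>"
  using lin_map_zero[OF assms(1,3) bilinD(1)[OF assms(4)]] lin_map_zero[OF assms(2,3) bilinD(2)[OF assms(4)]] by auto

lemma (in abelian_monoid) finsum_swap:
  assumes "finite A" "finite B" "\<And>a b. a \<in> A \<Longrightarrow> b \<in> B \<Longrightarrow> f a b \<in> carrier G"
  shows "(\<Oplus>a\<in>A. \<Oplus>b\<in>B. f a b) = (\<Oplus>b\<in>B. \<Oplus>a\<in>A. f a b)"
  using assms(1,3)
proof (induction A rule: finite_induct)
  case empty
  then show ?case by simp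
next
  case (insert a A)
  have "(\<Oplus>b\<in>B. \<Oplus>a'\<in>insert a A. f a' b) = (\<Oplus>b\<in>B. f a b \<oplus> (\<Oplus>a'\<in>A. f a' b))"
    by (rule finsum_cong') (use insert in \<open>auto intro!: a_closed finsum_closed finsum_insert\<close>)
  also have "\<dots> = (\<Oplus>b\<in>B. f a b) \<oplus> (\<Oplus>b\<in>B. \<Oplus>a'\<in>A. f a' b)"
    by (rule finsum_addf) (use insert in \<open>auto intro!: finsum_closed\<close>)
  also have "\<dots> = (\<Oplus>b\<in>B. f a b) \<oplus> (\<Oplus>a'\<in>A. \<Oplus>b\<in>B. f a' b)"
    using insert by simp
  also have "\<dots> = (\<Oplus>a'\<in>insert a A. \<Oplus>b\<in>B. f a' b)"
    by (rule finsum_insert[symmetric]) (use insert in \<open>auto intro!: finsum_closed\<close>)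
  finally show ?case ..
qed

text \<open>The pairs with \<open>i + j \<le> n\<close>, summed along diagonals or along rows. This
  is the rearrangement behind associativity of the graded product.\<close>

lemma (in abelian_monoid) finsum_triangle:
  fixes f :: "nat \<Rightarrow> nat \<Rightarrow> 'a"
  assumes "\<And>i j. i + j \<le> n \<Longrightarrow> f i j \<in> carrier G"
  shows "(\<Oplus>d\<in>{..n}. \<Oplus>i\<in>{..d}. f i (d - i)) = (\<Oplus>i\<in>{..n}. \<Oplus>j\<in>{..n - i}. f i j)"
  using assms
proof (induction n)
  case 0
  then show ?case by simp
next
  case (Suc n)
  let ?g = "\<lambda>i. \<Oplus>j\<in>{..n - i}. f i j"
  let ?h = "\<lambda>i. f i (Suc n - i)"
  \<comment> \<open>In the induction step, \<open>?h\<close> runs over the new diagonal, whose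
    \<open>i\<close>-th term completes row \<open>i\<close>; the row \<open>Suc n\<close> consists
    of a single new term.\<close>
  have g: "?g \<in> {..n} \<rightarrow> carrier G" using Suc.prems by (intro Pi_I finsum_closed) auto
  have h: "?h \<in> {..Suc n} \<rightarrow> carrier G" using Suc.prems by auto
  have gn: "(\<Oplus>i\<in>{..n}. ?g i) \<in> carrier G" using g by (rule finsum_closed)
  have hn: "(\<Oplus>i\<in>{..n}. ?h i) \<in> carrier G" using h by (intro finsum_closed) auto
  have "(\<Oplus>d\<in>{..Suc n}. \<Oplus>i\<in>{..d}. f i (d - i)) = (\<Oplus>i\<in>{..Suc n}. ?h i) \<oplus> (\<Oplus>d\<in>{..n}. \<Oplus>i\<in>{..d}. f i (d - i))"
    by (rule finsum_Suc) (use Suc.prems in \<open>auto intro!: finsum_closed\<close>)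
  also have "\<dots> = (\<Oplus>i\<in>{..Suc n}. ?h i) \<oplus> (\<Oplus>i\<in>{..n}. ?g i)"
    using Suc.IH Suc.prems by simp
  also have "(\<Oplus>i\<in>{..Suc n}. ?h i) = f (Suc n) 0 \<oplus> (\<Oplus>i\<in>{..n}. ?h i)"
    using finsum_Suc[OF h] by simp
  also have "f (Suc n) 0 \<oplus> (\<Oplus>i\<in>{..n}. ?h i) \<oplus> (\<Oplus>i\<in>{..n}. ?g i) = f (Suc n) 0 \<oplus> ((\<Oplus>i\<in>{..n}. ?h i) \<oplus> (\<Oplus>i\<in>{..n}. ?g i))"
    using gn hn Suc.prems[of "Suc n" 0] by (simp add: a_assoc)
  also have "(\<Oplus>i\<in>{..n}. ?h i) \<oplus> (\<Oplus>i\<in>{..n}. ?g i) = (\<Oplus>i\<in>{..n}. ?h i \<oplus> ?g i)"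
    by (rule finsum_addf[symmetric]) (use h g in auto)
  also have "\<dots> = (\<Oplus>i\<in>{..n}. \<Oplus>j\<in>{..Suc n - i}. f i j)"
  proof (rule finsum_cong')
    fix i assume i: "i \<in> {..n}"
    have "(\<Oplus>j\<in>{..Suc (n - i)}. f i j) = f i (Suc (n - i)) \<oplus> ?g i"
      by (rule finsum_Suc) (use i Suc.prems in auto)
    then show "?h i \<oplus> ?g i = (\<Oplus>j\<in>{..Suc n - i}. f i j)" using i by (simp add: Suc_diff_le)
  qed (use Suc.prems in \<open>auto intro!: finsum_closed\<close>)
  also have "f (Suc n) 0 \<oplus> (\<Oplus>i\<in>{..n}. \<Oplus>j\<in>{..Suc n - i}. f i j) = (\<Oplus>i\<in>{..Suc n}. \<Oplus>j\<in>{..Suc n - i}. f i j)"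
    using finsum_Suc[of "\<lambda>i. \<Oplus>j\<in>{..Suc n - i}. f i j" n] Suc.prems by (simp add: finsum_closed Pi_def)
  finally show ?case .
qed

text \<open>Transposing right multiplication gives a left action: multiplying \<open>x\<close> on
  the right by \<open>a \<otimes> b\<close> is multiplying by \<open>a\<close> and then by
  \<open>b\<close>, and moving first \<open>b\<close> and then \<open>a\<close> across the form lets
  \<open>b\<close> act first. Additivity in \<open>a\<close> is distributivity of the product, and
  \<open>inj\<close> turns equality under the form into equality.\<close>

lemma left_unital_module_adjoint:
  fixes R (structure) and M (structure) and act
  assumes R: "ring R" and M: "abelian_group M" and K: "abelian_monoid K"
    and \<beta>: "\<And>x m. x \<in> carrier R \<Longrightarrow> m \<in> carrier M \<Longrightarrow> \<beta> x m \<in> carrier K"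
    and \<beta>_l: "\<And>x y m. x \<in> carrier R \<Longrightarrow> y \<in> carrier R \<Longrightarrow> m \<in> carrier M \<Longrightarrow> \<beta> (x \<oplus> y) m = \<beta> x m \<oplus>\<^bsub>K\<^esub> \<beta> y m"
    and \<beta>_r: "\<And>x m n. x \<in> carrier R \<Longrightarrow> m \<in> carrier M \<Longrightarrow> n \<in> carrier M \<Longrightarrow> \<beta> x (m \<oplus>\<^bsub>M\<^esub> n) = \<beta> x m \<oplus>\<^bsub>K\<^esub> \<beta> x n"
    and inj: "\<And>m n. m \<in> carrier M \<Longrightarrow> n \<in> carrier M \<Longrightarrow> (\<And>x. x \<in> carrier R \<Longrightarrow> \<beta> x m = \<beta> x n) \<Longrightarrow> m = n"
    and adj: "\<And>a m. a \<in> carrier R \<Longrightarrow> m \<in> carrier M \<Longrightarrow> \<exists>c\<in>carrier M. \<forall>x\<in>carrier R. \<beta> (x \<otimes> a) m = \<beta> x c"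
    and act: "\<And>a m. act a m = (THE c. c \<in> carrier M \<and> (\<forall>x\<in>carrier R. \<beta> (x \<otimes> a) m = \<beta> x c))"
  shows "left_unital_module R M act"
proof -
  interpret R: ring R by (rule R)
  interpret M: abelian_group M by (rule M)
  have spec: "act a m \<in> carrier M" "\<And>x. x \<in> carrier R \<Longrightarrow> \<beta> (x \<otimes> a) m = \<beta> x (act a m)"
    if am: "a \<in> carrier R" "m \<in> carrier M" for a m
  proof -
    have "\<exists>!c. c \<in> carrier M \<and> (\<forall>x\<in>carrier R. \<beta> (x \<otimes> a) m = \<beta> x c)"
    proof (rule ex_ex1I)
      show "\<exists>c. c \<in> carrier M \<and> (\<forall>x\<in>carrier R. \<beta> (x \<otimes> a) m = \<beta> x c)" using adj[OF am] by blast
      fix c c' assume "c \<in> carrier M \<and> (\<forall>x\<in>carrier R. \<beta> (x \<otimes> a) m = \<beta> x c)"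
        "c' \<in> carrier M \<and> (\<forall>x\<in>carrier R. \<beta> (x \<otimes> a) m = \<beta> x c')"
      then show "c = c'" by (intro inj) auto
    qed
    from theI'[OF this] show "act a m \<in> carrier M" "\<And>x. x \<in> carrier R \<Longrightarrow> \<beta> (x \<otimes> a) m = \<beta> x (act a m)"
      unfolding act[symmetric] by auto
  qed
  note s = spec(2)[symmetric]
  show ?thesis
  proof (intro left_unital_module.intro left_unital_module_axioms.intro R M spec(1); assumption?)
    fix a b m assume a: "a \<in> carrier R" "b \<in> carrier R" "m \<in> carrier M"
    show "act (a \<oplus> b) m = act a m \<oplus>\<^bsub>M\<^esub> act b m"
      by (rule inj) (use a in \<open>simp_all add: spec(1) s \<beta>_r \<beta>_l R.r_distr\<close>)
    show "act (a \<otimes> b) m = act a (act b m)"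
      by (rule inj) (use a in \<open>simp_all add: spec(1) s R.m_assoc[symmetric]\<close>)
  next
    fix a m n assume a: "a \<in> carrier R" "m \<in> carrier M" "n \<in> carrier M"
    show "act a (m \<oplus>\<^bsub>M\<^esub> n) = act a m \<oplus>\<^bsub>M\<^esub> act a n"
      by (rule inj) (use a in \<open>simp_all add: spec(1) s \<beta>_r\<close>)
  next
    fix m assume m: "m \<in> carrier M"
    show "act \<one> m = m"
      by (rule inj) (use m in \<open>simp_all add: spec(1) s\<close>)
  qed
qed

section \<open>The graded algebra\<close>

context omega_character
begin

abbreviation (input) "cpow \<equiv> chi_power K W \<chi>"
abbreviation (input) "calg \<equiv> chi_algebra K W \<chi>"
abbreviation (input) "cmul \<equiv> chi_mult K W \<chi>"
abbreviation (input) "cform \<equiv> chi_power_form K W \<chi>"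

context
  fixes E :: "('k, 'e, 'n) module_scheme"
  assumes E: "module K E"
begin


lemma chi_mult_bilin: "bilin K (cpow E d) (cpow E e) (cpow E (d + e)) (cmul E d e)"
  by (rule bilin_descend[OF FT_module[OF E] FT_module[OF E] conc_bilin[OF K.is_cring E] cc_lin_map[OF E]
      cc_lin_map[OF E] CP_carrier[OF E] cc_lin_map[OF E] CP_carrier[OF E]])
    (rule chi_mult_class[OF E])

lemma chi_mult_assoc:
  assumes "a \<in> carrier (cpow E d)" "b \<in> carrier (cpow E e)" "c \<in> carrier (cpow E f)"
  shows "cmul E (d + e) f (cmul E d e a b) c = cmul E d (e + f) a (cmul E e f b c)"
proof -
  obtain u v t where "u \<in> carrier (free_tensors K E d)" "v \<in> carrier (free_tensors K E e)" "t \<in> carrier (free_tensors K E f)"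
    "a = chi_class K W \<chi> E d u" "b = chi_class K W \<chi> E e v" "c = chi_class K W \<chi> E f t"
    using assms unfolding CP_carrier[OF E] by blast
  then show ?thesis
    by (simp add: chi_mult_class[OF E] conc_closed[OF K.is_cring E] conc_assoc[OF K.is_cring E] add.assoc)
qed

lemma chi_one_class: "chi_one K W \<chi> E = chi_class K W \<chi> E 0 (gen K [])"
  by (simp add: chi_one_def chi_class_def tensor_class_def)

lemma gen_Nil: "gen K [] \<in> carrier (free_tensors K E 0)"
  by (rule gen_closed[OF K.is_cring]) (simp add: tuples_def)

lemma chi_one_closed: "chi_one K W \<chi> E \<in> carrier (cpow E 0)"
  unfolding chi_one_class by (rule lin_map_closed[OF cc_lin_map[OF E] gen_Nil])

lemma chi_mult_one:
  assumes "a \<in> carrier (cpow E d)"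
  shows "cmul E 0 d (chi_one K W \<chi> E) a = a" "cmul E d 0 a (chi_one K W \<chi> E) = a"
proof -
  obtain u where u: "u \<in> carrier (free_tensors K E d)" "a = chi_class K W \<chi> E d u"
    using assms unfolding CP_carrier[OF E] by blast
  then show "cmul E 0 d (chi_one K W \<chi> E) a = a" "cmul E d 0 a (chi_one K W \<chi> E) = a"
    using chi_mult_class[OF E gen_Nil u(1)] chi_mult_class[OF E u(1) gen_Nil]
    by (simp_all add: chi_one_class conc_nil[OF K.is_cring E u(1)])
qed

text \<open>Finite support is replaced by a bound on the degrees, since bounds combine easily: by
  their maximum for sums, by their sum for products.\<close>

lemma algebra_carrier_iff:
  "a \<in> carrier (calg E) \<longleftrightarrow> (\<forall>d. a d \<in> carrier (cpow E d)) \<and> (\<exists>N. \<forall>d>N. a d = \<zero>\<^bsub>cpow E d\<^esub>)"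
  unfolding chi_algebra_def finite_nat_set_iff_bounded_le by (auto simp: not_le[symmetric])

lemma algebra_carrierD: "a \<in> carrier (calg E) \<Longrightarrow> a d \<in> carrier (cpow E d)"
  by (simp add: algebra_carrier_iff)

lemma algebra_carrierI:
  assumes "\<And>d. a d \<in> carrier (cpow E d)" "\<And>d. d > N \<Longrightarrow> a d = \<zero>\<^bsub>cpow E d\<^esub>"
  shows "a \<in> carrier (calg E)"
  using assms by (auto simp: algebra_carrier_iff)

lemma algebra_simps':
  "(a \<oplus>\<^bsub>calg E\<^esub> b) d = a d \<oplus>\<^bsub>cpow E d\<^esub> b d" "\<zero>\<^bsub>calg E\<^esub> d = \<zero>\<^bsub>cpow E d\<^esub>"
  "(a \<otimes>\<^bsub>calg E\<^esub> b) n = (\<Oplus>\<^bsub>cpow E n\<^esub>d\<in>{..n}. cmul E d (n - d) (a d) (b (n - d)))"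
  "\<one>\<^bsub>calg E\<^esub> d = (if d = 0 then chi_one K W \<chi> E else \<zero>\<^bsub>cpow E d\<^esub>)"
  by (simp_all add: chi_algebra_def)

lemma algebra_abelian_group: "abelian_group (calg E)"
proof -
  have P: "module K (cpow E d)" for d by (rule CP_module[OF E])
  interpret P: module K "cpow E d" for d by (rule P)
  have add: "a \<oplus>\<^bsub>calg E\<^esub> b \<in> carrier (calg E)" if ab: "a \<in> carrier (calg E)" "b \<in> carrier (calg E)" for a b
  proof -
    obtain N N' where "\<forall>d>N. a d = \<zero>\<^bsub>cpow E d\<^esub>" "\<forall>d>N'. b d = \<zero>\<^bsub>cpow E d\<^esub>"
      using ab by (auto simp: algebra_carrier_iff)
    then show ?thesis
      by (intro algebra_carrierI[of _ "max N N'"]) (use ab in \<open>simp_all add: algebra_simps' algebra_carrierD\<close>)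
  qed
  have zero: "\<zero>\<^bsub>calg E\<^esub> \<in> carrier (calg E)" by (rule algebra_carrierI[of _ 0]) (simp_all add: algebra_simps')
  have neg: "\<exists>b\<in>carrier (calg E). b \<oplus>\<^bsub>calg E\<^esub> a = \<zero>\<^bsub>calg E\<^esub>" if a: "a \<in> carrier (calg E)" for a
  proof (rule bexI[of _ "\<lambda>d. \<ominus>\<^bsub>cpow E d\<^esub> a d"])
    obtain N where N: "\<forall>d>N. a d = \<zero>\<^bsub>cpow E d\<^esub>" using a by (auto simp: algebra_carrier_iff)
    have "\<ominus>\<^bsub>cpow E d\<^esub> \<zero>\<^bsub>cpow E d\<^esub> = \<zero>\<^bsub>cpow E d\<^esub>" for d by (rule P.M.minus_equality) auto
    then show "(\<lambda>d. \<ominus>\<^bsub>cpow E d\<^esub> a d) \<in> carrier (calg E)"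
      by (intro algebra_carrierI[of _ N]) (use a N in \<open>simp_all add: algebra_carrierD\<close>)
    show "(\<lambda>d. \<ominus>\<^bsub>cpow E d\<^esub> a d) \<oplus>\<^bsub>calg E\<^esub> a = \<zero>\<^bsub>calg E\<^esub>"
      by (rule ext) (simp add: algebra_simps' P.M.l_neg algebra_carrierD[OF a])
  qed
  show ?thesis
  proof (rule abelian_groupI)
    fix a b c assume abc: "a \<in> carrier (calg E)" "b \<in> carrier (calg E)" "c \<in> carrier (calg E)"
    show "a \<oplus>\<^bsub>calg E\<^esub> b \<oplus>\<^bsub>calg E\<^esub> c = a \<oplus>\<^bsub>calg E\<^esub> (b \<oplus>\<^bsub>calg E\<^esub> c)"
      by (rule ext) (simp add: algebra_simps' P.M.a_assoc abc[THEN algebra_carrierD])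
  next
    fix a b assume ab: "a \<in> carrier (calg E)" "b \<in> carrier (calg E)"
    show "a \<oplus>\<^bsub>calg E\<^esub> b = b \<oplus>\<^bsub>calg E\<^esub> a"
      by (rule ext) (simp add: algebra_simps' P.M.a_comm ab[THEN algebra_carrierD])
  next
    fix a assume a: "a \<in> carrier (calg E)"
    show "\<zero>\<^bsub>calg E\<^esub> \<oplus>\<^bsub>calg E\<^esub> a = a"
      by (rule ext) (simp add: algebra_simps' algebra_carrierD[OF a])
  qed (use add zero neg in auto)
qed

lemma mult_closed:
  assumes "a \<in> carrier (cpow E d)" "b \<in> carrier (cpow E (n - d))" "d \<le> n"
  shows "cmul E d (n - d) a b \<in> carrier (cpow E n)"
  using bilin_closed[OF chi_mult_bilin assms(1,2)] assms(3) by simp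

lemma mult_lin_map:
  assumes "d \<le> n"
  shows "b \<in> carrier (cpow E (n - d)) \<Longrightarrow> lin_map K (cpow E d) (cpow E n) (\<lambda>a. cmul E d (n - d) a b)"
    and "a \<in> carrier (cpow E d) \<Longrightarrow> lin_map K (cpow E (n - d)) (cpow E n) (cmul E d (n - d) a)"
  using bilinD[OF chi_mult_bilin[of d "n - d"]] assms by auto

lemma algebra_ring: "ring (calg E)"
proof -
  have P: "module K (cpow E d)" for d by (rule CP_module[OF E])
  interpret P: module K "cpow E d" for d by (rule P)
  interpret A: abelian_group "calg E" by (rule algebra_abelian_group)
  note c = algebra_carrierD
  have mc: "cmul E d (n - d) (a d) (b (n - d)) \<in> carrier (cpow E n)"
    if "a \<in> carrier (calg E)" "b \<in> carrier (calg E)" "d \<le> n" for a b d n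
    using mult_closed c that by blast
  have closed: "a \<otimes>\<^bsub>calg E\<^esub> b \<in> carrier (calg E)" if ab: "a \<in> carrier (calg E)" "b \<in> carrier (calg E)" for a b
  proof -
    obtain N N' where N: "\<forall>d>N. a d = \<zero>\<^bsub>cpow E d\<^esub>" "\<forall>d>N'. b d = \<zero>\<^bsub>cpow E d\<^esub>"
      using ab by (auto simp: algebra_carrier_iff)
    show ?thesis
    proof (rule algebra_carrierI[of _ "N + N'"])
      show "(a \<otimes>\<^bsub>calg E\<^esub> b) d \<in> carrier (cpow E d)" for d
        unfolding algebra_simps' using mc[OF ab] by (intro P.M.finsum_closed) auto
      fix n assume n: "n > N + N'"
      \<comment> \<open>Beyond degree \<open>N + N'\<close>, one of the two factors has a degree
        past its own bound.\<close>
      have "cmul E d (n - d) (a d) (b (n - d)) = \<zero>\<^bsub>cpow E n\<^esub>" if d: "d \<le> n" for d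
      proof (cases "d > N")
        case True
        then show ?thesis using N lin_map_zero[OF P P mult_lin_map(1)[OF d c[OF ab(2)]]] by simp
      next
        case False
        then have "n - d > N'" using n d by linarith
        then show ?thesis using N lin_map_zero[OF P P mult_lin_map(2)[OF d c[OF ab(1)]]] by simp
      qed
      then have "(\<Oplus>\<^bsub>cpow E n\<^esub>d\<in>{..n}. cmul E d (n - d) (a d) (b (n - d))) = (\<Oplus>\<^bsub>cpow E n\<^esub>d\<in>{..n}. \<zero>\<^bsub>cpow E n\<^esub>)"
        by (intro P.M.finsum_cong') auto
      then show "(a \<otimes>\<^bsub>calg E\<^esub> b) n = \<zero>\<^bsub>cpow E n\<^esub>" by (simp add: algebra_simps')
    qed
  qed
  have one: "\<one>\<^bsub>calg E\<^esub> \<in> carrier (calg E)"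
    by (rule algebra_carrierI[of _ 0]) (simp_all add: algebra_simps' chi_one_closed)
  have assoc: "a \<otimes>\<^bsub>calg E\<^esub> b \<otimes>\<^bsub>calg E\<^esub> e = a \<otimes>\<^bsub>calg E\<^esub> (b \<otimes>\<^bsub>calg E\<^esub> e)"
    if abe: "a \<in> carrier (calg E)" "b \<in> carrier (calg E)" "e \<in> carrier (calg E)" for a b e
  proof
    fix n
    \<comment> \<open>The triple product of the components of degrees \<open>i\<close>,
      \<open>j\<close> and \<open>n - i - j\<close>. One bracketing sums it along diagonals, the
      other along rows.\<close>
    let ?T = "\<lambda>i j. cmul E i (n - i) (a i) (cmul E j (n - i - j) (b j) (e (n - i - j)))"
    have T: "?T i j \<in> carrier (cpow E n)" if "i + j \<le> n" for i j
      using that by (intro mult_closed c abe) auto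
    have T': "?T i (d - i) \<in> carrier (cpow E n)" if "i \<le> d" "d \<le> n" for i d
      using that by (intro T) simp
    have "(a \<otimes>\<^bsub>calg E\<^esub> b \<otimes>\<^bsub>calg E\<^esub> e) n = (\<Oplus>\<^bsub>cpow E n\<^esub>d\<in>{..n}. \<Oplus>\<^bsub>cpow E n\<^esub>i\<in>{..d}. ?T i (d - i))"
      unfolding algebra_simps'(3)[of "a \<otimes>\<^bsub>calg E\<^esub> b"]
    proof (rule P.M.finsum_cong')
      fix d assume "d \<in> {..n}"
      then have d: "d \<le> n" by simp
      have "cmul E d (n - d) ((a \<otimes>\<^bsub>calg E\<^esub> b) d) (e (n - d)) =
          (\<Oplus>\<^bsub>cpow E n\<^esub>i\<in>{..d}. cmul E d (n - d) (cmul E i (d - i) (a i) (b (d - i))) (e (n - d)))"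
        unfolding algebra_simps'(3)
        by (rule lin_map_finsum[OF P P mult_lin_map(1)[OF d c[OF abe(3)]]]) (use mc abe in auto)
      also have "\<dots> = (\<Oplus>\<^bsub>cpow E n\<^esub>i\<in>{..d}. ?T i (d - i))"
      proof (rule P.M.finsum_cong')
        fix i assume "i \<in> {..d}"
        then have i: "i \<le> d" by simp
        show "cmul E d (n - d) (cmul E i (d - i) (a i) (b (d - i))) (e (n - d)) = ?T i (d - i)"
          using chi_mult_assoc[OF c[OF abe(1), of i] c[OF abe(2), of "d - i"] c[OF abe(3), of "n - d"]] i d by simp
      qed (use T' d in blast)+
      finally show "cmul E d (n - d) ((a \<otimes>\<^bsub>calg E\<^esub> b) d) (e (n - d)) = (\<Oplus>\<^bsub>cpow E n\<^esub>i\<in>{..d}. ?T i (d - i))" .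
    qed (rule refl, intro Pi_I P.M.finsum_closed T', simp_all)
    also have "\<dots> = (\<Oplus>\<^bsub>cpow E n\<^esub>i\<in>{..n}. \<Oplus>\<^bsub>cpow E n\<^esub>j\<in>{..n - i}. ?T i j)"
      by (rule P.M.finsum_triangle) (rule T)
    also have "\<dots> = (a \<otimes>\<^bsub>calg E\<^esub> (b \<otimes>\<^bsub>calg E\<^esub> e)) n"
      unfolding algebra_simps'(3)[of a]
    proof (rule P.M.finsum_cong')
      fix i assume "i \<in> {..n}"
      then have i: "i \<le> n" by simp
      show "(\<Oplus>\<^bsub>cpow E n\<^esub>j\<in>{..n - i}. ?T i j) = cmul E i (n - i) (a i) ((b \<otimes>\<^bsub>calg E\<^esub> e) (n - i))"
        unfolding algebra_simps'(3)
        by (rule lin_map_finsum[OF P P mult_lin_map(2)[OF i c[OF abe(1)]], symmetric])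
          (simp, intro Pi_I mc abe, simp)
    qed (use mc abe closed in auto)
    finally show "(a \<otimes>\<^bsub>calg E\<^esub> b \<otimes>\<^bsub>calg E\<^esub> e) n = (a \<otimes>\<^bsub>calg E\<^esub> (b \<otimes>\<^bsub>calg E\<^esub> e)) n" .
  qed
  have l_one: "\<one>\<^bsub>calg E\<^esub> \<otimes>\<^bsub>calg E\<^esub> a = a" if a: "a \<in> carrier (calg E)" for a
  proof
    fix n
    have "(\<Oplus>\<^bsub>cpow E n\<^esub>d\<in>{0}. cmul E d (n - d) (\<one>\<^bsub>calg E\<^esub> d) (a (n - d))) = (\<one>\<^bsub>calg E\<^esub> \<otimes>\<^bsub>calg E\<^esub> a) n"
      unfolding algebra_simps'(3)
    proof (rule finsum_mono_neutral)
      fix d assume "d \<in> {..n} - {0}"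
      then show "cmul E d (n - d) (\<one>\<^bsub>calg E\<^esub> d) (a (n - d)) = \<zero>\<^bsub>cpow E n\<^esub>"
        using lin_map_zero[OF P P mult_lin_map(1)[of d n, OF _ c[OF a]]] by (simp add: algebra_simps')
    qed (use mc[OF one a, of 0] P.M.abelian_monoid_axioms in auto)
    then show "(\<one>\<^bsub>calg E\<^esub> \<otimes>\<^bsub>calg E\<^esub> a) n = a n"
      using chi_mult_one(1)[OF c[OF a]] c[OF a] by (simp add: algebra_simps'(4))
  qed
  have r_one: "a \<otimes>\<^bsub>calg E\<^esub> \<one>\<^bsub>calg E\<^esub> = a" if a: "a \<in> carrier (calg E)" for a
  proof
    fix n
    have "(\<Oplus>\<^bsub>cpow E n\<^esub>d\<in>{n}. cmul E d (n - d) (a d) (\<one>\<^bsub>calg E\<^esub> (n - d))) = (a \<otimes>\<^bsub>calg E\<^esub> \<one>\<^bsub>calg E\<^esub>) n"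
      unfolding algebra_simps'(3)
    proof (rule finsum_mono_neutral)
      fix d assume "d \<in> {..n} - {n}"
      then show "cmul E d (n - d) (a d) (\<one>\<^bsub>calg E\<^esub> (n - d)) = \<zero>\<^bsub>cpow E n\<^esub>"
        using lin_map_zero[OF P P mult_lin_map(2)[of d n, OF _ c[OF a]]] by (simp add: algebra_simps')
    qed (use mc[OF a one, of n n] P.M.abelian_monoid_axioms in auto)
    then show "(a \<otimes>\<^bsub>calg E\<^esub> \<one>\<^bsub>calg E\<^esub>) n = a n"
      using chi_mult_one(2)[OF c[OF a]] c[OF a] by (simp add: algebra_simps'(4))
  qed
  have l_distr: "(a \<oplus>\<^bsub>calg E\<^esub> b) \<otimes>\<^bsub>calg E\<^esub> e = a \<otimes>\<^bsub>calg E\<^esub> e \<oplus>\<^bsub>calg E\<^esub> b \<otimes>\<^bsub>calg E\<^esub> e"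
    if abe: "a \<in> carrier (calg E)" "b \<in> carrier (calg E)" "e \<in> carrier (calg E)" for a b e
  proof
    fix n
    have "((a \<oplus>\<^bsub>calg E\<^esub> b) \<otimes>\<^bsub>calg E\<^esub> e) n = (\<Oplus>\<^bsub>cpow E n\<^esub>d\<in>{..n}. cmul E d (n - d) (a d) (e (n - d)) \<oplus>\<^bsub>cpow E n\<^esub> cmul E d (n - d) (b d) (e (n - d)))"
      unfolding algebra_simps'(3)
      by (rule P.M.finsum_cong')
        (use lin_map_add[OF mult_lin_map(1)[OF _ c[OF abe(3)]] c[OF abe(1)] c[OF abe(2)]] mc abe in \<open>auto simp: algebra_simps'(1)\<close>)
    also have "\<dots> = (a \<otimes>\<^bsub>calg E\<^esub> e \<oplus>\<^bsub>calg E\<^esub> b \<otimes>\<^bsub>calg E\<^esub> e) n"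
      unfolding algebra_simps'(1,3) by (rule P.M.finsum_addf) (use mc abe in auto)
    finally show "((a \<oplus>\<^bsub>calg E\<^esub> b) \<otimes>\<^bsub>calg E\<^esub> e) n = (a \<otimes>\<^bsub>calg E\<^esub> e \<oplus>\<^bsub>calg E\<^esub> b \<otimes>\<^bsub>calg E\<^esub> e) n" .
  qed
  have r_distr: "e \<otimes>\<^bsub>calg E\<^esub> (a \<oplus>\<^bsub>calg E\<^esub> b) = e \<otimes>\<^bsub>calg E\<^esub> a \<oplus>\<^bsub>calg E\<^esub> e \<otimes>\<^bsub>calg E\<^esub> b"
    if abe: "a \<in> carrier (calg E)" "b \<in> carrier (calg E)" "e \<in> carrier (calg E)" for a b e
  proof
    fix n
    have "(e \<otimes>\<^bsub>calg E\<^esub> (a \<oplus>\<^bsub>calg E\<^esub> b)) n = (\<Oplus>\<^bsub>cpow E n\<^esub>d\<in>{..n}. cmul E d (n - d) (e d) (a (n - d)) \<oplus>\<^bsub>cpow E n\<^esub> cmul E d (n - d) (e d) (b (n - d)))"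
      unfolding algebra_simps'(3)
      by (rule P.M.finsum_cong')
        (use lin_map_add[OF mult_lin_map(2)[OF _ c[OF abe(3)]] c[OF abe(1)] c[OF abe(2)]] mc abe in \<open>auto simp: algebra_simps'(1)\<close>)
    also have "\<dots> = (e \<otimes>\<^bsub>calg E\<^esub> a \<oplus>\<^bsub>calg E\<^esub> e \<otimes>\<^bsub>calg E\<^esub> b) n"
      unfolding algebra_simps'(1,3) by (rule P.M.finsum_addf) (use mc abe in auto)
    finally show "(e \<otimes>\<^bsub>calg E\<^esub> (a \<oplus>\<^bsub>calg E\<^esub> b)) n = (e \<otimes>\<^bsub>calg E\<^esub> a \<oplus>\<^bsub>calg E\<^esub> e \<otimes>\<^bsub>calg E\<^esub> b) n" .
  qed
  have "monoid (calg E)" by (rule monoidI) (use closed one assoc l_one r_one in auto)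
  then show ?thesis
    by (intro ringI algebra_abelian_group) (use l_distr r_distr in auto)
qed

end

section \<open>The form on the graded algebra and its adjoints\<close>

context
  fixes E :: "('k, 'e, 'n) module_scheme" and B and \<delta> :: "'e \<Rightarrow> 'e \<Rightarrow> 'k"
  assumes E: "module K E" and \<delta>: "dual_basis K E B \<delta>" and rat: "contains_rat K"
begin


lemma chi_power_form_bilin: "bilin K (cpow E d) (cpow (dual_module K E) d) (self_module K) (cform d)"
proof -
  note D = dual_module_module[OF E] and KM = self_module_module[OF K.is_cring]
  have id: "lin_map K (self_module K) (self_module K) (\<lambda>x. x)" by (auto intro: lin_mapI)
  show ?thesis
    by (rule bilin_descend[OF FT_module[OF E] FT_module[OF D] free_form_bilin[OF E] id cc_lin_map[OF E] CP_carrier[OF E]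
        cc_lin_map[OF D] CP_carrier[OF D]])
      (rule chi_power_form_class[OF E])
qed

lemma chi_power_form_representable:
  assumes \<phi>: "lin_map K (cpow E d) (self_module K) \<phi>"
  shows "\<exists>c\<in>carrier (cpow (dual_module K E) d). \<forall>a\<in>carrier (cpow E d). cform d a c = \<phi> a"
proof -
  note D = dual_module_module[OF E] and KM = self_module_module[OF K.is_cring]
  let ?\<psi> = "\<lambda>u. \<phi> (chi_class K W \<chi> E d u)"
  have "lin_map K (free_tensors K E d) (self_module K) ?\<psi>" by (rule lin_map_comp[OF cc_lin_map[OF E] \<phi>])
  moreover have "?\<psi> u = \<zero>\<^bsub>K\<^esub>" if "chi_class K W \<chi> E d u = \<zero>\<^bsub>cpow E d\<^esub>" for u
    using that lin_map_zero[OF CP_module[OF E] KM \<phi>] by simp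
  ultimately obtain c where c: "c \<in> carrier (free_tensors K (dual_module K E) d)"
    "\<forall>u\<in>carrier (free_tensors K E d). free_form K W \<chi> d u c = ?\<psi> u"
    using form_representable[OF E \<delta> rat, of d ?\<psi>] by blast
  show ?thesis
  proof (rule bexI[of _ "chi_class K W \<chi> (dual_module K E) d c"])
    show "chi_class K W \<chi> (dual_module K E) d c \<in> carrier (cpow (dual_module K E) d)" by (rule lin_map_closed[OF cc_lin_map[OF D] c(1)])
    show "\<forall>a\<in>carrier (cpow E d). cform d a (chi_class K W \<chi> (dual_module K E) d c) = \<phi> a"
      unfolding CP_carrier[OF E] using c chi_power_form_class[OF E _ c(1)] by simp
  qed
qed

lemma chi_power_form_nondegenerate:
  assumes c: "c \<in> carrier (cpow (dual_module K E) d)" "c' \<in> carrier (cpow (dual_module K E) d)"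
    and eq: "\<And>a. a \<in> carrier (cpow E d) \<Longrightarrow> cform d a c = cform d a c'"
  shows "c = c'"
proof -
  note D = dual_module_module[OF E] and KM = self_module_module[OF K.is_cring]
  interpret P': module K "cpow (dual_module K E) d" by (rule CP_module[OF D])
  have m: "c \<ominus>\<^bsub>cpow (dual_module K E) d\<^esub> c' \<in> carrier (cpow (dual_module K E) d)" using c by simp
  then obtain v where v: "v \<in> carrier (free_tensors K (dual_module K E) d)" "c \<ominus>\<^bsub>cpow (dual_module K E) d\<^esub> c' = chi_class K W \<chi> (dual_module K E) d v"
    unfolding CP_carrier[OF D] by blast
  have "free_form K W \<chi> d u v = \<zero>\<^bsub>K\<^esub>" if u: "u \<in> carrier (free_tensors K E d)" for u
  proof -
    let ?a = "chi_class K W \<chi> E d u"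
    have a: "?a \<in> carrier (cpow E d)" by (rule lin_map_closed[OF cc_lin_map[OF E] u])
    have "cform d ?a (c \<ominus>\<^bsub>cpow (dual_module K E) d\<^esub> c') = \<zero>\<^bsub>self_module K\<^esub>"
      using lin_map_kernel_eq[OF CP_module[OF D] KM bilinD(2)[OF chi_power_form_bilin a] c] eq[OF a] by blast
    then show ?thesis using chi_power_form_class[OF E u v(1)] v(2) by simp
  qed
  then have "c \<ominus>\<^bsub>cpow (dual_module K E) d\<^esub> c' = \<zero>\<^bsub>cpow (dual_module K E) d\<^esub>"
    using form_nondegenerate[OF E \<delta> rat v(1)] v(2) by simp
  then show ?thesis using P'.M.diff_eq_zero_iff[OF c] by simp
qed

text \<open>The index set in \<open>chi_form\<close> depends on both arguments. A common range of
  degrees, obtained from a bound on either one of them, allows sums with different arguments to be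
  compared.\<close>

lemma chi_form_bound:
  assumes x: "x \<in> carrier (calg E)" and b: "b \<in> carrier (calg (dual_module K E))" and N: "\<And>d. d > N \<Longrightarrow> x d = \<zero>\<^bsub>cpow E d\<^esub> \<or> b d = \<zero>\<^bsub>cpow (dual_module K E) d\<^esub>"
  shows "chi_form K W \<chi> E x b = (\<Oplus>\<^bsub>K\<^esub>d\<in>{..N}. cform d (x d) (b d))"
  unfolding chi_form_def
proof (rule finsum_mono_neutral)
  note D = dual_module_module[OF E] and KM = self_module_module[OF K.is_cring]
  note xc = algebra_carrierD[OF E x] and bc = algebra_carrierD[OF D b]
  note bz = bilin_zero[OF CP_module[OF E] CP_module[OF D] KM chi_power_form_bilin]
  show "{d. x d \<noteq> \<zero>\<^bsub>cpow E d\<^esub> \<and> b d \<noteq> \<zero>\<^bsub>cpow (dual_module K E) d\<^esub>} \<subseteq> {..N}" using N by (auto simp: not_le[symmetric])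
  show "cform d (x d) (b d) = \<zero>\<^bsub>K\<^esub>" if "d \<in> {..N} - {d. x d \<noteq> \<zero>\<^bsub>cpow E d\<^esub> \<and> b d \<noteq> \<zero>\<^bsub>cpow (dual_module K E) d\<^esub>}" for d
    using that bz(1)[OF bc] bz(2)[OF xc] by auto
  show "(\<lambda>d. cform d (x d) (b d)) \<in> {d. x d \<noteq> \<zero>\<^bsub>cpow E d\<^esub> \<and> b d \<noteq> \<zero>\<^bsub>cpow (dual_module K E) d\<^esub>} \<rightarrow> carrier K"
    using bilin_closed[OF chi_power_form_bilin xc bc] by simp
qed (simp_all add: K.abelian_monoid_axioms)

lemma form_closed: "x \<in> carrier (calg E) \<Longrightarrow> b \<in> carrier (calg (dual_module K E)) \<Longrightarrow> cform d (x d) (b d) \<in> carrier K"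
  using bilin_closed[OF chi_power_form_bilin algebra_carrierD[OF E] algebra_carrierD[OF dual_module_module[OF E]]] by simp

lemma chi_form_biadditive:
  shows "x \<in> carrier (calg E) \<Longrightarrow> b \<in> carrier (calg (dual_module K E)) \<Longrightarrow> chi_form K W \<chi> E x b \<in> carrier K"
    and "x \<in> carrier (calg E) \<Longrightarrow> y \<in> carrier (calg E) \<Longrightarrow> b \<in> carrier (calg (dual_module K E)) \<Longrightarrow>
      chi_form K W \<chi> E (x \<oplus>\<^bsub>calg E\<^esub> y) b = chi_form K W \<chi> E x b \<oplus>\<^bsub>K\<^esub> chi_form K W \<chi> E y b"
    and "x \<in> carrier (calg E) \<Longrightarrow> b \<in> carrier (calg (dual_module K E)) \<Longrightarrow> b' \<in> carrier (calg (dual_module K E)) \<Longrightarrow>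
      chi_form K W \<chi> E x (b \<oplus>\<^bsub>calg (dual_module K E)\<^esub> b') = chi_form K W \<chi> E x b \<oplus>\<^bsub>K\<^esub> chi_form K W \<chi> E x b'"
proof -
  note D = dual_module_module[OF E]
  interpret A: abelian_group "calg E" by (rule algebra_abelian_group[OF E])
  interpret A': abelian_group "calg (dual_module K E)" by (rule algebra_abelian_group[OF D])
  show "chi_form K W \<chi> E x b \<in> carrier K" if xb: "x \<in> carrier (calg E)" "b \<in> carrier (calg (dual_module K E))" for x b
  proof -
    obtain N where "\<forall>d>N. b d = \<zero>\<^bsub>cpow (dual_module K E) d\<^esub>" using xb(2) by (auto simp: algebra_carrier_iff[OF D])
    then show ?thesis using chi_form_bound[OF xb, of N] form_closed[OF xb] by (auto intro!: K.finsum_closed)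
  qed
  show "chi_form K W \<chi> E (x \<oplus>\<^bsub>calg E\<^esub> y) b = chi_form K W \<chi> E x b \<oplus>\<^bsub>K\<^esub> chi_form K W \<chi> E y b"
    if x: "x \<in> carrier (calg E)" and y: "y \<in> carrier (calg E)" and b: "b \<in> carrier (calg (dual_module K E))" for x y b
  proof -
    obtain N where N: "\<And>d. d > N \<Longrightarrow> b d = \<zero>\<^bsub>cpow (dual_module K E) d\<^esub>" using b by (auto simp: algebra_carrier_iff[OF D])
    have "cform d ((x \<oplus>\<^bsub>calg E\<^esub> y) d) (b d) = cform d (x d) (b d) \<oplus>\<^bsub>K\<^esub> cform d (y d) (b d)" for d
      using lin_map_add[OF bilinD(1)[OF chi_power_form_bilin algebra_carrierD[OF D b]] algebra_carrierD[OF E x] algebra_carrierD[OF E y]]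
      by (simp add: algebra_simps'(1)[OF E])
    then show ?thesis
      using N x y b form_closed[OF x b] form_closed[OF y b] by (simp add: chi_form_bound[of _ _ N] K.finsum_addf)
  qed
  show "chi_form K W \<chi> E x (b \<oplus>\<^bsub>calg (dual_module K E)\<^esub> b') = chi_form K W \<chi> E x b \<oplus>\<^bsub>K\<^esub> chi_form K W \<chi> E x b'"
    if x: "x \<in> carrier (calg E)" and b: "b \<in> carrier (calg (dual_module K E))" and b': "b' \<in> carrier (calg (dual_module K E))" for x b b'
  proof -
    obtain N where N: "\<And>d. d > N \<Longrightarrow> x d = \<zero>\<^bsub>cpow E d\<^esub>" using x by (auto simp: algebra_carrier_iff[OF E])
    have "cform d (x d) ((b \<oplus>\<^bsub>calg (dual_module K E)\<^esub> b') d) = cform d (x d) (b d) \<oplus>\<^bsub>K\<^esub> cform d (x d) (b' d)" for d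
      using lin_map_add[OF bilinD(2)[OF chi_power_form_bilin algebra_carrierD[OF E x]] algebra_carrierD[OF D b] algebra_carrierD[OF D b']]
      by (simp add: algebra_simps'(1)[OF D])
    then show ?thesis
      using N x b b' form_closed[OF x b] form_closed[OF x b'] by (simp add: chi_form_bound[of _ _ N] K.finsum_addf)
  qed
qed

text \<open>Homogeneous test elements isolate one degree, where nondegeneracy of the form on that
  power applies.\<close>

lemma chi_form_injective:
  assumes c: "c \<in> carrier (calg (dual_module K E))" "c' \<in> carrier (calg (dual_module K E))"
    and eq: "\<And>x. x \<in> carrier (calg E) \<Longrightarrow> chi_form K W \<chi> E x c = chi_form K W \<chi> E x c'"
  shows "c = c'"
proof
  fix d
  note D = dual_module_module[OF E] and KM = self_module_module[OF K.is_cring]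
  interpret P: module K "cpow E e" for e by (rule CP_module[OF E])
  show "c d = c' d"
  proof (rule chi_power_form_nondegenerate)
    fix a assume a: "a \<in> carrier (cpow E d)"
    let ?x = "\<lambda>e. if e = d then a else \<zero>\<^bsub>cpow E e\<^esub>"
    have x: "?x \<in> carrier (calg E)" by (rule algebra_carrierI[OF E, of _ d]) (use a in auto)
    have *: "chi_form K W \<chi> E ?x b = cform d a (b d)" if b: "b \<in> carrier (calg (dual_module K E))" for b
    proof -
      note bc = algebra_carrierD[OF D b]
      have z: "cform e \<zero>\<^bsub>cpow E e\<^esub> (b e) = \<zero>\<^bsub>K\<^esub>" for e
        using bilin_zero(1)[OF CP_module[OF E] CP_module[OF D] KM chi_power_form_bilin bc] by simp
      have fa: "cform d a (b d) \<in> carrier K" using bilin_closed[OF chi_power_form_bilin a bc] by simp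
      have "chi_form K W \<chi> E ?x b = (\<Oplus>\<^bsub>K\<^esub>e\<in>{..d}. cform e (?x e) (b e))"
        by (rule chi_form_bound[OF x b]) auto
      also have "\<dots> = (\<Oplus>\<^bsub>K\<^esub>e\<in>{d}. cform e (?x e) (b e))"
        by (rule finsum_mono_neutral[symmetric]) (use z fa K.abelian_monoid_axioms in auto)
      finally show ?thesis using fa by simp
    qed
    show "cform d a (c d) = cform d a (c' d)" using eq[OF x] *[OF c(1)] *[OF c(2)] by simp
  qed (use c algebra_carrierD[OF D] in auto)
qed

text \<open>The component of the adjoint in degree \<open>d\<close> represents the functional that
  multiplies \<open>y\<close> by the components of \<open>a\<close> and pairs the results with those
  of \<open>b\<close>. It exists because the form represents every functional in each
  degree.\<close>

lemma chi_form_adjoint: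
  assumes a: "a \<in> carrier (calg E)" and b: "b \<in> carrier (calg (dual_module K E))"
  shows "\<exists>c\<in>carrier (calg (dual_module K E)). \<forall>x\<in>carrier (calg E). chi_form K W \<chi> E (x \<otimes>\<^bsub>calg E\<^esub> a) b = chi_form K W \<chi> E x c"
proof -
  note D = dual_module_module[OF E] and KM = self_module_module[OF K.is_cring]
  have P: "module K (cpow E d)" for d by (rule CP_module[OF E])
  interpret P: module K "cpow E d" for d by (rule P)
  interpret P': module K "cpow (dual_module K E) d" for d by (rule CP_module[OF D])
  interpret A: ring "calg E" by (rule algebra_ring[OF E])
  note ac = algebra_carrierD[OF E a] and bc = algebra_carrierD[OF D b]
  obtain N where N: "\<And>d. d > N \<Longrightarrow> b d = \<zero>\<^bsub>cpow (dual_module K E) d\<^esub>" using b by (auto simp: algebra_carrier_iff[OF D])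
  \<comment> \<open>The contribution of degree \<open>n\<close> of \<open>b\<close>. The value zero
    for \<open>d > n\<close> lets both degrees range over \<open>{..N}\<close> independently, so
    that the two sums can be interchanged.\<close>
  define \<psi> where "\<psi> d n y = (if d \<le> n then cform n (chi_mult K W \<chi> E d (n - d) y (a (n - d))) (b n) else \<zero>\<^bsub>K\<^esub>)" for d n y
  have psi_lin: "lin_map K (cpow E d) (self_module K) (\<psi> d n)" for d n
  proof (cases "d \<le> n")
    case True
    then show ?thesis
      using lin_map_comp[OF mult_lin_map(1)[OF E True ac] bilinD(1)[OF chi_power_form_bilin bc]] by (simp add: \<psi>_def[abs_def])
  next
    case False
    then show ?thesis by (intro lin_mapI) (simp_all add: \<psi>_def)
  qed
  define \<phi> where "\<phi> d y = (\<Oplus>\<^bsub>self_module K\<^esub>n\<in>{..N}. \<psi> d n y)" for d y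
  have "\<exists>c\<in>carrier (cpow (dual_module K E) d). \<forall>y\<in>carrier (cpow E d). cform d y c = \<phi> d y" for d
    by (rule chi_power_form_representable) (unfold \<phi>_def, rule lin_map_sum[OF KM _ psi_lin], simp)
  then obtain c0 where c0: "\<And>d. c0 d \<in> carrier (cpow (dual_module K E) d)" "\<And>d y. y \<in> carrier (cpow E d) \<Longrightarrow> cform d y (c0 d) = \<phi> d y"
    by metis
  \<comment> \<open>Cutting off at the degree bound of \<open>b\<close> gives finite support; above
    it, no component of \<open>b\<close> is left to pair with.\<close>
  define c where "c d = (if d \<le> N then c0 d else \<zero>\<^bsub>cpow (dual_module K E) d\<^esub>)" for d
  have c: "c \<in> carrier (calg (dual_module K E))" by (rule algebra_carrierI[OF D, of _ N]) (simp_all add: c_def c0)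
  have "chi_form K W \<chi> E (x \<otimes>\<^bsub>calg E\<^esub> a) b = chi_form K W \<chi> E x c" if x: "x \<in> carrier (calg E)" for x
  proof -
    note xc = algebra_carrierD[OF E x]
    have psi_c: "\<psi> d n (x d) \<in> carrier K" for d n using lin_map_closed[OF psi_lin xc] by simp
    have "chi_form K W \<chi> E (x \<otimes>\<^bsub>calg E\<^esub> a) b = (\<Oplus>\<^bsub>K\<^esub>n\<in>{..N}. cform n ((x \<otimes>\<^bsub>calg E\<^esub> a) n) (b n))"
      by (rule chi_form_bound[OF A.m_closed[OF x a] b]) (use N in blast)
    also have "\<dots> = (\<Oplus>\<^bsub>K\<^esub>n\<in>{..N}. \<Oplus>\<^bsub>K\<^esub>d\<in>{..N}. \<psi> d n (x d))"
    proof (rule K.finsum_cong')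
      fix n assume n: "n \<in> {..N}"
      have "cform n ((x \<otimes>\<^bsub>calg E\<^esub> a) n) (b n) = (\<Oplus>\<^bsub>self_module K\<^esub>d\<in>{..n}. cform n (chi_mult K W \<chi> E d (n - d) (x d) (a (n - d))) (b n))"
        unfolding algebra_simps'(3)[OF E]
        by (rule lin_map_finsum[OF P KM bilinD(1)[OF chi_power_form_bilin bc]]) (use mult_closed[OF E xc ac] in auto)
      also have "\<dots> = (\<Oplus>\<^bsub>K\<^esub>d\<in>{..n}. \<psi> d n (x d))"
        unfolding self_module_simps by (rule K.finsum_cong') (use psi_c in \<open>auto simp: \<psi>_def\<close>)
      also have "\<dots> = (\<Oplus>\<^bsub>K\<^esub>d\<in>{..N}. \<psi> d n (x d))"
        by (rule finsum_mono_neutral) (use psi_c n K.abelian_monoid_axioms in \<open>auto simp: \<psi>_def\<close>)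
      finally show "cform n ((x \<otimes>\<^bsub>calg E\<^esub> a) n) (b n) = (\<Oplus>\<^bsub>K\<^esub>d\<in>{..N}. \<psi> d n (x d))" .
    qed (use psi_c in \<open>auto intro!: K.finsum_closed\<close>)
    also have "\<dots> = (\<Oplus>\<^bsub>K\<^esub>d\<in>{..N}. \<Oplus>\<^bsub>K\<^esub>n\<in>{..N}. \<psi> d n (x d))"
      by (rule K.finsum_swap) (use psi_c in auto)
    also have "\<dots> = (\<Oplus>\<^bsub>K\<^esub>d\<in>{..N}. cform d (x d) (c d))"
      by (rule K.finsum_cong') (use c0(2)[OF xc] form_closed[OF x c] in \<open>auto simp: c_def \<phi>_def\<close>)
    also have "\<dots> = chi_form K W \<chi> E x c"
      by (rule chi_form_bound[OF x c, symmetric]) (simp add: c_def)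
    finally show ?thesis .
  qed
  then show ?thesis using c by blast
qed

lemma left_inner_module: "left_unital_module (calg E) (calg (dual_module K E)) (left_inner K W \<chi> E)"
  by (rule left_unital_module_adjoint[OF algebra_ring[OF E] algebra_abelian_group[OF dual_module_module[OF E]]
      K.abelian_monoid_axioms chi_form_biadditive chi_form_injective chi_form_adjoint])
    (simp_all add: left_inner_def)

end

end

theorem proposition25:
  fixes K :: "('k, 'm) ring_scheme"
    and W :: "nat \<Rightarrow> (nat \<Rightarrow> nat) set"
    and \<chi> :: "nat \<Rightarrow> (nat \<Rightarrow> nat) \<Rightarrow> 'k"
    and E :: "('k, 'e, 'n) module_scheme"
  assumes "domain K"
    and "contains_rat K"
    and "omega_invariant K W \<chi>"
    and "module K E"
    and "\<exists>B. finite B \<and> module_basis K E B"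
  shows "left_unital_module (chi_algebra K W \<chi> E) (chi_algebra K W \<chi> (dual_module K E))
           (left_inner K W \<chi> E)"
proof -
  obtain B \<delta> where "dual_basis K E B \<delta>"
    using module_basis_dual_basis assms(4,5) by blast
  moreover have "omega_character K W \<chi>"
    using assms(1,3) by (simp add: omega_character_def omega_character_axioms_def domain.axioms(1))
  ultimately show ?thesis
    using omega_character.left_inner_module assms(2,4) by blast
qed

end
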